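(* Let $\alpha>-1/2$, $0<\gamma\le1$, $0<\zeta<\infty$, and let $A(x)=\sqrt{\gamma\pi}\,J_\alpha(\sqrt x)$, $B(x)=xA'(x)$ for $x>0$, where $J_\alpha$ is the Bessel function of order $\alpha$. Let $S_\zeta$ be the operator on $L^2(0,\zeta)$ $$(S_\zeta f)(x)=f(x)+\int_0^\zeta k(x,t)f(t)\,dt,\qquad k(x,t)=-\frac{A(x)B(t)-A(t)B(x)}{\pi(x-t)} .$$ Then $S_\zeta$ is positive, invertible and factorable, and the operator $K_\zeta=I-S_\zeta$ belongs to the trace class.
   Context: For $0\le\mu\le\zeta$ let $(\mathcal P_\mu f)(x)=f(x)$ for $\mu\le x\le\zeta$ and $(\mathcal P_\mu f)(x)=0$ for $0\le x<\mu$, $f\in L^2(0,\zeta)$. An operator $S$ on $L^2(0,\zeta)$ is factorable (admits triangular factorization) if $S=S_-^*S_-$ where $S_-$ and $S_-^{-1}$ are bounded on $L^2(0,\zeta)$ and $S_-^{\pm1}\mathcal P_\mu=\mathcal P_\mu S_-^{\pm1}\mathcal P_\mu$ for all $\mu$. *)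

theory Defs
  imports "HOL-Analysis.Analysis"
begin

subsection \<open>The complex Hilbert space $L^2(M)$ and its bounded operators\<close>

text \<open>
  Elements of $L^2(M)$ are represented by square-integrable functions, and two
  representatives are identified when they agree almost everywhere.  An operator is a map on
  representatives of which only the action on \<open>L2 M\<close>, up to a.e. equality, matters.
\<close>

definition L2 :: "'a measure \<Rightarrow> ('a \<Rightarrow> complex) set" where
  "L2 M = {f \<in> borel_measurable M. integrable M (\<lambda>x. (norm (f x))\<^sup>2)}"

definition L2_inner :: "'a measure \<Rightarrow> ('a \<Rightarrow> complex) \<Rightarrow> ('a \<Rightarrow> complex) \<Rightarrow> complex" where
  "L2_inner M f g = (LINT x|M. f x * cnj (g x))"

definition L2_norm :: "'a measure \<Rightarrow> ('a \<Rightarrow> complex) \<Rightarrow> real" where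
  "L2_norm M f = sqrt (LINT x|M. (norm (f x))\<^sup>2)"

type_synonym 'a operator = "('a \<Rightarrow> complex) \<Rightarrow> ('a \<Rightarrow> complex)"

definition op_eq :: "'a measure \<Rightarrow> 'a operator \<Rightarrow> 'a operator \<Rightarrow> bool" where
  "op_eq M S T \<longleftrightarrow> (\<forall>f\<in>L2 M. AE x in M. S f x = T f x)"

text \<open>
  Compatibility with a.e. equality is not a separate clause: by additivity and the norm bound,
  \<open>T f\<close> and \<open>T g\<close> agree a.e. whenever \<open>f\<close> and \<open>g\<close> do.
\<close>

definition bounded_op :: "'a measure \<Rightarrow> 'a operator \<Rightarrow> bool" where
  "bounded_op M T \<longleftrightarrow>
     (\<forall>f\<in>L2 M. T f \<in> L2 M) \<and>
     (\<forall>f\<in>L2 M. \<forall>g\<in>L2 M. AE x in M. T (\<lambda>y. f y + g y) x = T f x + T g x) \<and>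
     (\<forall>c. \<forall>f\<in>L2 M. AE x in M. T (\<lambda>y. c * f y) x = c * T f x) \<and>
     (\<exists>C. \<forall>f\<in>L2 M. L2_norm M (T f) \<le> C * L2_norm M f)"

definition is_adjoint :: "'a measure \<Rightarrow> 'a operator \<Rightarrow> 'a operator \<Rightarrow> bool" where
  "is_adjoint M T T' \<longleftrightarrow> bounded_op M T \<and> bounded_op M T' \<and>
     (\<forall>f\<in>L2 M. \<forall>g\<in>L2 M. L2_inner M (T f) g = L2_inner M f (T' g))"

definition positive_op :: "'a measure \<Rightarrow> 'a operator \<Rightarrow> bool" where
  "positive_op M T \<longleftrightarrow> bounded_op M T \<and>
     (\<forall>f\<in>L2 M. L2_inner M (T f) f \<in> \<real> \<and> 0 \<le> Re (L2_inner M (T f) f))"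

definition is_inverse :: "'a measure \<Rightarrow> 'a operator \<Rightarrow> 'a operator \<Rightarrow> bool" where
  "is_inverse M T R \<longleftrightarrow> bounded_op M T \<and> bounded_op M R \<and>
     op_eq M (T \<circ> R) id \<and> op_eq M (R \<circ> T) id"

definition invertible_op :: "'a measure \<Rightarrow> 'a operator \<Rightarrow> bool" where
  "invertible_op M T \<longleftrightarrow> (\<exists>R. is_inverse M T R)"

text \<open>An orthonormal basis is a maximal orthonormal set.\<close>

definition is_onb :: "'a measure \<Rightarrow> ('a \<Rightarrow> complex) set \<Rightarrow> bool" where
  "is_onb M E \<longleftrightarrow> E \<subseteq> L2 M \<and>
     (\<forall>e\<in>E. \<forall>e'\<in>E. L2_inner M e e' = (if e = e' then 1 else 0)) \<and>
     (\<forall>f\<in>L2 M. (\<forall>e\<in>E. L2_inner M f e = 0) \<longrightarrow> (AE x in M. f x = 0))"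

text \<open>\<open>P\<close> is the absolute value of \<open>T\<close>, i.e. the positive square root of $T^*T$.\<close>

definition is_abs_op :: "'a measure \<Rightarrow> 'a operator \<Rightarrow> 'a operator \<Rightarrow> bool" where
  "is_abs_op M T P \<longleftrightarrow> positive_op M P \<and>
     (\<exists>T'. is_adjoint M T T' \<and> op_eq M (P \<circ> P) (T' \<circ> T))"

text \<open>
  \<open>T\<close> is of trace class if $\sum_{e \in E} \langle |T| e, e\rangle < \infty$ for some orthonormal
  basis \<open>E\<close>; the sum of these nonnegative terms is the same for every basis.
\<close>

definition trace_class_op :: "'a measure \<Rightarrow> 'a operator \<Rightarrow> bool" where
  "trace_class_op M T \<longleftrightarrow> bounded_op M T \<and>
     (\<exists>P E. is_abs_op M T P \<and> is_onb M E \<and> (\<lambda>e. L2_inner M (P e) e) summable_on E)"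

subsection \<open>Triangular factorization on $L^2(0,\zeta)$\<close>

abbreviation interval_lborel :: "real \<Rightarrow> real measure" where
  "interval_lborel \<zeta> \<equiv> restrict_space lborel {0<..<\<zeta>}"

definition trunc_op :: "real \<Rightarrow> real \<Rightarrow> real operator" where
  "trunc_op \<zeta> \<mu> f = (\<lambda>x. if \<mu> \<le> x \<and> x \<le> \<zeta> then f x else 0)"

definition factorable :: "real \<Rightarrow> real operator \<Rightarrow> bool" where
  "factorable \<zeta> S \<longleftrightarrow> (\<exists>V V' R.
     is_adjoint (interval_lborel \<zeta>) V V' \<and> is_inverse (interval_lborel \<zeta>) V R \<and>
     op_eq (interval_lborel \<zeta>) S (V' \<circ> V) \<and>
     (\<forall>\<mu>\<in>{0..\<zeta>}.
        op_eq (interval_lborel \<zeta>) (V \<circ> trunc_op \<zeta> \<mu>) (trunc_op \<zeta> \<mu> \<circ> V \<circ> trunc_op \<zeta> \<mu>) \<and>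
        op_eq (interval_lborel \<zeta>) (R \<circ> trunc_op \<zeta> \<mu>) (trunc_op \<zeta> \<mu> \<circ> R \<circ> trunc_op \<zeta> \<mu>)))"

subsection \<open>The Bessel kernel operator\<close>

text \<open>
  Bessel function of the first kind of real order, for real argument \<open>z > 0\<close> only:
  \<open>powr\<close> is not the intended power for \<open>z \<le> 0\<close>.  Here \<open>rGamma\<close> is $1/\Gamma$.
\<close>

definition bessel_J :: "real \<Rightarrow> real \<Rightarrow> real" where
  "bessel_J \<alpha> z =
     (\<Sum>m. (-1) ^ m / fact m * rGamma (real m + \<alpha> + 1) * (z / 2) powr (2 * real m + \<alpha>))"

definition bessel_A :: "real \<Rightarrow> real \<Rightarrow> real \<Rightarrow> real" where
  "bessel_A \<alpha> \<gamma> x = sqrt (\<gamma> * pi) * bessel_J \<alpha> (sqrt x)"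

definition bessel_B :: "real \<Rightarrow> real \<Rightarrow> real \<Rightarrow> real" where
  "bessel_B \<alpha> \<gamma> x = x * deriv (bessel_A \<alpha> \<gamma>) x"

text \<open>On the diagonal, a null set, the kernel takes the irrelevant value \<open>0\<close> (division by zero).\<close>

definition bessel_kernel :: "real \<Rightarrow> real \<Rightarrow> real \<Rightarrow> real \<Rightarrow> real" where
  "bessel_kernel \<alpha> \<gamma> x t =
     - (bessel_A \<alpha> \<gamma> x * bessel_B \<alpha> \<gamma> t - bessel_A \<alpha> \<gamma> t * bessel_B \<alpha> \<gamma> x) / (pi * (x - t))"

definition bessel_S :: "real \<Rightarrow> real \<Rightarrow> real \<Rightarrow> real operator" where
  "bessel_S \<alpha> \<gamma> \<zeta> f =
     (\<lambda>x. f x + (LINT t|interval_lborel \<zeta>. complex_of_real (bessel_kernel \<alpha> \<gamma> x t) * f t))"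

definition bessel_K :: "real \<Rightarrow> real \<Rightarrow> real \<Rightarrow> real operator" where
  "bessel_K \<alpha> \<gamma> \<zeta> f = (\<lambda>x. f x - bessel_S \<alpha> \<gamma> \<zeta> f x)"

end

theory Submission
  imports Defs "HOL-Complex_Analysis.Complex_Analysis"
begin

text \<open>
  Let $h(s,x) = \frac12 J_\alpha(\sqrt{sx})$ be the kernel of the Hankel transform and let $T$ be
  the integral operator from $L^2(0,\zeta)$ to $L^2(0,1)$ with kernel $h$.  Bessel's equation turns
  the given quotient into $K_\zeta = \gamma T^*T$, so $K_\zeta$ is positive and of trace class.

  For $\varepsilon > 0$ the integral $\int_0^\infty e^{-\varepsilon s} h(s,x) h(s,t)\, ds$ is a
  positive kernel (Weber's second exponential integral) which fixes $x^{\alpha/2}$; by Schur's test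
  it has norm at most $1$, and $\varepsilon \to 0$ shows that the Hankel transform is a contraction.
  It cannot preserve the norm of a function supported in $(0,\zeta)$ already on $(0,1)$, because the
  transform of such a function is a power times an entire function.  Hence $\|T\| < 1$.

  For a symmetric kernel $k$ of norm less than $1$, solve $r(x,t) = k(x,t) +
  \int_t^\zeta k(x,u)\, r(u,t)\, du$ by a Neumann series.  If $R$ is the identity plus the part of
  $r$ below the diagonal, then $(I - K) R$ is upper triangular, $R^*(I-K)R$ is both upper triangular
  and self-adjoint, hence equal to $I$, and $R$ is inverted by the lower triangular
  $V = R^*(I-K)$.
\<close>

text \<open>That each nonzero \<open>f\<close> is strictly shortened by \<open>T\<close> does not
  give a constant below 1; this needs compactness, obtained here by letting the kernels of the
  powers K^(2^j) converge. The constant must be uniform because the Neumann series is run in every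
  column t, with K truncated to (t, zeta); each truncation inherits the bound \<open>q\<close>. The
  integral of h(s,x) h(s,t) over the half-line does not converge absolutely, since the Bessel
  function oscillates with only power decay. This is why the damping exp(-eps s) enters, and with it
  the modified Bessel function, whose positivity is what Schur's test needs. All kernels are
  dominated by C a(x) b(y) with a and b square integrable. On (0, zeta) the choice is x^(alpha/2),
  the size of J_alpha(sqrt x) at 0, which is unbounded for alpha < 0. Such kernels are closed under
  composition and have square-integrable rows and columns at every point, so products of operators
  can be computed as pointwise identities between kernels.\<close>

section \<open>Square-integrable functions\<close>

text \<open>These notions repeat \<open>L2\<close> and \<open>L2_norm\<close> for values in any
  Euclidean space, so that real kernels, their rows and complex functions share one theory. For
  complex values \<open>inn\<close> is the real part of \<open>L2_inner\<close>.\<close>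

definition sq :: "'a measure \<Rightarrow> ('a \<Rightarrow> 'b::euclidean_space) \<Rightarrow> bool" where
  "sq M f \<longleftrightarrow> f \<in> borel_measurable M \<and> integrable M (\<lambda>x. (norm (f x))^2)"

definition nrm :: "'a measure \<Rightarrow> ('a \<Rightarrow> 'b::euclidean_space) \<Rightarrow> real" where
  "nrm M f = sqrt (LINT x|M. (norm (f x))^2)"

definition inn :: "'a measure \<Rightarrow> ('a \<Rightarrow> 'b::euclidean_space) \<Rightarrow> ('a \<Rightarrow> 'b) \<Rightarrow> real" where
  "inn M f g = (LINT x|M. f x \<bullet> g x)"

lemma L2_iff_sq: "f \<in> L2 M \<longleftrightarrow> sq M f"
  by (simp add: L2_def sq_def)

lemma L2_norm_eq_nrm: "L2_norm M f = nrm M f"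
  by (simp add: L2_norm_def nrm_def)

lemma sq_measurable: "sq M f \<Longrightarrow> f \<in> borel_measurable M"
  by (simp add: sq_def)

lemma sq_integrable: "sq M f \<Longrightarrow> integrable M (\<lambda>x. (norm (f x))^2)"
  by (simp add: sq_def)

lemma nrm_nonneg: "0 \<le> nrm M f"
  by (simp add: nrm_def)

lemma nrm_sq: "(nrm M f)^2 = (LINT x|M. (norm (f x))^2)"
  by (simp add: nrm_def)

lemma sq_bound:
  assumes "f \<in> borel_measurable M" "integrable M g" "\<And>x. x \<in> space M \<Longrightarrow> (norm (f x))^2 \<le> g x"
  shows "sq M f"
  unfolding sq_def
proof
  show "integrable M (\<lambda>x. (norm (f x))^2)"
    by (rule Bochner_Integration.integrable_bound[OF assms(2)]) (use assms(1) in measurable,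
        auto intro!: AE_I2 order_trans[OF assms(3) abs_ge_self])
qed fact

lemma sq_norm: "sq M f \<Longrightarrow> sq M (\<lambda>x. norm (f x))"
  by (auto simp: sq_def)

lemma sq_scaleR: "sq M f \<Longrightarrow> sq M (\<lambda>x. c *\<^sub>R f x)"
  by (auto simp: sq_def power_mult_distrib)

lemma sq_uminus: "sq M f \<Longrightarrow> sq M (\<lambda>x. - f x)"
  by (auto simp: sq_def)

lemma sq_add:
  assumes "sq M f" "sq M g"
  shows "sq M (\<lambda>x. f x + g x)"
proof (rule sq_bound)
  show "(\<lambda>x. f x + g x) \<in> borel_measurable M"
    using assms by (auto simp: sq_def)
  show "integrable M (\<lambda>x. 2 * (norm (f x))^2 + 2 * (norm (g x))^2)"
    using assms by (auto simp: sq_def)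
  fix x
  have "(norm (f x + g x))^2 \<le> (norm (f x) + norm (g x))^2"
    by (intro power_mono norm_triangle_ineq) auto
  also have "\<dots> \<le> 2 * (norm (f x))^2 + 2 * (norm (g x))^2"
    using sum_squares_bound[of "norm (f x)" "norm (g x)"] by (simp add: power2_sum)
  finally show "(norm (f x + g x))^2 \<le> 2 * (norm (f x))^2 + 2 * (norm (g x))^2" .
qed

lemma sq_diff: "sq M f \<Longrightarrow> sq M g \<Longrightarrow> sq M (\<lambda>x. f x - g x)"
  using sq_add[of M f "\<lambda>x. - g x"] sq_uminus[of M g] by simp

lemma sq_integrable_norm_mult:
  assumes "sq M f" "sq M g"
  shows "integrable M (\<lambda>x. norm (f x) * norm (g x))"
proof (rule Bochner_Integration.integrable_bound)
  show "integrable M (\<lambda>x. (norm (f x))^2 + (norm (g x))^2)"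
    using assms by (auto simp: sq_def)
  show "(\<lambda>x. norm (f x) * norm (g x)) \<in> borel_measurable M"
    using assms by (auto simp: sq_def)
  have "norm (f x) * norm (g x) \<le> (norm (f x))^2 + (norm (g x))^2" for x
  proof -
    have "2 * (norm (f x) * norm (g x)) \<le> (norm (f x))^2 + (norm (g x))^2"
      using sum_squares_bound[of "norm (f x)" "norm (g x)"] by (simp add: mult.assoc)
    moreover have "0 \<le> norm (f x) * norm (g x)" by simp
    ultimately show ?thesis by linarith
  qed
  then show "AE x in M. norm (norm (f x) * norm (g x)) \<le> norm ((norm (f x))^2 + (norm (g x))^2)"
    by (auto intro!: AE_I2)
qed

lemma sq_integrable_bound:
  fixes h :: "'a \<Rightarrow> 'c::euclidean_space"
  assumes "sq M f" "sq M g" "h \<in> borel_measurable M"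
    "\<And>x. x \<in> space M \<Longrightarrow> norm (h x) \<le> C * (norm (f x) * norm (g x))"
  shows "integrable M h"
  by (rule Bochner_Integration.integrable_bound[OF
        integrable_mult_right[OF sq_integrable_norm_mult[OF assms(1,2)], of C]])
    (use assms(3) in measurable, auto intro!: AE_I2 order_trans[OF assms(4) abs_ge_self])

text \<open>The norms stand inside the integral because Fubini needs bounds for integrals of
  absolute values. The proof is the discriminant argument for the quadratic form of s |f| - t
  |g|.\<close>

lemma Cauchy_Schwarz_norm:
  assumes f: "sq M f" and g: "sq M g"
  shows "(LINT x|M. norm (f x) * norm (g x)) \<le> nrm M f * nrm M g"
proof -
  define F where "F = (LINT x|M. (norm (f x))^2)"
  define G where "G = (LINT x|M. (norm (g x))^2)"
  define B where "B = (LINT x|M. norm (f x) * norm (g x))"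
  have nn: "0 \<le> F" "0 \<le> G" "0 \<le> B"
    unfolding F_def G_def B_def by auto
  have I: "integrable M (\<lambda>x. norm (f x) * norm (g x))"
    by (rule sq_integrable_norm_mult[OF f g])
  have quad: "0 \<le> F * s^2 - 2 * s * t * B + G * t^2" for s t
  proof -
    have "0 \<le> (LINT x|M. (s * norm (f x) - t * norm (g x))^2)"
      by simp
    also have "\<dots> = (LINT x|M. s^2 * (norm (f x))^2 - 2 * s * t * (norm (f x) * norm (g x)) + t^2 * (norm (g x))^2)"
      by (intro Bochner_Integration.integral_cong) (auto simp: power2_eq_square algebra_simps)
    also have "\<dots> = s^2 * F - 2 * s * t * B + t^2 * G"
      unfolding F_def G_def B_def using f g I by (simp add: sq_def)
    finally show ?thesis by (simp add: algebra_simps)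
  qed
  have "B^2 \<le> F * G"
  proof (cases "G = 0")
    case True
    have "B = 0"
    proof (rule ccontr)
      assume "B \<noteq> 0"
      then have "B > 0" using nn by simp
      \<comment> \<open>With \<open>G = 0\<close> the form is linear in t; this t brings its value
        to -1.\<close>
      have "0 \<le> F - 2 * B * ((F + 1) / (2 * B))"
        using quad[of 1 "(F + 1) / (2 * B)"] True by (simp add: algebra_simps)
      then show False using \<open>B > 0\<close> by simp
    qed
    then show ?thesis using True by simp
  next
    case False
    then have "G > 0" using nn by simp
    have "0 \<le> F * G^2 - 2 * G * B * B + G * B^2" using quad[of G B] by simp
    also have "\<dots> = G * (F * G - B^2)" by (simp add: power2_eq_square algebra_simps)
    finally show ?thesis using \<open>G > 0\<close> by (simp add: zero_le_mult_iff)
  qed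
  then have "B \<le> sqrt (F * G)" by (rule real_le_rsqrt)
  then show ?thesis using nn unfolding nrm_def F_def[symmetric] G_def[symmetric] B_def[symmetric]
    by (simp add: real_sqrt_mult)
qed

lemma sq_integrable_inner:
  assumes "sq M f" "sq M g"
  shows "integrable M (\<lambda>x. f x \<bullet> g x)"
  by (rule sq_integrable_bound[OF assms, where C = 1])
    (use assms in \<open>auto simp: sq_def Cauchy_Schwarz_ineq2\<close>)

lemma inn_le:
  assumes "sq M f" "sq M g"
  shows "\<bar>inn M f g\<bar> \<le> nrm M f * nrm M g"
proof -
  have "\<bar>inn M f g\<bar> \<le> (LINT x|M. \<bar>f x \<bullet> g x\<bar>)"
    unfolding inn_def by (rule integral_abs_bound)
  also have "\<dots> \<le> (LINT x|M. norm (f x) * norm (g x))"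
    by (intro integral_mono sq_integrable_norm_mult assms integrable_abs sq_integrable_inner
        Cauchy_Schwarz_ineq2)
  also have "\<dots> \<le> nrm M f * nrm M g"
    by (rule Cauchy_Schwarz_norm[OF assms])
  finally show ?thesis .
qed

lemma inn_self: "inn M f f = (nrm M f)^2"
  by (simp add: inn_def nrm_sq dot_square_norm)

lemma nrm_add_sq:
  assumes "sq M f" "sq M g"
  shows "(nrm M (\<lambda>x. f x + g x))^2 = (nrm M f)^2 + 2 * inn M f g + (nrm M g)^2"
proof -
  have "(nrm M (\<lambda>x. f x + g x))^2 = (LINT x|M. (norm (f x))^2 + 2 * (f x \<bullet> g x) + (norm (g x))^2)"
    unfolding nrm_sq by (intro Bochner_Integration.integral_cong refl)
      (simp add: power2_norm_eq_inner inner_add inner_commute)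
  also have "\<dots> = (nrm M f)^2 + 2 * inn M f g + (nrm M g)^2"
    using assms sq_integrable_inner[OF assms] by (simp add: nrm_sq inn_def sq_def)
  finally show ?thesis .
qed

lemma nrm_diff_sq:
  assumes "sq M f" "sq M g"
  shows "(nrm M (\<lambda>x. f x - g x))^2 = (nrm M f)^2 - 2 * inn M f g + (nrm M g)^2"
  using nrm_add_sq[OF assms(1) sq_uminus[OF assms(2)]]
  unfolding nrm_sq inn_def by simp

lemma nrm_triangle:
  assumes "sq M f" "sq M g"
  shows "nrm M (\<lambda>x. f x + g x) \<le> nrm M f + nrm M g"
proof -
  have "(nrm M (\<lambda>x. f x + g x))^2 \<le> (nrm M f + nrm M g)^2"
    using nrm_add_sq[OF assms] inn_le[OF assms] by (simp add: power2_sum)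
  then show ?thesis
    by (rule power2_le_imp_le) (simp add: nrm_nonneg)
qed

lemma nrm_cong: "(\<And>x. x \<in> space M \<Longrightarrow> f x = g x) \<Longrightarrow> nrm M f = nrm M g"
  unfolding nrm_def by (simp cong: Bochner_Integration.integral_cong)

lemma nrm_scaleR: "nrm M (\<lambda>x. c *\<^sub>R f x) = \<bar>c\<bar> * nrm M f"
  by (simp add: nrm_def power_mult_distrib real_sqrt_mult)

lemma nrm_mono:
  assumes "sq M g" "f \<in> borel_measurable M" "\<And>x. x \<in> space M \<Longrightarrow> norm (f x) \<le> norm (g x)"
  shows "nrm M f \<le> nrm M g"
proof -
  have "sq M f"
    by (rule sq_bound[OF assms(2) sq_integrable[OF assms(1)]]) (use assms(3) in \<open>auto intro: power_mono\<close>)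
  then show ?thesis
    unfolding nrm_def using assms by (intro real_sqrt_le_mono integral_mono power_mono)
      (auto simp: sq_def)
qed

lemma nrm_le_of_bound:
  assumes "sq M g" "f \<in> borel_measurable M" "\<And>x. x \<in> space M \<Longrightarrow> norm (f x) \<le> C * norm (g x)" "0 \<le> C"
  shows "nrm M f \<le> C * nrm M g"
proof -
  have "nrm M f \<le> nrm M (\<lambda>x. C *\<^sub>R g x)"
    by (rule nrm_mono[OF sq_scaleR[OF assms(1)] assms(2)]) (use assms in simp)
  then show ?thesis using \<open>0 \<le> C\<close> by (simp add: nrm_scaleR)
qed

lemma nrm_eq_0_AE:
  assumes "sq M f" "nrm M f = 0"
  shows "AE x in M. f x = 0"
proof -
  have "(LINT x|M. (norm (f x))^2) = 0"
    using assms(2) nrm_sq[of M f] by simp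
  then have "AE x in M. (norm (f x))^2 = 0"
    using integral_nonneg_eq_0_iff_AE[OF sq_integrable[OF assms(1)]] by auto
  then show ?thesis by (auto elim: eventually_mono)
qed

section \<open>Dominated integral kernels\<close>

definition weight :: "'a measure \<Rightarrow> ('a \<Rightarrow> real) \<Rightarrow> bool" where
  "weight M a \<longleftrightarrow> sigma_finite_measure M \<and> (\<forall>x. 0 \<le> a x) \<and> sq M a"

text \<open>Domination by a product of weights is stronger than the Hilbert-Schmidt condition: it
  controls every row and every column, not only almost all of them, and it survives transposition,
  composition and truncation.\<close>

definition kern :: "'a measure \<Rightarrow> ('a \<Rightarrow> real) \<Rightarrow> 'b measure \<Rightarrow> ('b \<Rightarrow> real) \<Rightarrow> ('a \<Rightarrow> 'b \<Rightarrow> real) \<Rightarrow> bool" where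
  "kern M a N b c \<longleftrightarrow> case_prod c \<in> borel_measurable (M \<Otimes>\<^sub>M N) \<and>
     (\<exists>C\<ge>0. \<forall>x\<in>space M. \<forall>y\<in>space N. \<bar>c x y\<bar> \<le> C * a x * b y)"

definition kint :: "'b measure \<Rightarrow> ('a \<Rightarrow> 'b \<Rightarrow> real) \<Rightarrow> ('b \<Rightarrow> 'c::euclidean_space) \<Rightarrow> 'a \<Rightarrow> 'c" where
  "kint N c f x = (LINT y|N. c x y *\<^sub>R f y)"

definition kcomp :: "'b measure \<Rightarrow> ('a \<Rightarrow> 'b \<Rightarrow> real) \<Rightarrow> ('b \<Rightarrow> 'c \<Rightarrow> real) \<Rightarrow> 'a \<Rightarrow> 'c \<Rightarrow> real" where
  "kcomp N c d x z = (LINT y|N. c x y * d y z)"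

lemma kcomp_eq_kint: "kcomp N c d x z = kint N c (\<lambda>y. d y z) x"
  by (simp add: kcomp_def kint_def)

lemma kernE:
  assumes "kern M a N b c"
  obtains C where "0 \<le> C" "\<And>x y. x \<in> space M \<Longrightarrow> y \<in> space N \<Longrightarrow> \<bar>c x y\<bar> \<le> C * a x * b y"
  using assms unfolding kern_def by blast

lemma kern_measurable: "kern M a N b c \<Longrightarrow> case_prod c \<in> borel_measurable (M \<Otimes>\<^sub>M N)"
  by (simp add: kern_def)

lemma measurable_section1:
  assumes "case_prod c \<in> borel_measurable (M \<Otimes>\<^sub>M N)" "x \<in> space M"
  shows "c x \<in> borel_measurable N"
  using measurable_compose[OF measurable_Pair1'[OF assms(2)] assms(1)] by simp

lemma measurable_section2:
  assumes "case_prod c \<in> borel_measurable (M \<Otimes>\<^sub>M N)" "y \<in> space N"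
  shows "(\<lambda>x. c x y) \<in> borel_measurable M"
  using measurable_compose[OF measurable_Pair2'[OF assms(2)] assms(1)] by simp

lemma measurable_transpose:
  assumes "case_prod c \<in> borel_measurable (M \<Otimes>\<^sub>M N)"
  shows "(\<lambda>(y, x). c x y) \<in> borel_measurable (N \<Otimes>\<^sub>M M)"
  using measurable_compose[OF measurable_pair_swap' assms] by (simp add: case_prod_unfold)

lemma kern_transpose: "kern M a N b c \<Longrightarrow> kern N b M a (\<lambda>y x. c x y)"

  unfolding kern_def using measurable_transpose[of c M N] by (metis mult.commute mult.left_commute)

lemma kern_add:
  assumes "kern M a N b c" "kern M a N b d"
  shows "kern M a N b (\<lambda>x y. c x y + d x y)"
proof -
  obtain C where C: "0 \<le> C" "\<And>x y. x \<in> space M \<Longrightarrow> y \<in> space N \<Longrightarrow> \<bar>c x y\<bar> \<le> C * a x * b y"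
    using kernE[OF assms(1)] by blast
  obtain D where D: "0 \<le> D" "\<And>x y. x \<in> space M \<Longrightarrow> y \<in> space N \<Longrightarrow> \<bar>d x y\<bar> \<le> D * a x * b y"
    using kernE[OF assms(2)] by blast
  have "\<bar>c x y + d x y\<bar> \<le> (C + D) * a x * b y" if "x \<in> space M" "y \<in> space N" for x y
    using C(2)[OF that] D(2)[OF that] by (simp add: algebra_simps)
  moreover have "(\<lambda>(x, y). c x y + d x y) \<in> borel_measurable (M \<Otimes>\<^sub>M N)"
    using borel_measurable_add[OF kern_measurable[OF assms(1)] kern_measurable[OF assms(2)]]
    by (simp add: case_prod_unfold)
  ultimately show ?thesis
    unfolding kern_def using C(1) D(1) by (intro conjI exI[of _ "C + D"]) auto
qed

lemma kern_bound:
  assumes "kern M a N b d" "case_prod c \<in> borel_measurable (M \<Otimes>\<^sub>M N)"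
    "\<And>x y. x \<in> space M \<Longrightarrow> y \<in> space N \<Longrightarrow> \<bar>c x y\<bar> \<le> \<bar>d x y\<bar>"
  shows "kern M a N b c"
  using assms unfolding kern_def by (meson order_trans)

lemma kern_cmult:
  assumes "kern M a N b c"
  shows "kern M a N b (\<lambda>x y. s * c x y)"
proof -
  obtain C where C: "0 \<le> C" "\<And>x y. x \<in> space M \<Longrightarrow> y \<in> space N \<Longrightarrow> \<bar>c x y\<bar> \<le> C * a x * b y"
    using kernE[OF assms(1)] by blast
  have "\<bar>s * c x y\<bar> \<le> (\<bar>s\<bar> * C) * a x * b y" if "x \<in> space M" "y \<in> space N" for x y
    using mult_left_mono[OF C(2)[OF that], of "\<bar>s\<bar>"] by (simp add: abs_mult algebra_simps)
  moreover have "(\<lambda>(x, y). s * c x y) \<in> borel_measurable (M \<Otimes>\<^sub>M N)"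
    using borel_measurable_times[OF borel_measurable_const kern_measurable[OF assms(1)], of s]
    by (simp add: case_prod_unfold)
  ultimately show ?thesis
    unfolding kern_def using C(1) by (intro conjI exI[of _ "\<bar>s\<bar> * C"]) auto
qed

lemma kern_uminus: "kern M a N b c \<Longrightarrow> kern M a N b (\<lambda>x y. - c x y)"
  using kern_cmult[of M a N b c "-1"] by simp

lemma kern_sq1:
  assumes "kern M a N b c" "weight N b" "x \<in> space M"
  shows "sq N (c x)"
proof -
  obtain C where C: "0 \<le> C" "\<And>x y. x \<in> space M \<Longrightarrow> y \<in> space N \<Longrightarrow> \<bar>c x y\<bar> \<le> C * a x * b y"
    using kernE[OF assms(1)] by blast
  have b: "\<And>y. 0 \<le> b y" "sq N b" using assms(2) by (auto simp: weight_def)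
  show ?thesis
  proof (rule sq_bound)
    show "c x \<in> borel_measurable N"
      by (rule measurable_section1[OF kern_measurable[OF assms(1)] assms(3)])
    show "integrable N (\<lambda>y. (C * a x)^2 * (norm (b y))^2)"
      using b by (auto simp: sq_def)
    show "(norm (c x y))^2 \<le> (C * a x)^2 * (norm (b y))^2" if "y \<in> space N" for y
      using power_mono[OF C(2)[OF assms(3) that], of 2] by (simp add: power_mult_distrib)
  qed
qed

lemma kern_sq2:
  assumes "kern M a N b c" "weight M a" "y \<in> space N"
  shows "sq M (\<lambda>x. c x y)"
  by (rule kern_sq1[OF kern_transpose[OF assms(1)] assms(2,3)])

lemma kint_integrable:
  assumes "kern M a N b c" "weight N b" "x \<in> space M" "sq N f"
  shows "integrable N (\<lambda>y. c x y *\<^sub>R f y)"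
  by (rule sq_integrable_bound[OF kern_sq1[OF assms(1-3)] assms(4), where C = 1])
    (use kern_sq1[OF assms(1-3)] assms(4) in \<open>auto simp: sq_def\<close>)

lemma kint_norm_le:
  assumes "kern M a N b c" "weight N b" "x \<in> space M" "sq N f"
  shows "norm (kint N c f x) \<le> nrm N (c x) * nrm N f"
proof -
  have "norm (kint N c f x) \<le> (LINT y|N. norm (c x y *\<^sub>R f y))"
    unfolding kint_def by (rule integral_norm_bound)
  also have "\<dots> = (LINT y|N. norm (c x y) * norm (f y))" by simp
  also have "\<dots> \<le> nrm N (c x) * nrm N f"
    by (rule Cauchy_Schwarz_norm[OF kern_sq1[OF assms(1-3)] assms(4)])
  finally show ?thesis .
qed

lemma kern_row_nrm:
  assumes "kern M a N b c" "weight N b" "\<And>x. 0 \<le> a x"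
  obtains C where "0 \<le> C" "\<And>x. x \<in> space M \<Longrightarrow> nrm N (c x) \<le> C * a x"
proof -
  obtain C where C: "0 \<le> C" "\<And>x y. x \<in> space M \<Longrightarrow> y \<in> space N \<Longrightarrow> \<bar>c x y\<bar> \<le> C * a x * b y"
    using kernE[OF assms(1)] by blast
  have b: "\<And>y. 0 \<le> b y" "sq N b" using assms(2) by (auto simp: weight_def)
  have "nrm N (c x) \<le> (C * nrm N b) * a x" if x: "x \<in> space M" for x
  proof -
    have "nrm N (c x) \<le> (C * a x) * nrm N b"
      by (rule nrm_le_of_bound[OF b(2)])
        (use C x b assms(3) measurable_section1[OF kern_measurable[OF assms(1)] x] in auto)
    then show ?thesis by (simp add: algebra_simps)
  qed
  then show ?thesis using that[of "C * nrm N b"] C(1) nrm_nonneg[of N b] by simp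
qed

lemma kint_measurable:
  assumes "kern M a N b c" "sigma_finite_measure N" "f \<in> borel_measurable N"
  shows "kint N c f \<in> borel_measurable M"
proof -
  interpret sigma_finite_measure N by fact
  have "(\<lambda>(x, y). c x y *\<^sub>R f y) \<in> borel_measurable (M \<Otimes>\<^sub>M N)"
    using kern_measurable[OF assms(1)] assms(3) by (simp add: case_prod_unfold)
  from borel_measurable_lebesgue_integral[OF this] show ?thesis
    unfolding kint_def[abs_def] by simp
qed

lemma kint_row_bound:
  assumes "kern M a N b c" "weight M a" "weight N b"
  obtains C where "0 \<le> C"
    "\<And>x (f::'b \<Rightarrow> 'c::euclidean_space). x \<in> space M \<Longrightarrow> sq N f \<Longrightarrow> norm (kint N c f x) \<le> (C * nrm N f) * norm (a x)"
proof -
  have a: "\<And>y. 0 \<le> a y" "sq M a" using assms(2) by (auto simp: weight_def)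
  obtain C where C: "0 \<le> C" "\<And>x. x \<in> space M \<Longrightarrow> nrm N (c x) \<le> C * a x"
    using kern_row_nrm[OF assms(1,3) a(1)] by blast
  have "norm (kint N c f x) \<le> (C * nrm N f) * norm (a x)" if "x \<in> space M" "sq N f"
    for x and f :: "'b \<Rightarrow> 'c"
    using order_trans[OF kint_norm_le[OF assms(1,3) that]
        mult_right_mono[OF C(2)[OF that(1)] nrm_nonneg]] a(1)[of x] by (simp add: algebra_simps)
  then show ?thesis using that C(1) by blast
qed

lemma kint_sq:
  fixes f :: "'b \<Rightarrow> 'c::euclidean_space"
  assumes "kern M a N b c" "weight M a" "weight N b" "sq N f"
  shows "sq M (kint N c f)"
proof -
  have a: "\<And>y. 0 \<le> a y" "sq M a" using assms(2) by (auto simp: weight_def)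
  obtain C where C: "0 \<le> C"
    "\<And>x (f::'b \<Rightarrow> 'c). x \<in> space M \<Longrightarrow> sq N f \<Longrightarrow> norm (kint N c f x) \<le> (C * nrm N f) * norm (a x)"
    using kint_row_bound[OF assms(1-3)] by blast
  show ?thesis
  proof (rule sq_bound)
    show "kint N c f \<in> borel_measurable M"
      using kint_measurable[OF assms(1), of f] assms(3,4) by (auto simp: weight_def sq_def)
    show "integrable M (\<lambda>x. (C * nrm N f)^2 * (norm (a x))^2)"
      using a by (auto simp: sq_def)
    show "(norm (kint N c f x))^2 \<le> (C * nrm N f)^2 * (norm (a x))^2" if "x \<in> space M" for x
      using power_mono[OF C(2)[OF that assms(4)], of 2] by (simp add: power_mult_distrib)
  qed
qed

lemma kint_bounded:
  assumes "kern M a N b c" "weight M a" "weight N b"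
  obtains C where "0 \<le> C"
    "\<And>f::'b \<Rightarrow> 'c::euclidean_space. sq N f \<Longrightarrow> nrm M (kint N c f) \<le> C * nrm N f"
proof -
  have a: "\<And>y. 0 \<le> a y" "sq M a" using assms(2) by (auto simp: weight_def)
  obtain C where C: "0 \<le> C"
    "\<And>x (f::'b \<Rightarrow> 'c). x \<in> space M \<Longrightarrow> sq N f \<Longrightarrow> norm (kint N c f x) \<le> (C * nrm N f) * norm (a x)"
    using kint_row_bound[OF assms] by blast
  have "nrm M (kint N c f) \<le> (C * nrm M a) * nrm N f" if "sq N f" for f :: "'b \<Rightarrow> 'c"
    using nrm_le_of_bound[OF a(2) sq_measurable[OF kint_sq[OF assms that]] C(2)[OF _ that]]
      C(1) nrm_nonneg[of N f] by (simp add: algebra_simps)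
  then show ?thesis using that[of "C * nrm M a"] C(1) nrm_nonneg[of M a] by simp
qed

section \<open>Fubini's theorem, adjoints and composition of dominated kernels\<close>

lemma integrable_product:
  fixes u :: "'a \<Rightarrow> real" and v :: "'b \<Rightarrow> real"
  assumes "sigma_finite_measure M" "sigma_finite_measure N" "integrable M u" "integrable N v"
  shows "integrable (M \<Otimes>\<^sub>M N) (\<lambda>(x, y). u x * v y)"
proof -
  interpret M: sigma_finite_measure M by fact
  interpret N: sigma_finite_measure N by fact
  interpret pair_sigma_finite M N ..
  have [measurable]: "u \<in> borel_measurable M" "v \<in> borel_measurable N" using assms by auto
  show ?thesis
  proof (rule Fubini_integrable)
    show "(\<lambda>(x, y). u x * v y) \<in> borel_measurable (M \<Otimes>\<^sub>M N)" by measurable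
    have "integrable M (\<lambda>x. \<bar>u x\<bar> * (LINT y|N. \<bar>v y\<bar>))" using assms by auto
    then show "integrable M (\<lambda>x. LINT y|N. norm (case (x, y) of (x, y) \<Rightarrow> u x * v y))"
      by (simp add: abs_mult)
    show "AE x in M. integrable N (\<lambda>y. case (x, y) of (x, y) \<Rightarrow> u x * v y)"
      using assms by auto
  qed
qed

text \<open>\<open>F\<close> is left general so that the same integrability serves for adjoints,
  where \<open>g\<close> is the test function, and for composition, where \<open>g\<close> is a row
  of the outer kernel. The majorant splits into an integrable function of x times one of y.\<close>

lemma kern_integrable_product:
  fixes F :: "'a \<Rightarrow> 'b \<Rightarrow> 'e::euclidean_space"
  assumes "kern M a N b c" "weight M a" "weight N b" "sq M g" "sq N f"
    "case_prod F \<in> borel_measurable (M \<Otimes>\<^sub>M N)"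
    "\<And>x y. x \<in> space M \<Longrightarrow> y \<in> space N \<Longrightarrow> norm (F x y) \<le> \<bar>c x y\<bar> * norm (g x) * norm (f y)"
  shows "integrable (M \<Otimes>\<^sub>M N) (case_prod F)"
proof -
  obtain C where C: "0 \<le> C" "\<And>x y. x \<in> space M \<Longrightarrow> y \<in> space N \<Longrightarrow> \<bar>c x y\<bar> \<le> C * a x * b y"
    using kernE[OF assms(1)] by blast
  have a: "\<And>y. 0 \<le> a y" "sq M a" "sigma_finite_measure M" and b: "\<And>y. 0 \<le> b y" "sq N b" "sigma_finite_measure N"
    using assms(2,3) by (auto simp: weight_def)
  have "integrable (M \<Otimes>\<^sub>M N) (\<lambda>(x, y). (norm (a x) * norm (g x)) * (norm (b y) * norm (f y)))"
    by (intro integrable_product a b sq_integrable_norm_mult assms)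
  then have "integrable (M \<Otimes>\<^sub>M N) (\<lambda>z. C * (case z of (x, y) \<Rightarrow> (norm (a x) * norm (g x)) * (norm (b y) * norm (f y))))"
    by (rule integrable_mult_right)
  then show ?thesis
  proof (rule Bochner_Integration.integrable_bound[OF _ assms(6)], intro AE_I2)
    fix z assume "z \<in> space (M \<Otimes>\<^sub>M N)"
    then obtain x y where z: "z = (x, y)" "x \<in> space M" "y \<in> space N"
      by (auto simp: space_pair_measure)
    have "norm (F x y) \<le> \<bar>c x y\<bar> * norm (g x) * norm (f y)" by (rule assms(7)[OF z(2,3)])
    also have "\<dots> \<le> (C * a x * b y) * norm (g x) * norm (f y)"
      by (intro mult_right_mono C z) auto
    also have "\<dots> = C * ((norm (a x) * norm (g x)) * (norm (b y) * norm (f y)))"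
      using a(1)[of x] b(1)[of y] by simp
    also have "\<dots> \<le> norm (C * ((norm (a x) * norm (g x)) * (norm (b y) * norm (f y))))"
      by simp
    finally show "norm (case z of (x, y) \<Rightarrow> F x y) \<le> norm (C * (case z of (x, y) \<Rightarrow> (norm (a x) * norm (g x)) * (norm (b y) * norm (f y))))"
      using z by simp
  qed
qed

lemma kern_Fubini:
  fixes F :: "'a \<Rightarrow> 'b \<Rightarrow> 'e::euclidean_space"
  assumes "kern M a N b c" "weight M a" "weight N b" "sq M g" "sq N f"
    "case_prod F \<in> borel_measurable (M \<Otimes>\<^sub>M N)"
    "\<And>x y. x \<in> space M \<Longrightarrow> y \<in> space N \<Longrightarrow> norm (F x y) \<le> \<bar>c x y\<bar> * norm (g x) * norm (f y)"
  shows "(LINT x|M. LINT y|N. F x y) = (LINT y|N. LINT x|M. F x y)"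
proof -
  interpret M: sigma_finite_measure M using assms(2) by (simp add: weight_def)
  interpret N: sigma_finite_measure N using assms(3) by (simp add: weight_def)
  interpret pair_sigma_finite M N ..
  show ?thesis
    using Fubini_integral[OF kern_integrable_product[OF assms]] by simp
qed

lemma kint_adjoint:
  assumes "kern M a N b c" "weight M a" "weight N b" "sq M g" "sq N f"
  shows "inn M (kint N c f) g = inn N f (kint M (\<lambda>y x. c x y) g)"
proof -
  have [measurable]: "f \<in> borel_measurable N" "g \<in> borel_measurable M"
    using assms by (auto simp: sq_def)
  have "inn M (kint N c f) g = (LINT x|M. LINT y|N. (c x y *\<^sub>R f y) \<bullet> g x)"
    unfolding inn_def kint_def
    by (intro Bochner_Integration.integral_cong refl integral_inner_left[symmetric])
      (rule kint_integrable[OF assms(1,3) _ assms(5)])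
  also have "\<dots> = (LINT y|N. LINT x|M. (c x y *\<^sub>R f y) \<bullet> g x)"
  proof (rule kern_Fubini[OF assms])
    show "(\<lambda>(x, y). (c x y *\<^sub>R f y) \<bullet> g x) \<in> borel_measurable (M \<Otimes>\<^sub>M N)"
      using kern_measurable[OF assms(1)] by (simp add: case_prod_unfold)
    show "norm ((c x y *\<^sub>R f y) \<bullet> g x) \<le> \<bar>c x y\<bar> * norm (g x) * norm (f y)" for x y
      using Cauchy_Schwarz_ineq2[of "c x y *\<^sub>R f y" "g x"] by (simp add: algebra_simps)
  qed
  also have "\<dots> = (LINT y|N. LINT x|M. f y \<bullet> (c x y *\<^sub>R g x))"
    by (simp add: inner_commute)
  also have "\<dots> = inn N f (kint M (\<lambda>y x. c x y) g)"
    unfolding inn_def kint_def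
    by (intro Bochner_Integration.integral_cong refl integral_inner_right)
      (rule kint_integrable[OF kern_transpose[OF assms(1)] assms(2) _ assms(4)])
  finally show ?thesis .
qed

lemma kint_kint:
  assumes "kern M a N b c" "kern N b P d e" "weight N b" "weight P d" "x \<in> space M" "sq P f"
  shows "kint N c (kint P e f) x = kint P (kcomp N c e) f x"
proof -
  have cx: "sq N (c x)" by (rule kern_sq1[OF assms(1,3,5)])
  have [measurable]: "f \<in> borel_measurable P" "c x \<in> borel_measurable N"
    using assms cx by (auto simp: sq_def)
  have "kint N c (kint P e f) x = (LINT y|N. LINT z|P. c x y *\<^sub>R (e y z *\<^sub>R f z))"
    unfolding kint_def by (simp del: scaleR_scaleR)
  also have "\<dots> = (LINT z|P. LINT y|N. c x y *\<^sub>R (e y z *\<^sub>R f z))"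
  proof (rule kern_Fubini[OF assms(2,3,4) cx assms(6)])
    show "(\<lambda>(y, z). c x y *\<^sub>R (e y z *\<^sub>R f z)) \<in> borel_measurable (N \<Otimes>\<^sub>M P)"
      using kern_measurable[OF assms(2)] by (simp add: case_prod_unfold)
  qed (simp add: abs_mult algebra_simps)
  also have "\<dots> = kint P (kcomp N c e) f x"
    unfolding kint_def kcomp_def
  proof (intro Bochner_Integration.integral_cong refl)
    fix z assume z: "z \<in> space P"
    have "integrable N (\<lambda>y. c x y *\<^sub>R e y z)"
      by (rule kint_integrable[OF assms(1,3,5) kern_sq2[OF assms(2,3) z]])
    then have "integrable N (\<lambda>y. c x y * e y z)" by simp
    then have "(LINT y|N. (c x y * e y z) *\<^sub>R f z) = (LINT y|N. c x y * e y z) *\<^sub>R f z"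
      by (intro integral_scaleR_left) auto
    then show "(LINT y|N. c x y *\<^sub>R (e y z *\<^sub>R f z)) = (LINT y|N. c x y * e y z) *\<^sub>R f z"
      by simp
  qed
  finally show ?thesis .
qed

lemma kcomp_assoc:
  assumes "kern M a N b c" "kern N b P d e" "weight N b" "weight P d" "x \<in> space M" "sq P (\<lambda>u. g u z)"
  shows "kcomp N c (kcomp P e g) x z = kcomp P (kcomp N c e) g x z"
  using kint_kint[OF assms(1-5) assms(6)] unfolding kcomp_eq_kint[abs_def] by simp

text \<open>Cauchy-Schwarz in the inner variable: the rows of \<open>c\<close> have norm at most a
  constant times \<open>a\<close>, the columns of \<open>e\<close> at most a constant times
  \<open>d\<close>.\<close>

lemma kern_kcomp:
  assumes "kern M a N b c" "kern N b P d e" "weight M a" "weight N b" "weight P d"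
  shows "kern M a P d (kcomp N c e)"
proof -
  have a: "\<And>y. 0 \<le> a y" and d: "\<And>y. 0 \<le> d y"
    using assms(3,5) by (auto simp: weight_def)
  interpret N: sigma_finite_measure N using assms(4) by (simp add: weight_def)
  obtain C where C: "0 \<le> C" "\<And>x. x \<in> space M \<Longrightarrow> nrm N (c x) \<le> C * a x"
    using kern_row_nrm[OF assms(1,4) a] by blast
  obtain D where D: "0 \<le> D" "\<And>z. z \<in> space P \<Longrightarrow> nrm N (\<lambda>y. e y z) \<le> D * d z"
    using kern_row_nrm[OF kern_transpose[OF assms(2)] assms(4) d] by blast
  have "\<bar>kcomp N c e x z\<bar> \<le> (C * D) * a x * d z" if "x \<in> space M" "z \<in> space P" for x z
  proof -
    have "\<bar>kcomp N c e x z\<bar> \<le> nrm N (c x) * nrm N (\<lambda>y. e y z)"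
      unfolding kcomp_eq_kint
      using kint_norm_le[OF assms(1,4) that(1) kern_sq2[OF assms(2,4) that(2)]] by simp
    also have "\<dots> \<le> (C * a x) * (D * d z)"
      using C D a nrm_nonneg that by (intro mult_mono) auto
    finally show ?thesis by (simp add: algebra_simps)
  qed
  moreover have "case_prod (kcomp N c e) \<in> borel_measurable (M \<Otimes>\<^sub>M P)"
  proof -
    have 1: "(\<lambda>w. (fst (fst w), snd w)) \<in> (M \<Otimes>\<^sub>M P) \<Otimes>\<^sub>M N \<rightarrow>\<^sub>M M \<Otimes>\<^sub>M N"
      and 2: "(\<lambda>w. (snd w, snd (fst w))) \<in> (M \<Otimes>\<^sub>M P) \<Otimes>\<^sub>M N \<rightarrow>\<^sub>M N \<Otimes>\<^sub>M P"
      by measurable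
    have "(\<lambda>w. case_prod c (fst (fst w), snd w) * case_prod e (snd w, snd (fst w)))
        \<in> borel_measurable ((M \<Otimes>\<^sub>M P) \<Otimes>\<^sub>M N)"
      by (intro borel_measurable_times measurable_compose[OF 1 kern_measurable[OF assms(1)]]
        measurable_compose[OF 2 kern_measurable[OF assms(2)]])
    then have "(\<lambda>(p, y). c (fst p) y * e y (snd p)) \<in> borel_measurable ((M \<Otimes>\<^sub>M P) \<Otimes>\<^sub>M N)"
      by (simp add: case_prod_unfold)
    from N.borel_measurable_lebesgue_integral[OF this] show ?thesis
      by (simp add: kcomp_def[abs_def] case_prod_unfold)
  qed
  ultimately show ?thesis
    unfolding kern_def using C(1) D(1) by (intro conjI exI[of _ "C * D"]) auto
qed

lemma kint_add_right:
  assumes "kern M a N b c" "weight N b" "x \<in> space M" "sq N f" "sq N g"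
  shows "kint N c (\<lambda>y. f y + g y) x = kint N c f x + kint N c g x"
  using kint_integrable[OF assms(1-4)] kint_integrable[OF assms(1-3,5)]
  by (simp add: kint_def scaleR_add_right)

lemma kint_add_left:
  assumes "kern M a N b c" "kern M a N b d" "weight N b" "x \<in> space M" "sq N f"
  shows "kint N (\<lambda>x y. c x y + d x y) f x = kint N c f x + kint N d f x"
  using kint_integrable[OF assms(1,3-5)] kint_integrable[OF assms(2,3-5)]
  by (simp add: kint_def scaleR_add_left)

lemma kint_cong_AE:
  assumes "kern M a N b c" "x \<in> space M" "f \<in> borel_measurable N" "g \<in> borel_measurable N" "AE y in N. f y = g y"
  shows "kint N c f x = kint N c g x"
  unfolding kint_def
  using measurable_section1[OF kern_measurable[OF assms(1)] assms(2)] assms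
  by (intro integral_cong_AE) auto

section \<open>Strict contractions\<close>

lemma kint_cong_kern:
  "(\<And>y. y \<in> space N \<Longrightarrow> c x y = d x y) \<Longrightarrow> kint N c f x = kint N d f x"
  unfolding kint_def by (simp cong: Bochner_Integration.integral_cong)

lemma kint_cong: "(\<And>y. y \<in> space N \<Longrightarrow> f y = g y) \<Longrightarrow> kint N c f x = kint N c g x"
  unfolding kint_def by (simp cong: Bochner_Integration.integral_cong)

lemma kint_symmetric_adjoint:
  assumes "kern M a M a c" "weight M a" "\<And>x y. x \<in> space M \<Longrightarrow> y \<in> space M \<Longrightarrow> c x y = c y x"
    "sq M f" "sq M g"
  shows "inn M (kint M c f) g = inn M f (kint M c g)"
proof -
  have "inn M (kint M c f) g = inn M f (kint M (\<lambda>y x. c x y) g)"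
    by (rule kint_adjoint[OF assms(1,2,2,5,4)])
  also have "\<dots> = inn M f (kint M c g)"
    unfolding inn_def using assms(3)
    by (intro Bochner_Integration.integral_cong refl arg_cong2[where f = inner] kint_cong_kern) auto
  finally show ?thesis .
qed

text \<open>Only the exponents 2^j occur, because a norm bound can be carried from the square of a
  self-adjoint operator back to the operator.\<close>

primrec ksq :: "'a measure \<Rightarrow> ('a \<Rightarrow> 'a \<Rightarrow> real) \<Rightarrow> nat \<Rightarrow> 'a \<Rightarrow> 'a \<Rightarrow> real" where
  "ksq M k 0 = k"
| "ksq M k (Suc j) = kcomp M (ksq M k j) (ksq M k j)"

context
  fixes M :: "'a measure" and a :: "'a \<Rightarrow> real" and k :: "'a \<Rightarrow> 'a \<Rightarrow> real"
  assumes w: "weight M a" and k: "kern M a M a k"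
    and sym: "\<And>x y. x \<in> space M \<Longrightarrow> y \<in> space M \<Longrightarrow> k x y = k y x"
begin

lemma kern_ksq: "kern M a M a (ksq M k j)"
  by (induction j) (auto intro!: kern_kcomp k w)

lemma ksq_sym: "x \<in> space M \<Longrightarrow> y \<in> space M \<Longrightarrow> ksq M k j x y = ksq M k j y x"
proof (induction j arbitrary: x y)
  case (Suc j)
  have "ksq M k (Suc j) x y = (LINT u|M. ksq M k j x u * ksq M k j u y)"
    by (simp add: kcomp_def)
  also have "\<dots> = (LINT u|M. ksq M k j y u * ksq M k j u x)"
    using Suc by (intro Bochner_Integration.integral_cong) (auto simp: mult.commute)
  finally show ?case by (simp add: kcomp_def)
qed (use sym in simp)

lemma sq_ksq: "x \<in> space M \<Longrightarrow> sq M (ksq M k j x)"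
  by (rule kern_sq1[OF kern_ksq w])

lemma ksq_Suc_inn:
  assumes "x \<in> space M" "y \<in> space M"
  shows "ksq M k (Suc j) x y = inn M (ksq M k j x) (ksq M k j y)"
  unfolding inn_def ksq.simps kcomp_def
  using assms ksq_sym by (intro Bochner_Integration.integral_cong) auto

lemma kint_ksq_row:
  assumes "x \<in> space M" "y \<in> space M"
  shows "kint M (ksq M k j) (ksq M k j x) y = ksq M k (Suc j) x y"
  using assms by (simp add: ksq_Suc_inn inn_def kint_def mult.commute del: ksq.simps)

lemma kint_ksq_Suc:
  assumes "sq M f" "x \<in> space M"
  shows "kint M (ksq M k (Suc j)) f x = kint M (ksq M k j) (kint M (ksq M k j) f) x"
  using kint_kint[OF kern_ksq kern_ksq w w assms(2,1)] by simp

lemma sq_kint_ksq: "sq M f \<Longrightarrow> sq M (kint M (ksq M k j) f)"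
  by (rule kint_sq[OF kern_ksq w w])

lemma nrm_kint_ksq_Suc:
  "sq M f \<Longrightarrow> nrm M (kint M (ksq M k (Suc j)) f) = nrm M (kint M (ksq M k j) (kint M (ksq M k j) f))"
  by (intro nrm_cong kint_ksq_Suc)

text \<open>For self-adjoint K the square of the norm of K f is the inner product of f with K (K f),
  so a bound \<open>q\<close> for the square gives \<open>sqrt q\<close> for the operator. Iterating
  takes a bound from stage j down to \<open>k\<close> itself.\<close>

lemma ksq_bound_descend:
  assumes "0 < q" "q < 1" "\<And>f::'a \<Rightarrow> real. sq M f \<Longrightarrow> nrm M (kint M (ksq M k j) f) \<le> q * nrm M f"
  shows "\<exists>q. 0 < q \<and> q < 1 \<and> (\<forall>f::'a \<Rightarrow> real. sq M f \<longrightarrow> nrm M (kint M k f) \<le> q * nrm M f)"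
  using assms
proof (induction j arbitrary: q)
  case 0
  then show ?case by auto
next
  case (Suc j)
  have "nrm M (kint M (ksq M k j) f) \<le> sqrt q * nrm M f" if f: "sq M f" for f :: "'a \<Rightarrow> real"
  proof -
    have "(nrm M (kint M (ksq M k j) f))^2 = inn M f (kint M (ksq M k j) (kint M (ksq M k j) f))"
      unfolding inn_self[symmetric]
      by (rule kint_symmetric_adjoint[OF kern_ksq w ksq_sym f sq_kint_ksq[OF f]])
    also have "\<dots> \<le> nrm M f * nrm M (kint M (ksq M k j) (kint M (ksq M k j) f))"
      using inn_le[OF f sq_kint_ksq[OF sq_kint_ksq[OF f]]] by (rule order_trans[OF abs_ge_self])
    also have "\<dots> \<le> nrm M f * (q * nrm M f)"
      using Suc.prems(3)[OF f] nrm_kint_ksq_Suc[OF f] by (intro mult_left_mono nrm_nonneg) simp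
    also have "\<dots> = (sqrt q * nrm M f)^2"
      using Suc.prems(1) by (simp add: power_mult_distrib) (simp add: power2_eq_square)
    finally show ?thesis
      by (rule power2_le_imp_le) (use Suc.prems(1) nrm_nonneg[of M f] in simp)
  qed
  then show ?case using Suc.IH[of "sqrt q"] Suc.prems(1,2) by simp
qed

text \<open>The Hilbert-Schmidt norm bounds the operator norm, by Cauchy-Schwarz in each
  row.\<close>

lemma kint_HS_bound:
  fixes f :: "'a \<Rightarrow> real"
  assumes "kern M a M a c" "sq M f"
  shows "integrable M (\<lambda>x. (nrm M (c x))^2)"
    and "(nrm M (kint M c f))^2 \<le> (LINT x|M. (nrm M (c x))^2) * (nrm M f)^2"
proof -
  interpret sigma_finite_measure M using w by (simp add: weight_def)
  have a: "\<And>y. 0 \<le> a y" "sq M a" using w by (auto simp: weight_def)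
  obtain C where C: "0 \<le> C" "\<And>x. x \<in> space M \<Longrightarrow> nrm M (c x) \<le> C * a x"
    using kern_row_nrm[OF assms(1) w a(1)] by blast
  have "case_prod (\<lambda>x y. (norm (c x y))^2) \<in> borel_measurable (M \<Otimes>\<^sub>M M)"
    using kern_measurable[OF assms(1)] by (simp add: case_prod_unfold)
  then have m: "(\<lambda>x. (nrm M (c x))^2) \<in> borel_measurable M"
    unfolding nrm_sq by (rule borel_measurable_lebesgue_integral)
  show i: "integrable M (\<lambda>x. (nrm M (c x))^2)"
  proof (rule Bochner_Integration.integrable_bound[OF _ m])
    show "integrable M (\<lambda>x. C^2 * (norm (a x))^2)" using a by (auto simp: sq_def)
    show "AE x in M. norm ((nrm M (c x))^2) \<le> norm (C^2 * (norm (a x))^2)"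
    proof (rule AE_I2)
      fix x assume "x \<in> space M"
      then have "(nrm M (c x))^2 \<le> (C * a x)^2"
        by (intro power_mono C nrm_nonneg)
      then show "norm ((nrm M (c x))^2) \<le> norm (C^2 * (norm (a x))^2)"
        by (simp add: power_mult_distrib)
    qed
  qed
  have "(nrm M (kint M c f))^2 \<le> (LINT x|M. (nrm M (c x))^2 * (nrm M f)^2)"
    unfolding nrm_sq[of M "kint M c f"]
  proof (rule integral_mono)
    show "integrable M (\<lambda>x. (norm (kint M c f x))^2)"
      using kint_sq[OF assms(1) w w assms(2)] by (simp add: sq_def)
    show "integrable M (\<lambda>x. (nrm M (c x))^2 * (nrm M f)^2)" using i by simp
    show "(norm (kint M c f x))^2 \<le> (nrm M (c x))^2 * (nrm M f)^2" if "x \<in> space M" for x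
      using power_mono[OF kint_norm_le[OF assms(1) w that assms(2)], of 2]
      by (simp add: power_mult_distrib)
  qed
  then show "(nrm M (kint M c f))^2 \<le> (LINT x|M. (nrm M (c x))^2) * (nrm M f)^2"
    by simp
qed

text \<open>
  The kernels of $K^{2^j}$ converge pointwise, by polarization, to a kernel whose rows are fixed
  in norm by $K$.  Strictness forces these rows to vanish, so the Hilbert--Schmidt norms of
  $K^{2^j}$ tend to $0$, and the norm of $K$ is recovered by taking square roots.
\<close>

proposition strict_contraction:
  assumes contr: "\<And>f::'a \<Rightarrow> real. sq M f \<Longrightarrow> nrm M (kint M k f) \<le> nrm M f"
    and strict: "\<And>f::'a \<Rightarrow> real. sq M f \<Longrightarrow> nrm M f \<le> nrm M (kint M k f) \<Longrightarrow> nrm M f = 0"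
  shows "\<exists>q. 0 < q \<and> q < 1 \<and> (\<forall>f::'a \<Rightarrow> real. sq M f \<longrightarrow> nrm M (kint M k f) \<le> q * nrm M f)"
proof -
  define d where "d j = ksq M k j" for j
  note D = d_def[symmetric]
  have a: "\<And>y. 0 \<le> a y" "sq M a" using w by (auto simp: weight_def)
  obtain C where C: "0 \<le> C" "\<And>x. x \<in> space M \<Longrightarrow> nrm M (k x) \<le> C * a x"
    using kern_row_nrm[OF k w a(1)] by blast
  have contr_j: "nrm M (kint M (d j) f) \<le> nrm M f" if "sq M f" for f :: "'a \<Rightarrow> real" and j
    using that
  proof (induction j arbitrary: f)
    case 0
    then show ?case using contr by (simp add: d_def)
  next
    case (Suc j)
    have "nrm M (kint M (d (Suc j)) f) = nrm M (kint M (d j) (kint M (d j) f))"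
      unfolding d_def by (rule nrm_kint_ksq_Suc[OF Suc.prems])
    also have "\<dots> \<le> nrm M f"
      using Suc.IH[OF Suc.prems] Suc.IH[OF sq_kint_ksq[OF Suc.prems, of j, unfolded D]] by linarith
    finally show ?case .
  qed
  \<comment> \<open>K^(2^j) contains at least one factor K, and the remaining factors do not
    increase the norm.\<close>
  have contr_0: "nrm M (kint M (d j) f) \<le> nrm M (kint M k f)" if "sq M f" for f :: "'a \<Rightarrow> real" and j
    using that
  proof (induction j arbitrary: f)
    case 0
    then show ?case by (simp add: d_def)
  next
    case (Suc j)
    have "nrm M (kint M (d (Suc j)) f) = nrm M (kint M (d j) (kint M (d j) f))"
      unfolding d_def by (rule nrm_kint_ksq_Suc[OF Suc.prems])
    also have "\<dots> \<le> nrm M (kint M (d j) f)"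
      by (rule contr_j[OF sq_kint_ksq[OF Suc.prems, of j, unfolded D]])
    finally show ?case using Suc.IH[OF Suc.prems] by linarith
  qed
  have sqd: "sq M (d j x)" if "x \<in> space M" for j x
    unfolding d_def by (rule sq_ksq[OF that])
  have row: "kint M (d j) (d j x) y = d (Suc j) x y" if "x \<in> space M" "y \<in> space M" for j x y
    unfolding d_def by (rule kint_ksq_row[OF that])
  have dS: "d (Suc j) x y = inn M (d j x) (d j y)" if "x \<in> space M" "y \<in> space M" for j x y
    unfolding d_def by (rule ksq_Suc_inn[OF that])
  \<comment> \<open>The operator of \<open>d j\<close> maps the row of \<open>d j\<close> at x to
    the row of \<open>d (Suc j)\<close> at x, so contractivity makes the norms of all combinations
    of rows decrease with j.\<close>
  have comb: "nrm M (\<lambda>u. d (Suc j) x u + s * d (Suc j) y u) \<le> nrm M (\<lambda>u. d j x u + s * d j y u)"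
    if xy: "x \<in> space M" "y \<in> space M" for j x y s
  proof -
    have s: "sq M (\<lambda>u. s * d j y u)"
      using sq_scaleR[OF sqd[OF xy(2)], of s j] by simp
    have "nrm M (\<lambda>u. d (Suc j) x u + s * d (Suc j) y u) = nrm M (kint M (d j) (\<lambda>u. d j x u + s * d j y u))"
    proof (rule nrm_cong)
      fix u assume u: "u \<in> space M"
      have "kint M (d j) (\<lambda>u. d j x u + s * d j y u) u = kint M (d j) (d j x) u + kint M (d j) (\<lambda>u. s * d j y u) u"
        by (rule kint_add_right[OF kern_ksq[of j, unfolded D] w u sqd[OF xy(1)] s])
      also have "kint M (d j) (\<lambda>u. s * d j y u) u = s * kint M (d j) (d j y) u"
        by (simp add: kint_def mult.left_commute)
      finally show "d (Suc j) x u + s * d (Suc j) y u = kint M (d j) (\<lambda>u. d j x u + s * d j y u) u"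
        using row xy u by simp
    qed
    also have "\<dots> \<le> nrm M (\<lambda>u. d j x u + s * d j y u)"
      by (rule contr_j[OF sq_add[OF sqd[OF xy(1)] s]])
    finally show ?thesis .
  qed
  have conv: "convergent (\<lambda>j. (nrm M (\<lambda>u. d j x u + s * d j y u))^2)"
    if xy: "x \<in> space M" "y \<in> space M" for x y s
  proof (rule decseq_convergent[of _ 0])
    show "decseq (\<lambda>j. (nrm M (\<lambda>u. d j x u + s * d j y u))^2)"
      by (intro decseq_SucI power_mono comb xy nrm_nonneg)
  qed (auto simp: convergent_def)
  have conv_d: "convergent (\<lambda>j. d j x y)" if xy: "x \<in> space M" "y \<in> space M" for x y
  proof -
    \<comment> \<open>Polarization: the combinations with s = 1 and s = -1 recover the inner product
      of two rows, which is the value of the next kernel.\<close>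
    have "convergent (\<lambda>j. ((nrm M (\<lambda>u. d j x u + 1 * d j y u))^2 - (nrm M (\<lambda>u. d j x u + (-1) * d j y u))^2) / 4)"
      using convergent_mult[OF convergent_diff[OF conv[OF xy, of 1] conv[OF xy, of "-1"]] convergent_const[of "1/4"]]
      by simp
    moreover have "((nrm M (\<lambda>u. d j x u + 1 * d j y u))^2 - (nrm M (\<lambda>u. d j x u + (-1) * d j y u))^2) / 4
        = d (Suc j) x y" for j
      using nrm_add_sq[OF sqd[OF xy(1), of j] sqd[OF xy(2), of j]]
        nrm_diff_sq[OF sqd[OF xy(1), of j] sqd[OF xy(2), of j]] by (simp add: dS[OF xy])
    ultimately have "convergent (\<lambda>j. d (Suc j) x y)" by simp
    then show ?thesis by (subst (asm) convergent_Suc_iff)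
  qed
  define e where "e x y = lim (\<lambda>j. d j x y)" for x y
  have e_lim: "(\<lambda>j. d j x y) \<longlonglongrightarrow> e x y" if "x \<in> space M" "y \<in> space M" for x y
    unfolding e_def using conv_d[OF that] by (simp add: convergent_LIMSEQ_iff)
  have e_lim': "(\<lambda>j. d (Suc j) x y) \<longlonglongrightarrow> e x y" if "x \<in> space M" "y \<in> space M" for x y
    using e_lim[OF that] by (rule LIMSEQ_Suc)
  have nrm_d: "nrm M (d j x) \<le> C * a x" if x: "x \<in> space M" for j x
  proof (induction j)
    case 0
    then show ?case using C(2)[OF x] by (simp add: d_def)
  next
    case (Suc j)
    then show ?case using comb[OF x x, of j 0] by simp
  qed
  have d_bound: "\<bar>d (Suc j) x y\<bar> \<le> (C * a x) * (C * a y)" if "x \<in> space M" "y \<in> space M" for j x y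
    unfolding dS[OF that]
    by (rule order_trans[OF inn_le[OF sqd sqd]])
      (use that nrm_d C a nrm_nonneg in \<open>auto intro!: mult_mono\<close>)
  have e_m: "e x \<in> borel_measurable M" if "x \<in> space M" for x
    by (rule borel_measurable_LIMSEQ_real[OF e_lim]) (use that sq_measurable[OF sqd] in auto)
  have e_bound: "\<bar>e x y\<bar> \<le> (C * a x) * (C * a y)" if "x \<in> space M" "y \<in> space M" for x y
    by (rule tendsto_upperbound[OF tendsto_rabs[OF e_lim'[OF that]]]) (use d_bound that in auto)
  have a2: "integrable M (\<lambda>y. B * (a y)^2)" for B
    using a by (auto simp: sq_def)
  have e_sq: "sq M (e x)" if x: "x \<in> space M" for x
  proof (rule sq_bound[OF e_m[OF x] a2])
    show "(norm (e x y))^2 \<le> (C * a x * C)^2 * (a y)^2" if "y \<in> space M" for y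
      using power_mono[OF e_bound[OF x that], of 2] by (simp add: power_mult_distrib mult_ac)
  qed
  have nrm_lim: "(\<lambda>j. (nrm M (d (Suc j) x))^2) \<longlonglongrightarrow> (nrm M (e x))^2" if x: "x \<in> space M" for x
    unfolding nrm_sq
  proof (rule integral_dominated_convergence)
    show "integrable M (\<lambda>y. (C * a x * C)^2 * (a y)^2)" by (rule a2)
    show "AE y in M. (\<lambda>j. (norm (d (Suc j) x y))^2) \<longlonglongrightarrow> (norm (e x y))^2"
      by (intro AE_I2 tendsto_power tendsto_norm e_lim' x)
    show "AE y in M. norm ((norm (d (Suc j) x y))^2) \<le> (C * a x * C)^2 * (a y)^2" for j
    proof (rule AE_I2)
      fix y assume "y \<in> space M"
      from power_mono[OF d_bound[OF x this, of j], of 2]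
      show "norm ((norm (d (Suc j) x y))^2) \<le> (C * a x * C)^2 * (a y)^2"
        by (simp add: power_mult_distrib mult_ac)
    qed
  qed (use e_m[OF x] sq_measurable[OF sqd[OF x]] in auto)
  have K_lim: "(\<lambda>j. kint M k (d (Suc j) x) z) \<longlonglongrightarrow> kint M k (e x) z" if x: "x \<in> space M" and z: "z \<in> space M" for x z
    unfolding kint_def
  proof (rule integral_dominated_convergence)
    have kz: "sq M (k z)" by (rule kern_sq1[OF k w z])
    show "integrable M (\<lambda>y. (C * a x * C) * (norm (k z y) * norm (a y)))"
      by (intro integrable_mult_right sq_integrable_norm_mult kz a)
    show "AE y in M. (\<lambda>j. k z y *\<^sub>R d (Suc j) x y) \<longlonglongrightarrow> k z y *\<^sub>R e x y"
      by (intro AE_I2 tendsto_intros e_lim' x)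
    show "AE y in M. norm (k z y *\<^sub>R d (Suc j) x y) \<le> (C * a x * C) * (norm (k z y) * norm (a y))" for j
    proof (rule AE_I2)
      fix y assume "y \<in> space M"
      from mult_left_mono[OF d_bound[OF x this, of j], of "norm (k z y)"]
      show "norm (k z y *\<^sub>R d (Suc j) x y) \<le> (C * a x * C) * (norm (k z y) * norm (a y))"
        using a(1)[of y] by (simp add: mult_ac abs_mult)
    qed
  qed (use e_m[OF x] sq_measurable[OF sqd[OF x]] sq_measurable[OF kern_sq1[OF k w z]] in auto)
  have nrm_K_lim: "(\<lambda>j. (nrm M (kint M k (d (Suc j) x)))^2) \<longlonglongrightarrow> (nrm M (kint M k (e x)))^2"
    if x: "x \<in> space M" for x
    unfolding nrm_sq
  proof (rule integral_dominated_convergence)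
    show "integrable M (\<lambda>z. (C * (C * a x))^2 * (a z)^2)" by (rule a2)
    show "AE z in M. (\<lambda>j. (norm (kint M k (d (Suc j) x) z))^2) \<longlonglongrightarrow> (norm (kint M k (e x) z))^2"
      by (intro AE_I2 tendsto_power tendsto_norm K_lim x)
    show "AE z in M. norm ((norm (kint M k (d (Suc j) x) z))^2) \<le> (C * (C * a x))^2 * (a z)^2" for j
    proof (rule AE_I2)
      fix z assume z: "z \<in> space M"
      have "norm (kint M k (d (Suc j) x) z) \<le> nrm M (k z) * nrm M (d (Suc j) x)"
        by (rule kint_norm_le[OF k w z sqd[OF x]])
      also have "\<dots> \<le> (C * a z) * (C * a x)"
        using C a nrm_d x z nrm_nonneg by (intro mult_mono) auto
      finally have "(norm (kint M k (d (Suc j) x) z))^2 \<le> ((C * a z) * (C * a x))^2"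
        by (intro power_mono) auto
      then show "norm ((norm (kint M k (d (Suc j) x) z))^2) \<le> (C * (C * a x))^2 * (a z)^2"
        by (simp add: power_mult_distrib mult_ac)
    qed
    show "(\<lambda>z. (norm (kint M k (e x) z))^2) \<in> borel_measurable M"
      using sq_measurable[OF kint_sq[OF k w w e_sq[OF x]]] by auto
    show "(\<lambda>z. (norm (kint M k (d (Suc j) x) z))^2) \<in> borel_measurable M" for j
      using sq_measurable[OF kint_sq[OF k w w sqd[OF x]]] by auto
  qed
  \<comment> \<open>The row of stage j + 2 is the image of the row of stage j + 1 under K^(2^(j+1)),
    hence no longer than its image under K. In the limit \<open>e x\<close> is not shortened by K,
    and \<open>strict\<close> applies.\<close>
  have e0: "nrm M (e x) = 0" if x: "x \<in> space M" for x
  proof (rule strict[OF e_sq[OF x]])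
    have "(nrm M (e x))^2 \<le> (nrm M (kint M k (e x)))^2"
    proof (rule LIMSEQ_le[OF LIMSEQ_Suc[OF nrm_lim[OF x]] nrm_K_lim[OF x]], intro exI[of _ 0] allI impI power_mono)
      fix j
      have "nrm M (d (Suc (Suc j)) x) = nrm M (kint M (d (Suc j)) (d (Suc j) x))"
        using row[OF x] by (intro nrm_cong) simp
      also have "\<dots> \<le> nrm M (kint M k (d (Suc j) x))"
        by (rule contr_0[OF sqd[OF x]])
      finally show "nrm M (d (Suc (Suc j)) x) \<le> nrm M (kint M k (d (Suc j) x))" .
    qed (rule nrm_nonneg)
    then show "nrm M (e x) \<le> nrm M (kint M k (e x))"
      by (rule power2_le_imp_le) (rule nrm_nonneg)
  qed
  have "(\<lambda>j. (LINT x|M. (nrm M (d (Suc j) x))^2)) \<longlonglongrightarrow> (LINT x|M. (0::real))"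
  proof (rule integral_dominated_convergence)
    show "integrable M (\<lambda>x. C^2 * (a x)^2)" by (rule a2)
    show "AE x in M. (\<lambda>j. (nrm M (d (Suc j) x))^2) \<longlonglongrightarrow> 0"
      using nrm_lim e0 by (intro AE_I2) fastforce
    show "AE x in M. norm ((nrm M (d (Suc j) x))^2) \<le> C^2 * (a x)^2" for j
    proof (rule AE_I2)
      fix x assume "x \<in> space M"
      then have "(nrm M (d (Suc j) x))^2 \<le> (C * a x)^2"
        by (intro power_mono nrm_d nrm_nonneg)
      then show "norm ((nrm M (d (Suc j) x))^2) \<le> C^2 * (a x)^2"
        by (simp add: power_mult_distrib)
    qed
    show "(\<lambda>x. (nrm M (d (Suc j) x))^2) \<in> borel_measurable M" for j
      using kint_HS_bound(1)[OF kern_ksq[of "Suc j", unfolded D] a(2)] by (rule borel_measurable_integrable)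
  qed auto
  \<comment> \<open>The value 1/4 is the square of the operator bound 1/2 with which the descent to
    \<open>k\<close> starts.\<close>
  then have "\<forall>\<^sub>F j in sequentially. (LINT x|M. (nrm M (d (Suc j) x))^2) < 1/4"
    by (intro order_tendstoD) auto
  then obtain j where j: "(LINT x|M. (nrm M (d (Suc j) x))^2) < 1/4"
    by (auto simp: eventually_sequentially)
  show ?thesis
  proof (rule ksq_bound_descend[of "1/2" "Suc j", unfolded D])
    fix f :: "'a \<Rightarrow> real" assume f: "sq M f"
    have "(nrm M (kint M (d (Suc j)) f))^2 \<le> (LINT x|M. (nrm M (d (Suc j) x))^2) * (nrm M f)^2"
      by (rule kint_HS_bound(2)[OF kern_ksq[of "Suc j", unfolded D] f])
    also have "\<dots> \<le> 1/4 * (nrm M f)^2"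
      using j by (intro mult_right_mono) auto
    also have "\<dots> = (1/2 * nrm M f)^2" by (simp add: power_mult_distrib power2_eq_square)
    finally show "nrm M (kint M (d (Suc j)) f) \<le> 1/2 * nrm M f"
      by (rule power2_le_imp_le) (simp add: nrm_nonneg)
  qed auto
qed

end

section \<open>Operators of the form identity plus integral operator\<close>

definition iop :: "'a measure \<Rightarrow> ('a \<Rightarrow> 'a \<Rightarrow> real) \<Rightarrow> ('a \<Rightarrow> complex) \<Rightarrow> ('a \<Rightarrow> complex)" where
  "iop M c f x = f x + kint M c f x"

lemma iop_sq: "kern M a M a c \<Longrightarrow> weight M a \<Longrightarrow> sq M f \<Longrightarrow> sq M (iop M c f)"
  unfolding iop_def[abs_def] by (intro sq_add kint_sq)

lemma kint_mult_complex:
  fixes f :: "'b \<Rightarrow> complex"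
  shows "kint N c (\<lambda>y. s * f y) x = s * kint N c f x"
  unfolding kint_def by (simp flip: mult_scaleR_right)

lemma bounded_op_kint:
  assumes "kern M a M a c" "weight M a"
  shows "bounded_op M (kint M c)"
  unfolding bounded_op_def L2_iff_sq L2_norm_eq_nrm
proof (intro conjI ballI allI)
  fix f g :: "'a \<Rightarrow> complex" and s :: complex
  assume f: "f \<in> L2 M"
  then have f': "sq M f" by (simp add: L2_iff_sq)
  show "sq M (kint M c f)" by (rule kint_sq[OF assms assms(2) f'])
  show "AE x in M. kint M c (\<lambda>y. s * f y) x = s * kint M c f x"
    by (simp add: kint_mult_complex)
  assume g: "g \<in> L2 M"
  show "AE x in M. kint M c (\<lambda>y. f y + g y) x = kint M c f x + kint M c g x"
    by (intro AE_I2 kint_add_right[OF assms] f' g[unfolded L2_iff_sq])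
next
  obtain C where "\<And>f::'a \<Rightarrow> complex. sq M f \<Longrightarrow> nrm M (kint M c f) \<le> C * nrm M f"
    using kint_bounded[OF assms assms(2)] by blast
  then show "\<exists>C. \<forall>f\<in>L2 M. nrm M (kint M c f) \<le> C * nrm M f"
    by (auto simp: L2_iff_sq intro!: exI[of _ C])
qed

lemma bounded_op_iop:
  assumes "kern M a M a c" "weight M a"
  shows "bounded_op M (iop M c)"
  unfolding bounded_op_def L2_iff_sq L2_norm_eq_nrm
proof (intro conjI ballI allI)
  fix f g :: "'a \<Rightarrow> complex" and s :: complex
  assume f: "f \<in> L2 M"
  then have f': "sq M f" by (simp add: L2_iff_sq)
  show "sq M (iop M c f)" by (rule iop_sq[OF assms f'])
  show "AE x in M. iop M c (\<lambda>y. s * f y) x = s * iop M c f x"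
    by (simp add: iop_def kint_mult_complex algebra_simps)
  assume g: "g \<in> L2 M"
  show "AE x in M. iop M c (\<lambda>y. f y + g y) x = iop M c f x + iop M c g x"
    using kint_add_right[OF assms _ f' g[unfolded L2_iff_sq]] by (simp add: iop_def)
next
  obtain C where C: "\<And>f::'a \<Rightarrow> complex. sq M f \<Longrightarrow> nrm M (kint M c f) \<le> C * nrm M f"
    using kint_bounded[OF assms assms(2)] by blast
  have "nrm M (iop M c f) \<le> (1 + C) * nrm M f" if "sq M f" for f
    using nrm_triangle[OF that kint_sq[OF assms assms(2) that]] C[OF that]
    unfolding iop_def[abs_def] by (simp add: algebra_simps)
  then show "\<exists>C. \<forall>f\<in>L2 M. nrm M (iop M c f) \<le> C * nrm M f"
    by (auto simp: L2_iff_sq intro!: exI[of _ "1 + C"])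
qed

section \<open>The complex inner product and adjoints of integral operators\<close>

lemma borel_measurable_cnj:
  assumes "f \<in> borel_measurable M"
  shows "(\<lambda>x. cnj (f x)) \<in> borel_measurable M"
  using measurable_compose[OF assms borel_measurable_continuous_onI[OF continuous_on_cnj[OF continuous_on_id]]]
  by simp

lemma L2_inner_self: "L2_inner M f f = of_real ((nrm M f)^2)"
  unfolding L2_inner_def nrm_sq complex_norm_square[symmetric] by (simp del: of_real_power)

lemma L2_inner_commute: "L2_inner M g f = cnj (L2_inner M f g)"
  unfolding L2_inner_def by (simp flip: Bochner_Integration.integral_cnj add: mult.commute)

lemma L2_inner_integrable:
  assumes "sq M f" "sq M g"
  shows "integrable M (\<lambda>x. f x * cnj (g x))"
  by (rule sq_integrable_bound[OF assms, where C = 1])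
    (use assms in \<open>auto simp: sq_def norm_mult intro!: borel_measurable_times borel_measurable_cnj\<close>)

text \<open>The complex version of \<open>kint_adjoint\<close>, whose \<open>inn\<close> sees only
  the real part. Since the kernel is real, the adjoint kernel is the transpose without
  conjugation.\<close>

lemma L2_inner_kint:
  assumes "kern M a M a c" "weight M a" "sq M f" "sq M g"
  shows "L2_inner M (kint M c f) g = L2_inner M f (kint M (\<lambda>y x. c x y) g)"
proof -
  have [measurable]: "f \<in> borel_measurable M" "g \<in> borel_measurable M" "(\<lambda>x. cnj (g x)) \<in> borel_measurable M"
    using assms by (auto simp: sq_def intro!: borel_measurable_cnj)
  have "L2_inner M (kint M c f) g = (LINT x|M. LINT y|M. (c x y *\<^sub>R f y) * cnj (g x))"
    unfolding L2_inner_def kint_def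
    by (simp del: mult_scaleR_left)
  also have "\<dots> = (LINT y|M. LINT x|M. (c x y *\<^sub>R f y) * cnj (g x))"
  proof (rule kern_Fubini[OF assms(1,2,2,4,3)])
    show "(\<lambda>(x, y). (c x y *\<^sub>R f y) * cnj (g x)) \<in> borel_measurable (M \<Otimes>\<^sub>M M)"
      using kern_measurable[OF assms(1)] by (simp add: case_prod_unfold)
    show "norm ((c x y *\<^sub>R f y) * cnj (g x)) \<le> \<bar>c x y\<bar> * norm (g x) * norm (f y)" for x y
      by (simp add: norm_mult)
  qed
  also have "\<dots> = (LINT y|M. LINT x|M. f y * cnj (c x y *\<^sub>R g x))"
    by (simp add: mult_ac)
  also have "\<dots> = L2_inner M f (kint M (\<lambda>y x. c x y) g)"
    unfolding L2_inner_def kint_def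
    by (simp only: integral_mult_right_zero Bochner_Integration.integral_cnj)
  finally show ?thesis .
qed

lemma L2_inner_iop:
  assumes "kern M a M a c" "weight M a" "sq M f" "sq M g"
  shows "L2_inner M (iop M c f) g = L2_inner M f g + L2_inner M (kint M c f) g"
  using L2_inner_integrable[OF assms(3,4)]
    L2_inner_integrable[OF kint_sq[OF assms(1,2,2,3)] assms(4)]
  by (simp add: L2_inner_def iop_def algebra_simps)

lemma L2_inner_iop_right:
  assumes "kern M a M a c" "weight M a" "sq M f" "sq M g"
  shows "L2_inner M f (iop M c g) = L2_inner M f g + L2_inner M f (kint M c g)"
  using L2_inner_integrable[OF assms(3,4)]
    L2_inner_integrable[OF assms(3) kint_sq[OF assms(1,2,2,4)]]
  by (simp add: L2_inner_def iop_def algebra_simps)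

lemma is_adjoint_kint:
  assumes "kern M a M a c" "weight M a"
  shows "is_adjoint M (kint M c) (kint M (\<lambda>y x. c x y))"
  unfolding is_adjoint_def L2_iff_sq
  by (intro conjI ballI bounded_op_kint[OF assms] bounded_op_kint[OF kern_transpose assms(2)]
      L2_inner_kint[OF assms]) (auto simp: assms L2_iff_sq)

lemma is_adjoint_iop:
  assumes "kern M a M a c" "weight M a"
  shows "is_adjoint M (iop M c) (iop M (\<lambda>y x. c x y))"
  unfolding is_adjoint_def L2_iff_sq
proof (intro conjI ballI)
  show "bounded_op M (iop M c)" "bounded_op M (iop M (\<lambda>y x. c x y))"
    by (intro bounded_op_iop[OF assms] bounded_op_iop[OF kern_transpose[OF assms(1)] assms(2)])+
  fix f g :: "'a \<Rightarrow> complex" assume "f \<in> L2 M" "g \<in> L2 M"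
  then have fg: "sq M f" "sq M g" by (auto simp: L2_iff_sq)
  show "L2_inner M (iop M c f) g = L2_inner M f (iop M (\<lambda>y x. c x y) g)"
    by (simp add: L2_inner_iop[OF assms fg] L2_inner_kint[OF assms fg]
        L2_inner_iop_right[OF kern_transpose[OF assms(1)] assms(2) fg])
qed

lemma iop_iop:
  assumes "kern M a M a c" "kern M a M a d" "weight M a" "x \<in> space M" "sq M f"
  shows "iop M c (iop M d f) x = iop M (\<lambda>x y. c x y + d x y + kcomp M c d x y) f x"
proof -
  have cd: "kern M a M a (kcomp M c d)" by (rule kern_kcomp[OF assms(1,2,3,3,3)])
  have "iop M c (iop M d f) x = f x + kint M d f x + (kint M c f x + kint M c (kint M d f) x)"
    unfolding iop_def[abs_def]
    by (simp add: kint_add_right[OF assms(1,3,4,5) kint_sq[OF assms(2,3,3,5)]])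
  also have "kint M c (kint M d f) x = kint M (kcomp M c d) f x"
    by (rule kint_kint[OF assms(1,2,3,3,4,5)])
  finally show ?thesis
    unfolding iop_def
    by (simp add: kint_add_left[OF kern_add[OF assms(1,2)] cd assms(3,4,5)]
        kint_add_left[OF assms(1,2) assms(3,4,5)])
qed

lemma kint_uminus_kern: "kint N (\<lambda>x y. - c x y) f x = - kint N c f x"
  by (simp add: kint_def)

lemma kcomp_integrable:
  assumes "kern M a N b c" "kern N b P d e" "weight N b" "x \<in> space M" "z \<in> space P"
  shows "integrable N (\<lambda>y. c x y * e y z)"
  using kint_integrable[OF assms(1,3,4) kern_sq2[OF assms(2,3,5)]] by simp

section \<open>Triangular factorization\<close>

text \<open>The power by which J_alpha(sqrt x) differs from an entire function of x. It is also the
  dominating weight on bounded intervals and the function fixed by the Weber kernel.\<close>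

abbreviation pw :: "real \<Rightarrow> real \<Rightarrow> real" where
  "pw \<alpha> x \<equiv> x powr (\<alpha> / 2)"

lemma pw_square: "(pw \<alpha> x)^2 = x powr \<alpha>"
  by (simp add: power2_eq_square flip: powr_add)

text \<open>The integrands met here can be singular at an endpoint, such as x^alpha at 0, so
  differentiability is asked for only in the open interval. Nonnegativity upgrades the gauge
  integral to a Lebesgue integral.\<close>

lemma FTC_nonneg:
  fixes F f :: "real \<Rightarrow> real"
  assumes "a \<le> b" "continuous_on {a..b} F" "f \<in> borel_measurable borel"
    "\<And>t. t \<in> {a<..<b} \<Longrightarrow> (F has_real_derivative f t) (at t)" "\<And>t. t \<in> {a..b} \<Longrightarrow> 0 \<le> f t"
  shows "set_integrable lborel {a<..<b} f" "(LINT t:{a<..<b}|lborel. f t) = F b - F a"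
proof -
  have 1: "(f has_integral (F b - F a)) {a..b}"
    by (rule fundamental_theorem_of_calculus_interior[OF assms(1,2)])
      (use assms(4) in \<open>simp add: has_real_derivative_iff_has_vector_derivative\<close>)
  have "f absolutely_integrable_on {a..b}"
    by (rule nonnegative_absolutely_integrable_1[OF has_integral_integrable[OF 1]]) (use assms in auto)
  then have "set_integrable lborel {a..b} f"
    using assms(3) unfolding set_integrable_def by (simp add: integrable_completion)
  then show 2: "set_integrable lborel {a<..<b} f"
    by (rule set_integrable_subset) auto
  have "(f has_integral (F b - F a)) {a<..<b}"
    using 1 has_integral_Icc_iff_Ioo by blast
  then show "(LINT t:{a<..<b}|lborel. f t) = F b - F a"
    using set_borel_integral_eq_integral(2)[OF 2] by (simp add: integral_unique)
qed

section \<open>Lebesgue measure on (0, zeta) and powers of x\<close>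

lemma space_interval [simp]: "space (interval_lborel \<zeta>) = {0<..<\<zeta>}"
  by (simp add: space_restrict_space)

lemma sigma_finite_interval: "sigma_finite_measure (interval_lborel \<zeta>)"
  by (intro sigma_finite_measure_restrict_space lborel.sigma_finite_measure_axioms) simp

lemma borel_interval: "f \<in> borel_measurable borel \<Longrightarrow> f \<in> borel_measurable (interval_lborel \<zeta>)"
  by (intro measurable_restrict_space1) simp

lemma integrable_interval:
  "integrable (interval_lborel \<zeta>) (f::real \<Rightarrow> 'b::euclidean_space) \<longleftrightarrow> set_integrable lborel {0<..<\<zeta>} f"
  by (simp add: integrable_restrict_space set_integrable_def)

lemma integral_interval:
  "(LINT x|interval_lborel \<zeta>. (f x::'b::euclidean_space)) = (LINT x:{0<..<\<zeta>}|lborel. f x)"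
  by (simp add: integral_restrict_space set_lebesgue_integral_def)

lemma AE_interval_neq: "AE x in interval_lborel \<zeta>. x \<noteq> (t::real)"
  by (subst AE_restrict_space_iff) (auto intro: AE_mp[OF AE_lborel_singleton[of t]])

lemma continuous_on_powr_real:
  assumes "p > 0"
  shows "continuous_on {0..b} (\<lambda>x::real. x powr p)"
  by (rule Transcendental.continuous_on_powr') (use assms in \<open>auto intro: continuous_intros\<close>)

lemma powr_antiderivative:
  fixes \<alpha> b :: real
  assumes "\<alpha> > -1" "0 \<le> b"
  shows "set_integrable lborel {0<..<b} (\<lambda>x. x powr \<alpha>)"
    "(LINT x:{0<..<b}|lborel. x powr \<alpha>) = b powr (\<alpha> + 1) / (\<alpha> + 1)"
proof -
  have "continuous_on {0..b} (\<lambda>x. x powr (\<alpha> + 1))"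
    by (rule continuous_on_powr_real) (use assms in auto)
  then have "continuous_on {0..b} (\<lambda>x. x powr (\<alpha> + 1) / (\<alpha> + 1))"
    by (rule continuous_on_divide) (use assms in \<open>auto intro: continuous_intros\<close>)
  moreover have "((\<lambda>x. x powr (\<alpha> + 1) / (\<alpha> + 1)) has_real_derivative t powr \<alpha>) (at t)" if "t \<in> {0<..<b}" for t
    using that assms by (auto intro!: derivative_eq_intros simp: )
  ultimately show "set_integrable lborel {0<..<b} (\<lambda>x. x powr \<alpha>)"
    "(LINT x:{0<..<b}|lborel. x powr \<alpha>) = b powr (\<alpha> + 1) / (\<alpha> + 1)"
    using FTC_nonneg[of 0 b "\<lambda>x. x powr (\<alpha> + 1) / (\<alpha> + 1)" "\<lambda>x. x powr \<alpha>"] assms by auto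
qed

lemma weight_pw:
  assumes "\<alpha> > -1" "0 < \<zeta>"
  shows "weight (interval_lborel \<zeta>) (pw \<alpha>)"
  unfolding weight_def sq_def
  using powr_antiderivative(1)[OF assms(1), of \<zeta>] assms(2)
  by (auto simp: sigma_finite_interval integrable_interval pw_square intro!: borel_interval)

text \<open>An exponentially weighted norm makes the Volterra operator a contraction. The weight is
  exp(- l phi) with phi the primitive of x^alpha, the square of the dominating function, so the
  squared weighted row norms can be integrated exactly and gain a factor 1 / (2 l).\<close>

lemma Volterra_unique:
  fixes w :: "real \<Rightarrow> 'b::euclidean_space"
  assumes \<alpha>: "\<alpha> > -1" and \<zeta>: "0 < \<zeta>" and w: "sq (interval_lborel \<zeta>) w" and C: "0 \<le> C"
    and bound: "AE x in interval_lborel \<zeta>. norm (w x) \<le>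
      C * pw \<alpha> x * (LINT t|interval_lborel \<zeta>. (if t \<le> x then pw \<alpha> t * norm (w t) else 0))"
  shows "AE x in interval_lborel \<zeta>. w x = 0"
proof -
  let ?M = "interval_lborel \<zeta>"
  define \<phi> where "\<phi> t = t powr (\<alpha> + 1) / (\<alpha> + 1)" for t :: real
  \<comment> \<open>Chosen to make C^2 phi(zeta) / (2 l) less than 1; the summand 1 keeps
    \<open>l\<close> positive when \<open>C = 0\<close>.\<close>
  define l where "l = C^2 * \<phi> \<zeta> + 1"
  define E where "E t = exp (- (l * \<phi> t))" for t
  have \<phi>_nn: "0 \<le> \<phi> t" for t using \<alpha> by (simp add: \<phi>_def)
  have l: "l > 0" using \<phi>_nn[of \<zeta>] by (simp add: l_def add_nonneg_pos)
  have Em [measurable]: "E \<in> borel_measurable borel"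
    unfolding E_def \<phi>_def by measurable
  have E: "0 < E t" "E t \<le> 1" for t using l \<phi>_nn[of t] by (auto simp: E_def)
  have E0: "E t \<noteq> 0" for t by (simp add: E_def)
  define v where "v t = E t * norm (w t)" for t
  have wm: "w \<in> borel_measurable ?M" using w by (rule sq_measurable)
  have vsq: "sq ?M v"
  proof (rule sq_bound[OF _ sq_integrable[OF w]])
    show "v \<in> borel_measurable ?M"
      unfolding v_def using wm borel_interval[OF Em] by auto
    have "(norm (v x))^2 = (E x)^2 * (norm (w x))^2" for x
      by (simp add: v_def power_mult_distrib)
    also have "\<dots> x \<le> 1 * (norm (w x))^2" for x
      using E[of x] by (intro mult_right_mono power_le_one) auto
    finally show "(norm (v x))^2 \<le> (norm (w x))^2" for x by simp
  qed
  \<comment> \<open>The Volterra kernel divided by the weight. Its squared norm is the integral of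
    phi' exp(2 l phi) over (0,x), whose primitive is exp(2 l phi) / (2 l).\<close>
  define g where "g x t = (if t \<le> x then pw \<alpha> t / E t else 0)" for x t :: real
  have E2: "1 / (E t)^2 = exp (2 * l * \<phi> t)" for t
    by (simp add: E_def exp_minus power_inverse field_simps flip: exp_double)
  have g: "sq ?M (g x)" "(nrm ?M (g x))^2 \<le> 1 / (2 * l * (E x)^2)" if x: "x \<in> {0<..<\<zeta>}" for x
  proof -
    have m: "g x \<in> borel_measurable ?M"
      unfolding g_def by (rule borel_interval) measurable
    have g0: "g x t = 0" if "t \<noteq> x" "\<not> t < x" for t
      using that by (simp add: g_def)
    have sqe: "(g x t)^2 = (if t \<le> x then t powr \<alpha> * exp (2 * l * \<phi> t) else 0)" for t
      by (simp add: g_def power_divide pw_square E2[symmetric])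
    have cont: "continuous_on {0..x} (\<lambda>t. exp (2 * l * \<phi> t) / (2 * l))"
      unfolding \<phi>_def using \<alpha> l by (intro continuous_intros continuous_on_powr_real) auto
    have der: "((\<lambda>t. exp (2 * l * \<phi> t) / (2 * l)) has_real_derivative t powr \<alpha> * exp (2 * l * \<phi> t)) (at t)"
      if "t \<in> {0<..<x}" for t
      unfolding \<phi>_def using that \<alpha> l by (auto intro!: derivative_eq_intros)
    have bm: "(\<lambda>t. t powr \<alpha> * exp (2 * l * \<phi> t)) \<in> borel_measurable borel"
      unfolding \<phi>_def by measurable
    note F = FTC_nonneg[OF _ cont bm der]
    have ae: "AE t in lborel. indicator {0<..<\<zeta>} t *\<^sub>R (norm (g x t))^2 =
        indicator {0<..<x} t *\<^sub>R (t powr \<alpha> * exp (2 * l * \<phi> t))"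
      using AE_lborel_singleton[of x]
      by eventually_elim (use x in \<open>auto simp: sqe g0 indicator_def\<close>)
    have mm: "(\<lambda>t. indicator {0<..<\<zeta>} t *\<^sub>R (norm (g x t))^2) \<in> borel_measurable lborel"
      "(\<lambda>t. indicator {0<..<x} t *\<^sub>R (t powr \<alpha> * exp (2 * l * \<phi> t))) \<in> borel_measurable lborel"
      unfolding g_def \<phi>_def by measurable
    have "integrable lborel (\<lambda>t. indicator {0<..<\<zeta>} t *\<^sub>R (norm (g x t))^2)"
      using F(1) x unfolding set_integrable_def integrable_cong_AE[OF mm ae] by auto
    then show "sq ?M (g x)"
      unfolding sq_def integrable_interval set_integrable_def using m by auto
    have "(nrm ?M (g x))^2 = (LINT t:{0<..<x}|lborel. t powr \<alpha> * exp (2 * l * \<phi> t))"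
      unfolding nrm_sq integral_interval set_lebesgue_integral_def by (rule integral_cong_AE[OF mm ae])
    also have "\<dots> = exp (2 * l * \<phi> x) / (2 * l) - exp (2 * l * \<phi> 0) / (2 * l)"
      by (rule F(2)) (use x in auto)
    also have "\<dots> \<le> exp (2 * l * \<phi> x) / (2 * l)" using l by simp
    finally show "(nrm ?M (g x))^2 \<le> 1 / (2 * l * (E x)^2)"
      unfolding E2[symmetric] by (simp add: field_simps)
  qed
  have ptw: "v x \<le> (C * nrm ?M v / sqrt (2 * l)) * pw \<alpha> x"
    if x: "x \<in> {0<..<\<zeta>}" and b: "norm (w x) \<le> C * pw \<alpha> x * (LINT t|?M. (if t \<le> x then pw \<alpha> t * norm (w t) else 0))" for x
  proof -
    have "(LINT t|?M. (if t \<le> x then pw \<alpha> t * norm (w t) else 0)) = (LINT t|?M. norm (g x t) * norm (v t))"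
      using E by (intro Bochner_Integration.integral_cong refl) (auto simp: g_def v_def abs_mult less_imp_le E0)
    also have "\<dots> \<le> nrm ?M (g x) * nrm ?M v"
      by (rule Cauchy_Schwarz_norm[OF g(1)[OF x] vsq])
    also have "\<dots> \<le> (1 / (sqrt (2 * l) * E x)) * nrm ?M v"
    proof (rule mult_right_mono[OF _ nrm_nonneg])
      show "nrm ?M (g x) \<le> 1 / (sqrt (2 * l) * E x)"
        by (rule power2_le_imp_le) (use g(2)[OF x] l E[of x] in \<open>auto simp: power_divide power_mult_distrib\<close>)
    qed
    finally have "norm (w x) \<le> C * pw \<alpha> x * ((1 / (sqrt (2 * l) * E x)) * nrm ?M v)"
      using b C by (meson mult_left_mono mult_nonneg_nonneg order_trans powr_ge_zero)
    then have "v x \<le> E x * (C * pw \<alpha> x * ((1 / (sqrt (2 * l) * E x)) * nrm ?M v))"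
      unfolding v_def using E[of x] by (intro mult_left_mono) auto
    also have "\<dots> = (C * nrm ?M v / sqrt (2 * l)) * pw \<alpha> x"
      using E[of x] l by (simp add: field_simps)
    finally show ?thesis .
  qed
  have W: "weight ?M (pw \<alpha>)" by (rule weight_pw[OF \<alpha> \<zeta>])
  then have Wsq: "sq ?M (pw \<alpha>)" by (simp add: weight_def)
  have "(nrm ?M v)^2 \<le> (LINT x|?M. ((C * nrm ?M v / sqrt (2 * l)) * pw \<alpha> x)^2)"
    unfolding nrm_sq
  proof (rule integral_mono_AE)
    show "integrable ?M (\<lambda>x. (norm (v x))^2)" using vsq by (rule sq_integrable)
    show "integrable ?M (\<lambda>x. ((C * nrm ?M v / sqrt (2 * l)) * pw \<alpha> x)^2)"
      using sq_integrable[OF sq_scaleR[OF Wsq, of "C * nrm ?M v / sqrt (2 * l)"]]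
      by (simp add: power_divide power_mult_distrib)
    show "AE x in ?M. (norm (v x))^2 \<le> ((C * nrm ?M v / sqrt (2 * l)) * pw \<alpha> x)^2"
      using bound AE_space[of ?M]
    proof eventually_elim
      case (elim x)
      then have "v x \<le> (C * nrm ?M v / sqrt (2 * l)) * pw \<alpha> x" by (intro ptw) auto
      moreover have "0 \<le> v x" using E[of x] by (simp add: v_def)
      ultimately show ?case by (intro power_mono) auto
    qed
  qed
  also have "\<dots> = (C * nrm ?M v / sqrt (2 * l))^2 * \<phi> \<zeta>"
    unfolding power_mult_distrib pw_square using powr_antiderivative(2)[OF \<alpha>, of \<zeta>] \<zeta>
    by (simp add: integral_interval \<phi>_def)
  also have "\<dots> = (C^2 * \<phi> \<zeta> / (2 * l)) * (nrm ?M v)^2"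
    using l by (simp add: power_mult_distrib power_divide)
  finally have "(1 - C^2 * \<phi> \<zeta> / (2 * l)) * (nrm ?M v)^2 \<le> 0" by (simp add: algebra_simps)
  moreover have "C^2 * \<phi> \<zeta> / (2 * l) < 1"
  proof -
    have "0 \<le> C^2 * \<phi> \<zeta>" using \<phi>_nn[of \<zeta>] by simp
    moreover have "Y < 2 * (Y + 1)" if "0 \<le> Y" for Y :: real using that by (smt (verit))
    ultimately have "C^2 * \<phi> \<zeta> < 2 * l" unfolding l_def by blast
    then show ?thesis using l by simp
  qed
  ultimately have "nrm ?M v = 0"
    by (simp add: mult_le_0_iff)
  from nrm_eq_0_AE[OF vsq this] show ?thesis
    by eventually_elim (use E in \<open>auto simp: v_def less_le\<close>)
qed

text \<open>The inequality is strict, so the diagonal falls to the complementary part. With t fixed,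
  a kernel applied to such a column integrates over (t, zeta) only.\<close>

definition cut :: "(real \<Rightarrow> real \<Rightarrow> real) \<Rightarrow> real \<Rightarrow> real \<Rightarrow> real" where
  "cut c x t = (if t < x then c x t else 0)"

lemma cut_le: "\<bar>cut c x t\<bar> \<le> \<bar>c x t\<bar>"
  by (simp add: cut_def)

lemma kern_cut:
  assumes "kern (interval_lborel \<zeta>) a (interval_lborel \<zeta>) b c"
  shows "kern (interval_lborel \<zeta>) a (interval_lborel \<zeta>) b (cut c)"
proof (rule kern_bound[OF assms])
  have [measurable]: "(\<lambda>x. x) \<in> borel_measurable (interval_lborel \<zeta>)"
    by (rule borel_interval) simp
  have [measurable]: "(\<lambda>z. c (fst z) (snd z)) \<in> borel_measurable (interval_lborel \<zeta> \<Otimes>\<^sub>M interval_lborel \<zeta>)"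
    using kern_measurable[OF assms] by (simp add: case_prod_unfold)
  show "case_prod (cut c) \<in> borel_measurable (interval_lborel \<zeta> \<Otimes>\<^sub>M interval_lborel \<zeta>)"
    unfolding cut_def case_prod_unfold by measurable
qed (rule cut_le)

lemma sq_cut:
  fixes c :: "real \<Rightarrow> real \<Rightarrow> real"
  assumes "kern (interval_lborel \<zeta>) a (interval_lborel \<zeta>) b c" "weight (interval_lborel \<zeta>) a" "t \<in> {0<..<\<zeta>}"
  shows "sq (interval_lborel \<zeta>) (\<lambda>x. cut c x t)" "nrm (interval_lborel \<zeta>) (\<lambda>x. cut c x t) \<le> nrm (interval_lborel \<zeta>) (\<lambda>x. c x t)"
proof -
  show 1: "sq (interval_lborel \<zeta>) (\<lambda>x. cut c x t)"
    by (rule kern_sq2[OF kern_cut[OF assms(1)] assms(2)]) (use assms(3) in simp)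
  show "nrm (interval_lborel \<zeta>) (\<lambda>x. cut c x t) \<le> nrm (interval_lborel \<zeta>) (\<lambda>x. c x t)"
    by (rule nrm_mono[OF kern_sq2[OF assms(1,2)] sq_measurable[OF 1]])
      (use assms(3) cut_le in auto)
qed

text \<open>
  The column \<open>rcol k n _ t\<close> is the $n$-th term of the Neumann series of the equation
  $r(x,t) = k(x,t) + \int_t^\zeta k(x,u)\, r(u,t)\, du$, whose operator is the compression of $K$
  to $(t,\zeta)$.
\<close>

primrec rcol :: "real measure \<Rightarrow> (real \<Rightarrow> real \<Rightarrow> real) \<Rightarrow> nat \<Rightarrow> real \<Rightarrow> real \<Rightarrow> real" where
  "rcol M k 0 = k"
| "rcol M k (Suc n) = kcomp M k (cut (rcol M k n))"

context
  fixes \<alpha> \<zeta> q :: real and k :: "real \<Rightarrow> real \<Rightarrow> real" and M :: "real measure"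
  defines "M \<equiv> interval_lborel \<zeta>"
  assumes \<alpha>: "\<alpha> > -1" and \<zeta>: "0 < \<zeta>" and k: "kern M (pw \<alpha>) M (pw \<alpha>) k"
    and sym: "\<And>x y. x \<in> space M \<Longrightarrow> y \<in> space M \<Longrightarrow> k x y = k y x"
    and q: "0 < q" "q < 1"
    and contr: "\<And>f::real \<Rightarrow> real. sq M f \<Longrightarrow> nrm M (kint M k f) \<le> q * nrm M f"
begin

lemma weight_M: "weight M (pw \<alpha>)"
  unfolding M_def by (rule weight_pw[OF \<alpha> \<zeta>])

lemma space_M: "space M = {0<..<\<zeta>}" by (simp add: M_def)

lemma kern_cutM: "kern M (pw \<alpha>) M (pw \<alpha>) c \<Longrightarrow> kern M (pw \<alpha>) M (pw \<alpha>) (cut c)"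
  unfolding M_def by (rule kern_cut)

lemma kern_rcol: "kern M (pw \<alpha>) M (pw \<alpha>) (rcol M k n)"
  by (induction n) (auto intro!: kern_kcomp[OF k] weight_M kern_cutM k)

lemma sq_cut_rcol: "t \<in> space M \<Longrightarrow> sq M (\<lambda>x. cut (rcol M k n) x t)"
  by (rule kern_sq2[OF kern_cutM[OF kern_rcol] weight_M])

text \<open>Truncation can only lower the norm, and each application of \<open>k\<close> multiplies
  it by at most \<open>q\<close>, uniformly in t. The columns are real functions, the case covered
  by \<open>contr\<close>.\<close>

lemma nrm_cut_rcol: "t \<in> space M \<Longrightarrow> nrm M (\<lambda>x. cut (rcol M k n) x t) \<le> q ^ n * nrm M (\<lambda>x. k x t)"
proof (induction n)
  case 0
  then show ?case using sq_cut(2)[of \<zeta> "pw \<alpha>" "pw \<alpha>" k t] k weight_M by (simp add: M_def)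
next
  case (Suc n)
  have "nrm M (\<lambda>x. cut (rcol M k (Suc n)) x t) \<le> nrm M (\<lambda>x. rcol M k (Suc n) x t)"
    using sq_cut(2)[of \<zeta> "pw \<alpha>" "pw \<alpha>" "rcol M k (Suc n)" t] kern_rcol[of "Suc n"] weight_M Suc.prems
    unfolding M_def by (simp del: rcol.simps)
  also have "\<dots> = nrm M (kint M k (\<lambda>x. cut (rcol M k n) x t))"
    by (intro nrm_cong) (simp add: kcomp_eq_kint)
  also have "\<dots> \<le> q * nrm M (\<lambda>x. cut (rcol M k n) x t)"
    by (rule contr[OF sq_cut_rcol[OF Suc.prems]])
  also have "\<dots> \<le> q * (q ^ n * nrm M (\<lambda>x. k x t))"
    using Suc q by (intro mult_left_mono) auto
  finally show ?case by simp
qed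

text \<open>A norm bound for a column becomes a pointwise bound through one more application of
  \<open>k\<close>, whose row at x has norm at most C x^(alpha/2).\<close>

lemma rcol_bound:
  obtains D where "0 \<le> D" "\<And>n x t. x \<in> space M \<Longrightarrow> t \<in> space M \<Longrightarrow> \<bar>rcol M k n x t\<bar> \<le> q ^ n * (D * pw \<alpha> x * pw \<alpha> t)"
proof -
  obtain D where D: "0 \<le> D" "\<And>x y. x \<in> space M \<Longrightarrow> y \<in> space M \<Longrightarrow> \<bar>k x y\<bar> \<le> D * pw \<alpha> x * pw \<alpha> y"
    using kernE[OF k] by blast
  obtain C where C: "0 \<le> C" "\<And>x. x \<in> space M \<Longrightarrow> nrm M (k x) \<le> C * pw \<alpha> x"
    using kern_row_nrm[OF k weight_M] by (metis powr_ge_zero)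
  have C': "nrm M (\<lambda>x. k x t) \<le> C * pw \<alpha> t" if "t \<in> space M" for t
    using C(2)[OF that] nrm_cong[of M "\<lambda>x. k x t" "k t"] sym[OF _ that] by simp
  \<comment> \<open>The term n = 0 costs \<open>D\<close>; for n = m + 1 the norm bound supplies
    only q^m, hence the quotient C^2 / q.\<close>
  have "\<bar>rcol M k n x t\<bar> \<le> q ^ n * ((D + C^2 / q) * pw \<alpha> x * pw \<alpha> t)"
    if x: "x \<in> space M" and t: "t \<in> space M" for n x t
  proof (cases n)
    case 0
    have "\<bar>k x t\<bar> \<le> D * pw \<alpha> x * pw \<alpha> t" by (rule D(2)[OF x t])
    also have "\<dots> \<le> (D + C^2 / q) * pw \<alpha> x * pw \<alpha> t"
      using q by (intro mult_right_mono) auto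
    finally show ?thesis using 0 by simp
  next
    case (Suc m)
    have "\<bar>rcol M k n x t\<bar> \<le> nrm M (k x) * nrm M (\<lambda>x. cut (rcol M k m) x t)"
      unfolding Suc rcol.simps kcomp_eq_kint
      using kint_norm_le[OF k weight_M x sq_cut_rcol[OF t, of m]] by simp
    also have "\<dots> \<le> (C * pw \<alpha> x) * (q ^ m * (C * pw \<alpha> t))"
    proof (intro mult_mono C(2) x nrm_nonneg)
      show "nrm M (\<lambda>x. cut (rcol M k m) x t) \<le> q ^ m * (C * pw \<alpha> t)"
        by (rule order_trans[OF nrm_cut_rcol[OF t]]) (intro mult_left_mono C' t, use q in simp)
    qed (use C(1) in simp)
    also have "\<dots> = q ^ n * ((C^2 / q) * pw \<alpha> x * pw \<alpha> t)"
      using q by (simp add: Suc power2_eq_square)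
    also have "\<dots> \<le> q ^ n * ((D + C^2 / q) * pw \<alpha> x * pw \<alpha> t)"
      using D q by (intro mult_left_mono mult_right_mono) auto
    finally show ?thesis .
  qed
  then show ?thesis using that[of "D + C^2 / q"] D q by simp
qed

text \<open>Summing the recursion of \<open>rcol\<close> over n reproduces the series without its
  first term. The geometric pointwise bound makes the sum a dominated kernel and permits integration
  term by term.\<close>

lemma resolvent_kernel:
  obtains r where "kern M (pw \<alpha>) M (pw \<alpha>) r"
    "\<And>x t. x \<in> space M \<Longrightarrow> t \<in> space M \<Longrightarrow> r x t = k x t + kcomp M k (cut r) x t"
proof -
  obtain D where D: "0 \<le> D" "\<And>n x t. x \<in> space M \<Longrightarrow> t \<in> space M \<Longrightarrow> \<bar>rcol M k n x t\<bar> \<le> q ^ n * (D * pw \<alpha> x * pw \<alpha> t)"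
    using rcol_bound by blast
  define r where "r x t = (\<Sum>n. rcol M k n x t)" for x t
  have geo: "summable (\<lambda>n. q ^ n * B)" "(\<Sum>n. q ^ n * B) = B / (1 - q)" for B
    using q summable_mult2[OF summable_geometric[of q], of B] suminf_mult2[OF summable_geometric[of q], of B] suminf_geometric[of q]
    by auto
  have summ: "summable (\<lambda>n. rcol M k n x t)" "\<bar>r x t\<bar> \<le> D * pw \<alpha> x * pw \<alpha> t / (1 - q)"
    if "x \<in> space M" "t \<in> space M" for x t
  proof -
    show "summable (\<lambda>n. rcol M k n x t)"
      by (rule summable_comparison_test'[OF geo(1)]) (use D(2)[OF that] in auto)
    have "norm (\<Sum>n. rcol M k n x t) \<le> (\<Sum>n. q ^ n * (D * pw \<alpha> x * pw \<alpha> t))"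
      by (rule norm_suminf_le[OF _ geo(1)]) (use D(2)[OF that] in auto)
    then show "\<bar>r x t\<bar> \<le> D * pw \<alpha> x * pw \<alpha> t / (1 - q)" by (simp add: r_def geo)
  qed
  have r: "kern M (pw \<alpha>) M (pw \<alpha>) r"
    unfolding kern_def
  proof (intro conjI exI[of _ "D / (1 - q)"] ballI)
    have "(\<lambda>z. \<Sum>n. case_prod (rcol M k n) z) \<in> borel_measurable (M \<Otimes>\<^sub>M M)"
      by (intro borel_measurable_suminf kern_measurable[OF kern_rcol])
    then show "case_prod r \<in> borel_measurable (M \<Otimes>\<^sub>M M)"
      by (simp add: r_def[abs_def] case_prod_unfold)
  qed (use D q summ in auto)
  have "r x t = k x t + kcomp M k (cut r) x t" if x: "x \<in> space M" and t: "t \<in> space M" for x t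
  proof -
    let ?f = "\<lambda>n u. k x u * cut (rcol M k n) u t"
    have kx: "sq M (k x)" by (rule kern_sq1[OF k weight_M x])
    have a: "sq M (pw \<alpha>)" using weight_M by (simp add: weight_def)
    have bd: "norm (?f n u) \<le> q ^ n * (D * pw \<alpha> t * (norm (k x u) * norm (pw \<alpha> u)))" if "u \<in> space M" for n u
    proof -
      have "norm (?f n u) \<le> norm (k x u) * (q ^ n * (D * pw \<alpha> u * pw \<alpha> t))"
        using order_trans[OF cut_le[of "rcol M k n" u t] D(2)[OF that t]] by (auto simp: abs_mult intro!: mult_left_mono)
      then show ?thesis by (simp add: mult_ac)
    qed
    have ki: "integrable M (\<lambda>u. norm (k x u) * norm (pw \<alpha> u))"
      by (rule sq_integrable_norm_mult[OF kx a])
    have int: "integrable M (?f n)" for n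
      using kcomp_integrable[OF k kern_cutM[OF kern_rcol] weight_M x t] .
    have "(\<Sum>n. rcol M k (Suc n) x t) = (\<Sum>n. LINT u|M. ?f n u)"
      by (simp add: kcomp_def)
    also have "\<dots> = (LINT u|M. (\<Sum>n. ?f n u))"
    proof (rule integral_suminf[symmetric, OF int])
      show "AE u in M. summable (\<lambda>n. norm (?f n u))"
      proof (rule AE_I2)
        fix u assume "u \<in> space M"
        then show "summable (\<lambda>n. norm (?f n u))"
          by (intro summable_comparison_test'[OF geo(1)]) (use bd in auto)
      qed
      show "summable (\<lambda>n. LINT u|M. norm (?f n u))"
      proof (rule summable_comparison_test'[OF geo(1)])
        fix n
        have "(LINT u|M. norm (?f n u)) \<le> (LINT u|M. q ^ n * (D * pw \<alpha> t * (norm (k x u) * norm (pw \<alpha> u))))"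
          by (intro integral_mono integrable_norm int integrable_mult_right ki bd)
        then show "norm (LINT u|M. norm (?f n u)) \<le> q ^ n * (D * pw \<alpha> t * (LINT u|M. norm (k x u) * norm (pw \<alpha> u)))"
          by simp
      qed
    qed
    also have "\<dots> = kcomp M k (cut r) x t"
      unfolding kcomp_def
    proof (intro Bochner_Integration.integral_cong refl)
      fix u assume u: "u \<in> space M"
      have "(\<Sum>n. k x u * cut (rcol M k n) u t) = k x u * (if t < u then (\<Sum>n. rcol M k n u t) else 0)"
        unfolding cut_def using summ(1)[OF u t] by (simp add: suminf_mult)
      then show "(\<Sum>n. k x u * cut (rcol M k n) u t) = k x u * cut r u t"
        by (simp add: cut_def r_def)
    qed
    finally show ?thesis
      using suminf_split_head[OF summ(1)[OF x t]] by (simp add: r_def del: rcol.simps) simp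
  qed
  with r show ?thesis using that by blast
qed

text \<open>Write r = l + u with l strictly below the diagonal. The equation for r then says exactly
  that (I - K)(I + l) = I - u. With R = I + l, V' = I - u and V the transpose of V', the symmetry of
  \<open>k\<close> gives V = R^T (I - K). So V R and R^T V' are the same operator, lower triangular
  in the first form and upper triangular in the second.\<close>

proposition triangular_factorization:
  "invertible_op M (iop M (\<lambda>x y. - k x y))" "factorable \<zeta> (iop M (\<lambda>x y. - k x y))"
proof -
  obtain r where r: "kern M (pw \<alpha>) M (pw \<alpha>) r"
    and req: "\<And>x t. x \<in> space M \<Longrightarrow> t \<in> space M \<Longrightarrow> r x t = k x t + kcomp M k (cut r) x t"
    using resolvent_kernel by blast
  define l where "l = cut r"
  define u where "u x t = r x t - l x t" for x t
  define V where "V = iop M (\<lambda>x t. - u t x)"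
  define V' where "V' = iop M (\<lambda>x t. - u x t)"
  define R where "R = iop M l"
  define S where "S = iop M (\<lambda>x y. - k x y)"
  have l: "kern M (pw \<alpha>) M (pw \<alpha>) l" unfolding l_def by (rule kern_cutM[OF r])
  have u_add: "u = (\<lambda>x t. r x t + - l x t)" by (auto simp: u_def fun_eq_iff)
  have u: "kern M (pw \<alpha>) M (pw \<alpha>) u" unfolding u_add by (rule kern_add[OF r kern_uminus[OF l]])
  have nu: "kern M (pw \<alpha>) M (pw \<alpha>) (\<lambda>x t. - u x t)" by (rule kern_uminus[OF u])
  have nuT: "kern M (pw \<alpha>) M (pw \<alpha>) (\<lambda>x t. - u t x)" by (rule kern_uminus[OF kern_transpose[OF u]])
  have lT: "kern M (pw \<alpha>) M (pw \<alpha>) (\<lambda>x t. l t x)" by (rule kern_transpose[OF l])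
  have nk: "kern M (pw \<alpha>) M (pw \<alpha>) (\<lambda>x t. - k x t)" by (rule kern_uminus[OF k])
  have l0: "l x t = 0" if "x \<le> t" for x t using that by (simp add: l_def cut_def)
  have u0: "u x t = 0" if "t < x" for x t using that by (simp add: u_def l_def cut_def)
  have kl: "kern M (pw \<alpha>) M (pw \<alpha>) (kcomp M k l)" by (rule kern_kcomp[OF k l weight_M weight_M weight_M])
  have lk: "kern M (pw \<alpha>) M (pw \<alpha>) (kcomp M (\<lambda>x t. l t x) k)" by (rule kern_kcomp[OF lT k weight_M weight_M weight_M])
  \<comment> \<open>The kernel form of (I - K)(I + l) = I - u; \<open>id2\<close> is its
    transpose.\<close>
  have id1: "- u x t = l x t - k x t - kcomp M k l x t" if "x \<in> space M" "t \<in> space M" for x t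
    using req[OF that] by (simp add: u_def l_def)
  have id2: "- u t x = l t x - k x t - kcomp M (\<lambda>x t. l t x) k x t" if "x \<in> space M" "t \<in> space M" for x t
  proof -
    have "kcomp M k l t x = kcomp M (\<lambda>x t. l t x) k x t"
      unfolding kcomp_def using sym that by (intro Bochner_Integration.integral_cong) (auto simp: mult.commute)
    then show ?thesis using id1[OF that(2,1)] sym[OF that] by simp
  qed
  \<comment> \<open>The kernel of V R - I; \<open>c_eq\<close> rewrites it as the kernel of R^T V' -
    I.\<close>
  define c where "c x t = - u t x + l x t + kcomp M (\<lambda>x t. - u t x) l x t" for x t
  have c_eq: "c x t = l t x - u x t - kcomp M (\<lambda>x t. l t x) u x t" if x: "x \<in> space M" and t: "t \<in> space M" for x t
  proof -
    note I = kcomp_integrable[OF _ _ weight_M x t]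
    have "kcomp M (\<lambda>x t. - u t x) l x t = (LINT y|M. l y x * l y t - k x y * l y t - kcomp M (\<lambda>x t. l t x) k x y * l y t)"
      unfolding kcomp_def[of M "\<lambda>x t. - u t x"]
      by (intro Bochner_Integration.integral_cong refl) (simp add: id2[OF x] algebra_simps)
    also have "\<dots> = kcomp M (\<lambda>x t. l t x) l x t - kcomp M k l x t - kcomp M (kcomp M (\<lambda>x t. l t x) k) l x t"
      using I[OF lT l] I[OF k l] I[OF lk l] by (simp add: kcomp_def)
    finally have 1: "kcomp M (\<lambda>x t. - u t x) l x t = kcomp M (\<lambda>x t. l t x) l x t - kcomp M k l x t
        - kcomp M (\<lambda>x t. l t x) (kcomp M k l) x t"
      using kcomp_assoc[where g = l and z = t, OF lT k weight_M weight_M x kern_sq2[OF l weight_M t]] by simp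
    have "- kcomp M (\<lambda>x t. l t x) u x t = (LINT y|M. l y x * l y t - l y x * k y t - l y x * kcomp M k l y t)"
      unfolding kcomp_def[of M "\<lambda>x t. l t x" u] integral_minus[symmetric]
    proof (intro Bochner_Integration.integral_cong refl)
      fix y assume y: "y \<in> space M"
      have "- (l y x * u y t) = l y x * (- u y t)" by simp
      also have "\<dots> = l y x * l y t - l y x * k y t - l y x * kcomp M k l y t"
        unfolding id1[OF y t] by (simp add: algebra_simps)
      finally show "- (l y x * u y t) = l y x * l y t - l y x * k y t - l y x * kcomp M k l y t" .
    qed
    also have "\<dots> = kcomp M (\<lambda>x t. l t x) l x t - kcomp M (\<lambda>x t. l t x) k x t - kcomp M (\<lambda>x t. l t x) (kcomp M k l) x t"
      using I[OF lT l] I[OF lT k] I[OF lT kl] by (simp add: kcomp_def)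
    finally show ?thesis
      unfolding c_def 1 id2[OF x t] using id1[OF x t] by simp
  qed
  \<comment> \<open>For x < t the product of lower triangular kernels vanishes, for t < x the
    product of upper triangular ones. On the diagonal \<open>c\<close> need not vanish, but that is
    a single point of each row.\<close>
  have c0: "c x t = 0" if x: "x \<in> space M" and t: "t \<in> space M" and "x \<noteq> t" for x t
  proof (cases "x < t")
    case True
    have "(\<lambda>y. - u y x * l y t) = (\<lambda>_. 0)"
    proof
      show "- u y x * l y t = 0" for y
        using True u0[of x y] l0[of y t] by (cases "x < y") (auto intro!: l0)
    qed
    then show ?thesis using True u0 l0 by (simp add: c_def kcomp_def)
  next
    case False
    then have *: "t < x" using \<open>x \<noteq> t\<close> by simp
    have "(\<lambda>y. l y x * u y t) = (\<lambda>_. 0)"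
    proof
      show "l y x * u y t = 0" for y
        using * u0[of t y] l0[of y x] by (cases "y \<le> x") auto
    qed
    then show ?thesis using * u0 l0 by (simp add: c_eq[OF x t] kcomp_def)
  qed
  have VR: "V (R f) x = f x" if "x \<in> space M" "sq M f" for f x
  proof -
    have "V (R f) x = iop M c f x"
      unfolding V_def R_def by (simp add: iop_iop[OF nuT l weight_M that] c_def[abs_def])
    also have "kint M c f x = 0"
      unfolding kint_def
    proof (rule integral_eq_zero_AE)
      show "AE y in M. c x y *\<^sub>R f y = 0"
        using AE_interval_neq[of x \<zeta>] AE_space[of M] unfolding M_def[symmetric]
        by eventually_elim (use c0[OF that(1)] in auto)
    qed
    then have "iop M c f x = f x" by (simp add: iop_def)
    finally show ?thesis .
  qed
  have SR: "S (R f) x = V' f x" if "x \<in> space M" "sq M f" for f x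
  proof -
    have "kcomp M (\<lambda>x y. - k x y) l y t = - kcomp M k l y t" for y t
      by (simp add: kcomp_def)
    then have "S (R f) x = iop M (\<lambda>x t. - k x t + l x t - kcomp M k l x t) f x"
      unfolding S_def R_def by (simp add: iop_iop[OF nk l weight_M that])
    also have "\<dots> = V' f x"
      unfolding V'_def iop_def using id1[OF that(1)] by (auto intro!: kint_cong_kern)
    finally show ?thesis .
  qed
  have sqR: "sq M (R f)" and sqV: "sq M (V f)" and sqV': "sq M (V' f)" if "sq M f" for f
    unfolding R_def V_def V'_def
    by (rule iop_sq[OF l weight_M that] iop_sq[OF nuT weight_M that] iop_sq[OF nu weight_M that])+
  \<comment> \<open>So far \<open>R\<close> is only a right inverse of \<open>V\<close>. Injectivity
    of \<open>V\<close>, a Volterra operator of the second kind, makes it a two-sided one.\<close>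
  have V_inj: "AE x in M. w x = 0" if w: "sq M w" and Vw: "AE x in M. V w x = 0" for w
  proof -
    obtain C where C: "0 \<le> C" "\<And>x y. x \<in> space M \<Longrightarrow> y \<in> space M \<Longrightarrow> \<bar>u x y\<bar> \<le> C * pw \<alpha> x * pw \<alpha> y"
      using kernE[OF u] by blast
    have "AE x in M. norm (w x) \<le> C * pw \<alpha> x * (LINT t|M. (if t \<le> x then pw \<alpha> t * norm (w t) else 0))"
      using Vw AE_space[of M]
    proof eventually_elim
      case (elim x)
      let ?g = "\<lambda>t. (if t \<le> x then pw \<alpha> t * norm (w t) else 0)"
      have "w x = kint M (\<lambda>x t. u t x) w x"
        using elim(1) unfolding V_def iop_def kint_uminus_kern by simp
      then have "norm (w x) \<le> (LINT t|M. norm (u t x *\<^sub>R w t))"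
        unfolding kint_def by (metis integral_norm_bound)
      also have "\<dots> \<le> (LINT t|M. C * pw \<alpha> x * ?g t)"
      proof (rule integral_mono)
        show "integrable M (\<lambda>t. norm (u t x *\<^sub>R w t))"
          by (rule integrable_norm[OF kint_integrable[OF kern_transpose[OF u] weight_M elim(2) w]])
        have "integrable M ?g"
        proof (rule sq_integrable_bound[of M "pw \<alpha>" w _ 1])
          show "sq M (pw \<alpha>)" using weight_M by (simp add: weight_def)
          have [measurable]: "(\<lambda>x. x) \<in> borel_measurable M" "w \<in> borel_measurable M"
            using w by (auto simp: M_def sq_def intro!: borel_interval)
          show "?g \<in> borel_measurable M" by measurable
        qed (use w in auto)
        then show "integrable M (\<lambda>t. C * pw \<alpha> x * ?g t)" by simp
        show "norm (u t x *\<^sub>R w t) \<le> C * pw \<alpha> x * ?g t" if "t \<in> space M" for t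
          using mult_right_mono[OF C(2)[OF that elim(2)] norm_ge_zero[of "w t"]] u0[of x t]
          by (auto simp: mult_ac)
      qed
      finally show ?case by simp
    qed
    then show ?thesis
      using Volterra_unique[OF \<alpha> \<zeta>, of w C] w C(1) unfolding M_def by blast
  qed
  have V_add: "V (\<lambda>x. g x + h x) x = V g x + V h x" if "x \<in> space M" "sq M g" "sq M h" for g h x
    by (simp add: V_def iop_def kint_add_right[OF nuT weight_M that])
  have RV: "AE x in M. R (V f) x = f x" if f: "sq M f" for f
  proof -
    have s: "sq M (R (V f))" by (intro sqR sqV f)
    have "V (\<lambda>x. R (V f) x - f x) x = 0" if x: "x \<in> space M" for x
    proof -
      have "V (\<lambda>x. R (V f) x + - f x) x = V (R (V f)) x + V (\<lambda>x. - f x) x"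
        by (rule V_add[OF x s sq_uminus[OF f]])
      moreover have "V (\<lambda>x. - f x) x = - V f x"
        by (simp add: V_def iop_def kint_def)
      ultimately show ?thesis using VR[OF x sqV[OF f]] by simp
    qed
    then have "AE x in M. R (V f) x - f x = 0"
      using V_inj[OF sq_diff[OF s f]] by auto
    then show ?thesis by simp
  qed
  have kint_AE: "kint M b f x = kint M b g x" if "kern M (pw \<alpha>) M (pw \<alpha>) b" "x \<in> space M" "sq M f" "sq M g" "AE x in M. f x = g x"
    for b x and f g :: "real \<Rightarrow> complex"
    by (rule kint_cong_AE[OF that(1,2)]) (use that in \<open>auto simp: sq_def\<close>)
  have bV: "bounded_op M V" and bV': "bounded_op M V'" and bR: "bounded_op M R" and bS: "bounded_op M S"
    unfolding V_def V'_def R_def S_def by (rule bounded_op_iop[OF nuT weight_M] bounded_op_iop[OF nu weight_M] bounded_op_iop[OF l weight_M] bounded_op_iop[OF nk weight_M])+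
  have adj: "is_adjoint M V V'"
    unfolding V_def V'_def by (rule is_adjoint_iop[OF nuT weight_M])
  have inv: "is_inverse M V R"
    unfolding is_inverse_def op_eq_def using bV bR VR RV by (auto simp: L2_iff_sq)
  have SV: "AE x in M. S f x = V' (V f) x" if f: "sq M f" for f
    using RV[OF f] AE_space[of M]
  proof eventually_elim
    case (elim x)
    have "S (R (V f)) x = S f x"
      unfolding S_def iop_def[of M "\<lambda>x y. - k x y"] using elim kint_AE[OF nk elim(2) sqR[OF sqV[OF f]] f RV[OF f]] by simp
    then show ?case using SR[OF elim(2) sqV[OF f]] by simp
  qed
  \<comment> \<open>For x < \<mu> the row at x reaches only arguments t \<le> x, where the truncated
    function is 0.\<close>
  have tri: "iop M b (trunc_op \<zeta> \<mu> f) x = trunc_op \<zeta> \<mu> (iop M b (trunc_op \<zeta> \<mu> f)) x"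
    if "\<And>x t. x < t \<Longrightarrow> b x t = 0" "x \<in> space M" for b \<mu> f x
  proof (cases "\<mu> \<le> x")
    case True
    then show ?thesis using that(2) by (simp add: trunc_op_def space_M)
  next
    case False
    then have "(\<lambda>y. b x y *\<^sub>R trunc_op \<zeta> \<mu> f y) = (\<lambda>_. 0)"
      using that(1)[of x] by (auto simp: trunc_op_def fun_eq_iff)
    then show ?thesis using False by (simp add: trunc_op_def iop_def kint_def)
  qed
  show "factorable \<zeta> (iop M (\<lambda>x y. - k x y))"
    unfolding factorable_def M_def[symmetric] S_def[symmetric]
  proof (intro exI conjI ballI)
    show "op_eq M S (V' \<circ> V)" using SV by (auto simp: op_eq_def L2_iff_sq)
    show "op_eq M (V \<circ> trunc_op \<zeta> \<mu>) (trunc_op \<zeta> \<mu> \<circ> V \<circ> trunc_op \<zeta> \<mu>)" for \<mu>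
      unfolding op_eq_def V_def using tri[of "\<lambda>x t. - u t x" _ \<mu>] u0 by (auto intro!: AE_I2)
    show "op_eq M (R \<circ> trunc_op \<zeta> \<mu>) (trunc_op \<zeta> \<mu> \<circ> R \<circ> trunc_op \<zeta> \<mu>)" for \<mu>
      unfolding op_eq_def R_def using tri[of l _ \<mu>] l0 by (auto intro!: AE_I2)
  qed (fact adj inv)+
  define R' where "R' = iop M (\<lambda>x t. l t x)"
  have sqR': "sq M (R' f)" if "sq M f" for f
    unfolding R'_def by (rule iop_sq[OF lT weight_M that])
  have V_R': "R' (S f) x = V f x" if "x \<in> space M" "sq M f" for f x
  proof -
    have "kcomp M (\<lambda>x t. l t x) (\<lambda>x y. - k x y) y t = - kcomp M (\<lambda>x t. l t x) k y t" for y t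
      by (simp add: kcomp_def)
    then have "R' (S f) x = iop M (\<lambda>x t. l t x + - k x t - kcomp M (\<lambda>x t. l t x) k x t) f x"
      unfolding S_def R'_def by (simp add: iop_iop[OF lT nk weight_M that])
    also have "\<dots> = V f x"
      unfolding V_def iop_def using id2[OF that(1)] by (auto intro!: kint_cong_kern)
    finally show ?thesis .
  qed
  have R'V': "R' (V' f) x = f x" if x: "x \<in> space M" and f: "sq M f" for f x
  proof -
    have "R' (V' f) x = R' (S (R f)) x"
      unfolding R'_def iop_def using SR[OF _ f] x by (auto intro!: kint_cong)
    then show ?thesis using V_R'[OF x sqR[OF f]] VR[OF x f] by simp
  qed
  \<comment> \<open>Since S = V' V, the inverse of S is R R', with R' the adjoint of R.\<close>
  have "is_inverse M S (R \<circ> R')"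
    unfolding is_inverse_def
  proof (intro conjI bS)
    have rr: "kern M (pw \<alpha>) M (pw \<alpha>) (\<lambda>x y. l x y + l y x + kcomp M l (\<lambda>x t. l t x) x y)"
      by (intro kern_add l lT kern_kcomp[OF l lT weight_M weight_M weight_M])
    have RR: "(R \<circ> R') f x = iop M (\<lambda>x y. l x y + l y x + kcomp M l (\<lambda>x t. l t x) x y) f x" if "x \<in> space M" "sq M f" for f x
      unfolding R_def R'_def comp_def by (rule iop_iop[OF l lT weight_M that])
    have bRR: "bounded_op M (iop M (\<lambda>x y. l x y + l y x + kcomp M l (\<lambda>x t. l t x) x y))"
      by (rule bounded_op_iop[OF rr weight_M])
    show "bounded_op M (R \<circ> R')"
      unfolding bounded_op_def
    proof (intro conjI ballI allI)
      show "(R \<circ> R') f \<in> L2 M" if "f \<in> L2 M" for f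
        using that sqR sqR' by (simp add: L2_iff_sq)
      show "AE x in M. (R \<circ> R') (\<lambda>y. f y + g y) x = (R \<circ> R') f x + (R \<circ> R') g x" if "f \<in> L2 M" "g \<in> L2 M" for f g
      proof (rule AE_I2)
        fix x assume x: "x \<in> space M"
        have fg: "sq M f" "sq M g" using that by (auto simp: L2_iff_sq)
        show "(R \<circ> R') (\<lambda>y. f y + g y) x = (R \<circ> R') f x + (R \<circ> R') g x"
          unfolding RR[OF x fg(1)] RR[OF x fg(2)] RR[OF x sq_add[OF fg]]
          by (simp add: iop_def kint_add_right[OF rr weight_M x fg])
      qed
      show "AE x in M. (R \<circ> R') (\<lambda>y. s * f y) x = s * (R \<circ> R') f x" for s f
        by (simp add: R_def R'_def iop_def[abs_def] kint_mult_complex distrib_left[symmetric])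
      obtain C where C: "\<And>f. f \<in> L2 M \<Longrightarrow> L2_norm M (iop M (\<lambda>x y. l x y + l y x + kcomp M l (\<lambda>x t. l t x) x y) f) \<le> C * L2_norm M f"
        using bRR unfolding bounded_op_def by blast
      have "L2_norm M ((R \<circ> R') f) \<le> C * L2_norm M f" if "f \<in> L2 M" for f
      proof -
        have f: "sq M f" using that by (simp add: L2_iff_sq)
        have "L2_norm M ((R \<circ> R') f) = L2_norm M (iop M (\<lambda>x y. l x y + l y x + kcomp M l (\<lambda>x t. l t x) x y) f)"
          unfolding L2_norm_eq_nrm by (rule nrm_cong[OF RR[OF _ f]])
        then show ?thesis using C[OF that] by simp
      qed
      then show "\<exists>C. \<forall>f\<in>L2 M. L2_norm M ((R \<circ> R') f) \<le> C * L2_norm M f" by blast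
    qed
    have "(AE x in M. S (R (R' f)) x = f x)" if f: "sq M f" for f
    proof -
      \<comment> \<open>V' R' is the adjoint of R V = I. Moving V' and R' to the other side as V and
        R shows that the defect \<open>?g\<close> is orthogonal to itself.\<close>
      let ?g = "\<lambda>x. V' (R' f) x - f x"
      have s: "sq M (V' (R' f))" by (intro sqV' sqR' f)
      have g: "sq M ?g" by (rule sq_diff[OF s f])
      have "L2_inner M ?g (V' (R' f)) = L2_inner M (V ?g) (R' f)"
        using adj g sqR'[OF f] by (simp add: is_adjoint_def L2_iff_sq)
      also have "\<dots> = L2_inner M (R (V ?g)) f"
        using is_adjoint_iop[OF l weight_M] sqV[OF g] f by (simp add: is_adjoint_def L2_iff_sq R_def R'_def)
      also have "\<dots> = L2_inner M ?g f"
        unfolding L2_inner_def using RV[OF g] sq_measurable[OF f] sq_measurable[OF g] sq_measurable[OF sqR[OF sqV[OF g]]]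
        by (intro integral_cong_AE borel_measurable_times borel_measurable_cnj) auto
      finally have "L2_inner M ?g ?g = 0"
        using L2_inner_integrable[OF g s] L2_inner_integrable[OF g f]
        by (simp add: L2_inner_def right_diff_distrib)
      then have "nrm M ?g = 0" by (simp add: L2_inner_self)
      from nrm_eq_0_AE[OF g this] have V'R': "AE x in M. V' (R' f) x = f x" by simp
      then show ?thesis using SR[OF _ sqR'[OF f]] by (auto elim!: AE_mp intro!: AE_I2)
    qed
    then show "op_eq M (S \<circ> (R \<circ> R')) id" by (auto simp: op_eq_def L2_iff_sq)
    have "AE x in M. R (R' (S f)) x = f x" if f: "sq M f" for f
      using RV[OF f] AE_space[of M]
    proof eventually_elim
      case (elim x)
      have "R (R' (S f)) x = R (V f) x"
        unfolding R_def iop_def[of M l] using V_R'[OF _ f] elim(2) by (auto intro!: kint_cong)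
      then show ?case using elim(1) by simp
    qed
    then show "op_eq M ((R \<circ> R') \<circ> S) id" by (auto simp: op_eq_def L2_iff_sq)
  qed
  then show "invertible_op M (iop M (\<lambda>x y. - k x y))"
    unfolding invertible_op_def S_def[symmetric] by blast
qed

end

section \<open>Trace class\<close>

definition orthonormal :: "'a measure \<Rightarrow> ('a \<Rightarrow> complex) set \<Rightarrow> bool" where
  "orthonormal M E \<longleftrightarrow> E \<subseteq> L2 M \<and>
     (\<forall>e\<in>E. \<forall>e'\<in>E. L2_inner M e e' = (if e = e' then 1 else 0))"

text \<open>Zorn's lemma applied to sets of representatives. Two different representatives of one
  class never occur together, as their inner product would be 1 and not 0.\<close>

lemma exists_onb: "\<exists>E. is_onb M E"
proof -
  have "\<exists>E\<in>Collect (orthonormal M). \<forall>X\<in>Collect (orthonormal M). E \<subseteq> X \<longrightarrow> X = E"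
  proof (rule subset_Zorn')
    fix Ch assume Ch: "subset.chain (Collect (orthonormal M)) Ch"
    have 1: "orthonormal M X" if "X \<in> Ch" for X
      using Ch that by (auto simp: subset.chain_def)
    have 2: "\<exists>X\<in>Ch. e \<in> X \<and> e' \<in> X" if "e \<in> \<Union>Ch" "e' \<in> \<Union>Ch" for e e'
      using Ch that unfolding subset.chain_def by blast
    have "orthonormal M (\<Union>Ch)"
      unfolding orthonormal_def using 1 2 unfolding orthonormal_def
      by (intro conjI Union_least ballI) blast+
    then show "\<Union>Ch \<in> Collect (orthonormal M)" by simp
  qed
  then obtain E where E: "orthonormal M E" and max: "\<And>X. orthonormal M X \<Longrightarrow> E \<subseteq> X \<Longrightarrow> X = E"
    by auto
  have "AE x in M. f x = 0" if f: "f \<in> L2 M" and ort: "\<forall>e\<in>E. L2_inner M f e = 0" for f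
  proof -
    have f': "sq M f" using f by (simp add: L2_iff_sq)
    have "nrm M f = 0"
    proof (rule ccontr)
      assume n0: "nrm M f \<noteq> 0"
      define g where "g = (\<lambda>x. of_real (1 / nrm M f) * f x)"
      have gL: "g \<in> L2 M"
        using sq_scaleR[OF f', of "1 / nrm M f"] by (simp add: g_def L2_iff_sq scaleR_conv_of_real)
      have gE: "L2_inner M g e = of_real (1 / nrm M f) * L2_inner M f e" for e
        by (simp add: L2_inner_def g_def mult.assoc)
      have "nrm M g = 1"
        using nrm_scaleR[of M "1 / nrm M f" f] n0 nrm_nonneg[of M f]
        by (simp add: g_def scaleR_conv_of_real)
      then have gg: "L2_inner M g g = 1" by (simp add: L2_inner_self)
      have ge: "L2_inner M g e = 0" "L2_inner M e g = 0" if "e \<in> E" for e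
      proof -
        show "L2_inner M g e = 0" using gE[of e] ort that by simp
        then show "L2_inner M e g = 0" by (subst L2_inner_commute) simp
      qed
      have "g \<notin> E" using ge gg by fastforce
      moreover have "orthonormal M (insert g E)"
        using E gL gg ge \<open>g \<notin> E\<close> unfolding orthonormal_def by auto
      ultimately show False using max[of "insert g E"] by auto
    qed
    then show ?thesis by (rule nrm_eq_0_AE[OF f'])
  qed
  then show ?thesis using E unfolding is_onb_def orthonormal_def by blast
qed

section \<open>Finite sums and Bessel's inequality\<close>

lemma sq_sum:
  assumes "finite F" "\<And>e. e \<in> F \<Longrightarrow> sq M (g e)"
  shows "sq M (\<lambda>x. \<Sum>e\<in>F. g e x)"
  using assms
proof (induction F rule: finite_induct)
  case empty
  then show ?case by (simp add: sq_def)
next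
  case (insert a F)
  then show ?case using sq_add[of M "g a" "\<lambda>x. \<Sum>e\<in>F. g e x"] by simp
qed

lemma Bessel_inequality:
  assumes "finite F" "orthonormal M F" "sq M h"
  shows "(\<Sum>e\<in>F. (norm (L2_inner M h e))^2) \<le> (nrm M h)^2"
proof -
  define c where "c e = L2_inner M h e" for e
  define p where "p = (\<lambda>x. \<Sum>e\<in>F. c e * e x)"
  have e: "sq M e" if "e \<in> F" for e
    using assms(2) that by (auto simp: orthonormal_def L2_iff_sq)
  have ce: "sq M (\<lambda>x. c e * e x)" if "e \<in> F" for e
    using e[OF that] by (auto simp: sq_def norm_mult power_mult_distrib)
  have p: "sq M p" unfolding p_def by (rule sq_sum[OF assms(1) ce])
  have pe: "L2_inner M g p = (\<Sum>e\<in>F. cnj (c e) * L2_inner M g e)" if g: "sq M g" for g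
  proof -
    have "L2_inner M g p = (LINT x|M. (\<Sum>e\<in>F. g x * cnj (c e * e x)))"
      unfolding L2_inner_def p_def by (simp add: sum_distrib_left)
    also have "\<dots> = (\<Sum>e\<in>F. LINT x|M. g x * cnj (c e * e x))"
      by (intro Bochner_Integration.integral_sum L2_inner_integrable g ce)
    also have "\<dots> = (\<Sum>e\<in>F. cnj (c e) * L2_inner M g e)"
      unfolding L2_inner_def by (intro sum.cong refl) (simp flip: integral_mult_right_zero add: mult.left_commute)
    finally show ?thesis .
  qed
  have hp: "L2_inner M h p = of_real (\<Sum>e\<in>F. (norm (c e))^2)"
    unfolding pe[OF assms(3)] by (simp add: c_def[symmetric] complex_norm_square mult.commute del: of_real_power)
  have "L2_inner M p e = c e" if "e \<in> F" for e
  proof -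
    have "L2_inner M e p = (\<Sum>e'\<in>F. if e = e' then cnj (c e') else 0)"
      unfolding pe[OF e[OF that]] using assms(2) that by (intro sum.cong) (auto simp: orthonormal_def)
    also have "\<dots> = cnj (c e)" using assms(1) that by simp
    finally show ?thesis by (subst L2_inner_commute) simp
  qed
  then have pp: "L2_inner M p p = of_real (\<Sum>e\<in>F. (norm (c e))^2)"
    unfolding pe[OF p] by (simp add: complex_norm_square mult.commute del: of_real_power)
  have d: "sq M (\<lambda>x. h x - p x)" by (rule sq_diff[OF assms(3) p])
  have "L2_inner M (\<lambda>x. h x - p x) (\<lambda>x. h x - p x) = L2_inner M h h - L2_inner M h p - (L2_inner M p h - L2_inner M p p)"
    using L2_inner_integrable[OF assms(3,3)] L2_inner_integrable[OF assms(3) p] L2_inner_integrable[OF p assms(3)] L2_inner_integrable[OF p p]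
    by (simp add: L2_inner_def algebra_simps)
  also have "\<dots> = L2_inner M h h - of_real (\<Sum>e\<in>F. (norm (c e))^2)"
    using hp pp L2_inner_commute[of M p h] by simp
  finally have "complex_of_real ((nrm M (\<lambda>x. h x - p x))^2) = of_real ((nrm M h)^2 - (\<Sum>e\<in>F. (norm (c e))^2))"
    unfolding L2_inner_self by simp
  then have "0 \<le> (nrm M h)^2 - (\<Sum>e\<in>F. (norm (c e))^2)"
    unfolding of_real_eq_iff by (metis zero_le_power2)
  then show ?thesis by (simp add: c_def)
qed

text \<open>An operator with kernel $h^{T} h$ is its own absolute value, and its trace in any orthonormal
  basis is at most the squared Hilbert--Schmidt norm of $h$ by Bessel's inequality.\<close>

lemma L2_inner_Gram:
  assumes h: "kern N b M a h" and wN: "weight N b" and wM: "weight M a" and f: "sq M (f :: _ \<Rightarrow> complex)"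
  shows "L2_inner M (kint M (kcomp N (\<lambda>x s. h s x) h) f) f = of_real ((nrm N (kint M h f))^2)"
proof -
  have hT: "kern M a N b (\<lambda>x s. h s x)" by (rule kern_transpose[OF h])
  have s: "sq N (kint M h f)" by (rule kint_sq[OF h wN wM f])
  have [measurable]: "f \<in> borel_measurable M" "(\<lambda>x. cnj (f x)) \<in> borel_measurable M" "kint M h f \<in> borel_measurable N"
    using f s by (auto simp: sq_def intro!: borel_measurable_cnj)
  have "L2_inner M (kint M (kcomp N (\<lambda>x s. h s x) h) f) f
      = (LINT x|M. LINT s|N. (h s x *\<^sub>R kint M h f s) * cnj (f x))"
    unfolding L2_inner_def
  proof (intro Bochner_Integration.integral_cong refl)
    fix x assume x: "x \<in> space M"
    have "kint M (kcomp N (\<lambda>x s. h s x) h) f x = kint N (\<lambda>x s. h s x) (kint M h f) x"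
      by (rule kint_kint[OF hT h wN wM x f, symmetric])
    then show "kint M (kcomp N (\<lambda>x s. h s x) h) f x * cnj (f x) = (LINT s|N. (h s x *\<^sub>R kint M h f s) * cnj (f x))"
      unfolding kint_def[of N] by (simp del: mult_scaleR_left)
  qed
  also have "\<dots> = (LINT s|N. LINT x|M. (h s x *\<^sub>R kint M h f s) * cnj (f x))"
  proof (rule kern_Fubini[OF hT wM wN f s])
    show "(\<lambda>(x, s). (h s x *\<^sub>R kint M h f s) * cnj (f x)) \<in> borel_measurable (M \<Otimes>\<^sub>M N)"
      using kern_measurable[OF hT] by (simp add: case_prod_unfold)
  qed (simp add: norm_mult)
  also have "\<dots> = (LINT s|N. LINT x|M. kint M h f s * cnj (h s x *\<^sub>R f x))"
    by (simp add: mult_ac)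
  also have "\<dots> = L2_inner N (kint M h f) (kint M h f)"
    unfolding L2_inner_def by (simp only: integral_mult_right_zero Bochner_Integration.integral_cnj kint_def[of M h f])
  finally show ?thesis by (simp add: L2_inner_self)
qed

text \<open>The hypothesis \<open>eq\<close> relates operators and not kernels, because
  \<open>k\<close> will be the negated Bessel kernel, which has the value 0 on the diagonal.\<close>

lemma trace_class_Gram:
  assumes h: "kern N b M a h" and wN: "weight N b" and wM: "weight M a" and g: "0 \<le> g"
    and k: "kern M a M a k" and sym: "\<And>x y. k x y = k y x"
    and eq: "\<And>f x. sq M (f :: _ \<Rightarrow> complex) \<Longrightarrow> x \<in> space M \<Longrightarrow> kint M k f x = g *\<^sub>R kint M (kcomp N (\<lambda>x s. h s x) h) f x"
  shows "positive_op M (kint M k)" "trace_class_op M (kint M k)"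
proof -
  have in_k: "L2_inner M (kint M k f) f = of_real (g * (nrm N (kint M h f))^2)" if f: "sq M f" for f
  proof -
    have "L2_inner M (kint M k f) f = (LINT x|M. g *\<^sub>R (kint M (kcomp N (\<lambda>x s. h s x) h) f x * cnj (f x)))"
      unfolding L2_inner_def using eq[OF f] by (intro Bochner_Integration.integral_cong) auto
    also have "\<dots> = g *\<^sub>R L2_inner M (kint M (kcomp N (\<lambda>x s. h s x) h) f) f"
      unfolding L2_inner_def by (simp only: integral_scaleR_right)
    finally show ?thesis by (simp add: L2_inner_Gram[OF h wN wM f] scaleR_conv_of_real)
  qed
  show pos: "positive_op M (kint M k)"
    unfolding positive_op_def using bounded_op_kint[OF k wM] in_k g by (auto simp: L2_iff_sq)
  have kT: "(\<lambda>x y. k y x) = k" using sym by (intro ext) blast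
  have abs: "is_abs_op M (kint M k) (kint M k)"
    unfolding is_abs_op_def using pos is_adjoint_kint[OF k wM] unfolding kT
    by (auto simp: op_eq_def intro!: exI[of _ "kint M k"])
  obtain E where E: "is_onb M E" using exists_onb by blast
  then have oE: "orthonormal M E" by (auto simp: is_onb_def orthonormal_def)
  have bN: "\<And>x. 0 \<le> b x" "sq N b" using wN by (auto simp: weight_def)
  obtain C where C: "0 \<le> C" "\<And>s. s \<in> space N \<Longrightarrow> nrm M (h s) \<le> C * b s"
    using kern_row_nrm[OF h wM bN(1)] by blast
  have "(\<Sum>e\<in>F. (nrm N (kint M h e))^2) \<le> C^2 * (nrm N b)^2" if F: "finite F" "F \<subseteq> E" for F
  proof -
    have oF: "orthonormal M F" using oE F(2) unfolding orthonormal_def by blast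
    have e: "sq M e" if "e \<in> F" for e
      using oF that by (auto simp: orthonormal_def L2_iff_sq)
    have "(\<Sum>e\<in>F. (nrm N (kint M h e))^2) = (LINT s|N. (\<Sum>e\<in>F. (norm (kint M h e s))^2))"
      unfolding nrm_sq using sq_integrable[OF kint_sq[OF h wN wM e]]
      by (intro Bochner_Integration.integral_sum[symmetric]) auto
    also have "\<dots> \<le> (LINT s|N. C^2 * (norm (b s))^2)"
    proof (rule integral_mono)
      show "integrable N (\<lambda>s. \<Sum>e\<in>F. (norm (kint M h e s))^2)"
        using sq_integrable[OF kint_sq[OF h wN wM e]] by (intro Bochner_Integration.integrable_sum) auto
      show "integrable N (\<lambda>s. C^2 * (norm (b s))^2)" using bN by (auto simp: sq_def)
      fix s assume s: "s \<in> space N"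
      have hs: "sq M (h s)" by (rule kern_sq1[OF h wM s])
      have hs': "sq M (\<lambda>x. complex_of_real (h s x))"
        using hs by (auto simp: sq_def)
      \<comment> \<open>The value at s of the transform of e is, up to conjugation, the Fourier
        coefficient of the row \<open>h s\<close> along e. This is where Bessel's inequality comes
        in.\<close>
      have n: "norm (L2_inner M (\<lambda>x. complex_of_real (h s x)) e) = norm (kint M h e s)" for e
      proof -
        have "L2_inner M (\<lambda>x. complex_of_real (h s x)) e = cnj (kint M h e s)"
          unfolding L2_inner_def kint_def by (simp flip: Bochner_Integration.integral_cnj add: scaleR_conv_of_real)
        then show ?thesis by simp
      qed
      have "(\<Sum>e\<in>F. (norm (kint M h e s))^2) \<le> (nrm M (\<lambda>x. complex_of_real (h s x)))^2"
        using Bessel_inequality[OF F(1) oF hs'] unfolding n .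
      also have "\<dots> = (nrm M (h s))^2" by (simp add: nrm_def)
      also have "\<dots> \<le> (C * b s)^2" by (intro power_mono C s nrm_nonneg)
      finally show "(\<Sum>e\<in>F. (norm (kint M h e s))^2) \<le> C^2 * (norm (b s))^2"
        by (simp add: power_mult_distrib)
    qed
    finally show ?thesis by (simp add: nrm_sq)
  qed
  then have "(\<lambda>e. (nrm N (kint M h e))^2) summable_on E"
    by (intro nonneg_bdd_above_summable_on bdd_aboveI2[where M = "C^2 * (nrm N b)^2"]) auto
  then have "(\<lambda>e. g * (nrm N (kint M h e))^2) summable_on E"
    by (rule summable_on_cmult_right)
  then have "(\<lambda>e. complex_of_real (g * (nrm N (kint M h e))^2)) summable_on E"
    by (rule summable_on_of_real)
  then have "(\<lambda>e. L2_inner M (kint M k e) e) summable_on E"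
    by (rule summable_on_cong[THEN iffD1, rotated]) (use oE in_k in \<open>auto simp: orthonormal_def L2_iff_sq\<close>)
  then show "trace_class_op M (kint M k)"
    unfolding trace_class_op_def using bounded_op_kint[OF k wM] abs E by blast
qed

section \<open>The Bessel series\<close>

text \<open>Coefficients of the entire function phi with J_alpha(sqrt x) = x^(alpha/2) phi(x) for x
  > 0; the powers 4^m and 2^(-alpha) come from (z/2)^(2 m + alpha) at z = sqrt x.\<close>

definition bcoef :: "real \<Rightarrow> nat \<Rightarrow> real" where
  "bcoef \<alpha> m = (-1) ^ m / (fact m * 4 ^ m) * rGamma (real m + \<alpha> + 1) * 2 powr (-\<alpha>)"

definition bphi :: "real \<Rightarrow> real \<Rightarrow> real" where
  "bphi \<alpha> x = (\<Sum>m. bcoef \<alpha> m * x ^ m)"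

lemma rGamma_pos: "0 < x \<Longrightarrow> 0 < rGamma (x::real)"
  by (simp add: rGamma_inverse_Gamma)

lemma rGamma_shift_pos: "\<alpha> > -1 \<Longrightarrow> 0 < rGamma (real m + \<alpha> + 1)"
  by (intro rGamma_pos) linarith

lemma rGamma_Suc:
  assumes "\<alpha> > -1"
  shows "rGamma (real (Suc m) + \<alpha> + 1) = rGamma (real m + \<alpha> + 1) / (real m + \<alpha> + 1)"
  using rGamma_plus1[of "real m + \<alpha> + 1"] assms by (simp add: field_simps)

lemma summable_rGamma_power:
  assumes "\<alpha> > -1"
  shows "summable (\<lambda>m. rGamma (real m + \<alpha> + 1) * y ^ m)"
proof (rule summable_ratio_test[of "1/2" "nat \<lceil>2 * \<bar>y\<bar> + 1\<rceil>"])
  fix n assume "nat \<lceil>2 * \<bar>y\<bar> + 1\<rceil> \<le> n"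
  then have n: "2 * \<bar>y\<bar> + 1 \<le> real n" by linarith
  then have d: "2 * \<bar>y\<bar> \<le> real n + \<alpha> + 1" "0 < real n + \<alpha> + 1" using assms by linarith+
  have "norm (rGamma (real (Suc n) + \<alpha> + 1) * y ^ Suc n)
      = (\<bar>y\<bar> / (real n + \<alpha> + 1)) * norm (rGamma (real n + \<alpha> + 1) * y ^ n)"
    unfolding rGamma_Suc[OF assms] using d by (simp add: abs_mult)
  also have "\<dots> \<le> 1/2 * norm (rGamma (real n + \<alpha> + 1) * y ^ n)"
    using d by (intro mult_right_mono) (auto simp: divide_simps)
  finally show "norm (rGamma (real (Suc n) + \<alpha> + 1) * y ^ Suc n) \<le> 1/2 * norm (rGamma (real n + \<alpha> + 1) * y ^ n)" .
qed simp

lemma abs_bcoef: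
  assumes "\<alpha> > -1"
  shows "\<bar>bcoef \<alpha> m\<bar> = rGamma (real m + \<alpha> + 1) * 2 powr (-\<alpha>) / (fact m * 4 ^ m)"
  using rGamma_shift_pos[OF assms, of m] by (simp add: bcoef_def abs_mult)

text \<open>Besides 1/m! the coefficient contains 1/Gamma(m + alpha + 1), which decays faster than
  any geometric sequence. Hence the rate \<open>d\<close> can be arbitrarily small, so small that a
  given exponential damping in s still dominates phi(s x).\<close>

lemma bcoef_exp_bound:
  assumes "\<alpha> > -1" "0 < d"
  obtains C where "0 \<le> C" "\<And>m. \<bar>bcoef \<alpha> m\<bar> \<le> C * d ^ m / fact m"
proof -
  \<comment> \<open>With the base 1 / (4 d), boundedness of these terms bounds 1/Gamma by a multiple
    of (4 d)^m, and 4^m cancels against the coefficient.\<close>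
  have "summable (\<lambda>m. rGamma (real m + \<alpha> + 1) * (1 / (4 * d)) ^ m)"
    by (rule summable_rGamma_power[OF assms(1)])
  then have "Bseq (\<lambda>m. rGamma (real m + \<alpha> + 1) * (1 / (4 * d)) ^ m)"
    by (intro convergent_imp_Bseq) (auto simp: convergent_def dest: summable_LIMSEQ_zero)
  then obtain K where K: "0 < K" "\<And>m. norm (rGamma (real m + \<alpha> + 1) * (1 / (4 * d)) ^ m) \<le> K"
    by (auto simp: Bseq_def)
  have "\<bar>bcoef \<alpha> m\<bar> \<le> (K * 2 powr (-\<alpha>)) * d ^ m / fact m" for m
  proof -
    have "rGamma (real m + \<alpha> + 1) \<le> K * (4 * d) ^ m"
      using K(2)[of m] rGamma_shift_pos[OF assms(1), of m] assms(2)
      by (simp add: power_divide field_simps abs_mult)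
    then have "rGamma (real m + \<alpha> + 1) * 2 powr (-\<alpha>) / (fact m * 4 ^ m) \<le> (K * (4 * d) ^ m) * 2 powr (-\<alpha>) / (fact m * 4 ^ m)"
      by (intro divide_right_mono mult_right_mono) auto
    then show ?thesis
      unfolding abs_bcoef[OF assms(1)] by (simp add: power_mult_distrib field_simps)
  qed
  then show ?thesis using that[of "K * 2 powr (-\<alpha>)"] K(1) by simp
qed

lemma summable_bcoef_abs:
  assumes "\<alpha> > -1"
  shows "summable (\<lambda>m. \<bar>bcoef \<alpha> m\<bar> * norm (y :: 'a::{real_normed_field,banach}) ^ m)"
proof -
  obtain C where C: "0 \<le> C" "\<And>m. \<bar>bcoef \<alpha> m\<bar> \<le> C * 1 ^ m / fact m"
    using bcoef_exp_bound[OF assms, of 1] by auto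
  have "summable (\<lambda>m. C * (norm y ^ m / fact m))"
    using summable_exp_generic[of "norm y"] by (intro summable_mult) (simp add: field_simps)
  then show ?thesis
  proof (rule summable_comparison_test')
    fix m
    have "\<bar>bcoef \<alpha> m\<bar> * norm y ^ m \<le> (C * 1 ^ m / fact m) * norm y ^ m"
      by (intro mult_right_mono C) auto
    then show "norm (\<bar>bcoef \<alpha> m\<bar> * norm y ^ m) \<le> C * (norm y ^ m / fact m)" by simp
  qed
qed

lemma summable_bcoef_norm: "\<alpha> > -1 \<Longrightarrow> summable (\<lambda>m. norm (bcoef \<alpha> m * y ^ m))"
  using summable_bcoef_abs[of \<alpha> y] by (simp add: abs_mult power_abs)

lemma summable_bcoef: "\<alpha> > -1 \<Longrightarrow> summable (\<lambda>m. bcoef \<alpha> m * y ^ m)"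
  by (rule summable_norm_cancel[OF summable_bcoef_norm])

lemma bphi_exp_bound:
  assumes "\<alpha> > -1" "0 < d"
  obtains C where "0 \<le> C" "\<And>y. 0 \<le> y \<Longrightarrow> \<bar>bphi \<alpha> y\<bar> \<le> C * exp (d * y)"
proof -
  obtain C where C: "0 \<le> C" "\<And>m. \<bar>bcoef \<alpha> m\<bar> \<le> C * d ^ m / fact m"
    using bcoef_exp_bound[OF assms] by blast
  have "\<bar>bphi \<alpha> y\<bar> \<le> C * exp (d * y)" if y: "0 \<le> y" for y
  proof -
    have s: "(\<lambda>m. C * ((d * y) ^ m /\<^sub>R fact m)) sums (C * exp (d * y))"
      by (intro sums_mult exp_converges)
    have "norm (\<Sum>m. bcoef \<alpha> m * y ^ m) \<le> (\<Sum>m. C * ((d * y) ^ m /\<^sub>R fact m))"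
    proof (rule norm_suminf_le[OF _ sums_summable[OF s]])
      fix m
      have "norm (bcoef \<alpha> m * y ^ m) \<le> (C * d ^ m / fact m) * y ^ m"
        using y mult_right_mono[OF C(2)[of m], of "y ^ m"] by (simp add: abs_mult)

      then show "norm (bcoef \<alpha> m * y ^ m) \<le> C * ((d * y) ^ m /\<^sub>R fact m)"
        by (simp add: power_mult_distrib field_simps)
    qed
    then show ?thesis using sums_unique[OF s] by (simp add: bphi_def)
  qed
  then show ?thesis using that C(1) by blast
qed

lemma bcoef_recurrence:
  assumes "\<alpha> > -1"
  shows "real (Suc m) * (real m + \<alpha> + 1) * bcoef \<alpha> (Suc m) = - bcoef \<alpha> m / 4"
proof -
  obtain p where p: "real m + \<alpha> + 1 = p" by simp
  then have "p \<noteq> 0" using assms by linarith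
  then show ?thesis
    unfolding bcoef_def rGamma_Suc[OF assms] p fact_Suc power_Suc
    by (simp del: of_nat_Suc)

qed

section \<open>Derivatives of the Bessel series\<close>

definition bphi' :: "real \<Rightarrow> real \<Rightarrow> real" where
  "bphi' \<alpha> x = (\<Sum>m. diffs (bcoef \<alpha>) m * x ^ m)"

lemma bphi_deriv:
  assumes "\<alpha> > -1"
  shows "(bphi \<alpha> has_real_derivative bphi' \<alpha> x) (at x)"
  unfolding bphi_def[abs_def] bphi'_def
  by (rule termdiffs_strong_converges_everywhere[OF summable_bcoef[OF assms]])

lemma continuous_on_bphi: "\<alpha> > -1 \<Longrightarrow> continuous_on S (bphi \<alpha>)"
  by (meson DERIV_isCont bphi_deriv continuous_at_imp_continuous_on)

lemma borel_bphi: "\<alpha> > -1 \<Longrightarrow> bphi \<alpha> \<in> borel_measurable borel"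
  by (intro borel_measurable_continuous_onI continuous_on_bphi)

lemma borel_bphi_scale: "\<alpha> > -1 \<Longrightarrow> (\<lambda>s. bphi \<alpha> (s * x)) \<in> borel_measurable borel"
  by (rule measurable_compose[OF _ borel_bphi]) measurable

text \<open>Bessel's equation $x \varphi'' + (\alpha + 1) \varphi' + \varphi / 4 = 0$.\<close>

lemma bphi'_deriv:
  assumes \<alpha>: "\<alpha> > -1" and x: "x \<noteq> 0"
  shows "(bphi' \<alpha> has_real_derivative (- ((\<alpha> + 1) * bphi' \<alpha> x + bphi \<alpha> x / 4) / x)) (at x)"
proof -
  have s1: "summable (\<lambda>m. diffs (bcoef \<alpha>) m * y ^ m)" for y :: real
    by (rule termdiff_converges_all[OF summable_bcoef[OF \<alpha>]])
  have s2: "summable (\<lambda>m. diffs (diffs (bcoef \<alpha>)) m * y ^ m)" for y :: real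
    by (rule termdiff_converges_all[OF s1])
  define D where "D = (\<Sum>m. diffs (diffs (bcoef \<alpha>)) m * x ^ m)"
  have der: "(bphi' \<alpha> has_real_derivative D) (at x)"
    unfolding bphi'_def[abs_def] D_def by (rule termdiffs_strong_converges_everywhere[OF s1])
  \<comment> \<open>Multiplying the second derivative by x aligns its powers with those of phi'; the
    shifted series begins with a zero term.\<close>
  have shift: "(\<lambda>m. x * (diffs (diffs (bcoef \<alpha>)) m * x ^ m)) = (\<lambda>m. real (Suc m) * diffs (bcoef \<alpha>) (Suc m) * x ^ Suc m)"
    by (rule ext) (simp add: diffs_def mult_ac del: of_nat_Suc)
  have "(\<lambda>m. real (Suc m) * diffs (bcoef \<alpha>) (Suc m) * x ^ Suc m) sums (x * D)"
    unfolding D_def shift[symmetric] by (rule sums_mult[OF summable_sums[OF s2]])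
  then have "(\<lambda>m. real m * diffs (bcoef \<alpha>) m * x ^ m) sums (x * D)"
    by (rule sums_Suc_imp[rotated]) simp
  moreover have "(\<lambda>m. (\<alpha> + 1) * (diffs (bcoef \<alpha>) m * x ^ m)) sums ((\<alpha> + 1) * bphi' \<alpha> x)"
    unfolding bphi'_def by (rule sums_mult[OF summable_sums[OF s1]])
  moreover have "(\<lambda>m. bcoef \<alpha> m * x ^ m / 4) sums (bphi \<alpha> x / 4)"
    unfolding bphi_def by (rule sums_divide[OF summable_sums[OF summable_bcoef[OF \<alpha>]]])
  ultimately have S: "(\<lambda>m. real m * diffs (bcoef \<alpha>) m * x ^ m + (\<alpha> + 1) * (diffs (bcoef \<alpha>) m * x ^ m) + bcoef \<alpha> m * x ^ m / 4)
      sums (x * D + (\<alpha> + 1) * bphi' \<alpha> x + bphi \<alpha> x / 4)"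
    using sums_add[OF sums_add] by blast

  have "(\<lambda>m. real m * diffs (bcoef \<alpha>) m * x ^ m + (\<alpha> + 1) * (diffs (bcoef \<alpha>) m * x ^ m) + bcoef \<alpha> m * x ^ m / 4) = (\<lambda>_. 0)"
  proof
    fix m
    have "real m * diffs (bcoef \<alpha>) m * x ^ m + (\<alpha> + 1) * (diffs (bcoef \<alpha>) m * x ^ m) + bcoef \<alpha> m * x ^ m / 4
        = (real (Suc m) * (real m + \<alpha> + 1) * bcoef \<alpha> (Suc m) + bcoef \<alpha> m / 4) * x ^ m"
      by (simp add: diffs_def algebra_simps)
    then show "real m * diffs (bcoef \<alpha>) m * x ^ m + (\<alpha> + 1) * (diffs (bcoef \<alpha>) m * x ^ m) + bcoef \<alpha> m * x ^ m / 4 = 0"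
      using bcoef_recurrence[OF \<alpha>, of m] by simp
  qed
  from S[unfolded this] have "x * D + (\<alpha> + 1) * bphi' \<alpha> x + bphi \<alpha> x / 4 = 0"
    by (rule sums_unique2[OF _ sums_zero])
  then have "x * D = - ((\<alpha> + 1) * bphi' \<alpha> x + bphi \<alpha> x / 4)" by linarith
  then have "D = - ((\<alpha> + 1) * bphi' \<alpha> x + bphi \<alpha> x / 4) / x"
    by (metis x nonzero_mult_div_cancel_left)
  then show ?thesis using der by simp
qed

section \<open>The functions A and B expressed by the series\<close>

lemma bessel_J_sqrt:
  assumes "\<alpha> > -1" "0 < x"
  shows "bessel_J \<alpha> (sqrt x) = pw \<alpha> x * bphi \<alpha> x"
proof -
  have "(-1) ^ m / fact m * rGamma (real m + \<alpha> + 1) * (sqrt x / 2) powr (2 * real m + \<alpha>)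
      = pw \<alpha> x * (bcoef \<alpha> m * x ^ m)" for m
  proof -
    have "(sqrt x / 2) powr (2 * real m + \<alpha>) = (sqrt x) powr (2 * real m + \<alpha>) / 2 powr (2 * real m + \<alpha>)"
      using assms by (simp add: powr_divide)
    also have "(sqrt x) powr (2 * real m + \<alpha>) = x powr (real m + \<alpha> / 2)"
      using assms by (simp add: powr_half_sqrt[symmetric] powr_powr algebra_simps)
    also have "\<dots> = x ^ m * pw \<alpha> x"
      using assms by (simp add: powr_add powr_realpow)
    also have "2 powr (2 * real m + \<alpha>) = 4 ^ m * 2 powr \<alpha>"
      by (simp add: powr_add powr_realpow[symmetric] powr_powr[of 2 2, symmetric])
    finally show ?thesis
      by (simp add: bcoef_def powr_minus field_simps)
  qed
  then have "bessel_J \<alpha> (sqrt x) = (\<Sum>m. pw \<alpha> x * (bcoef \<alpha> m * x ^ m))"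
    by (simp add: bessel_J_def)
  also have "\<dots> = pw \<alpha> x * bphi \<alpha> x"
    unfolding bphi_def by (rule suminf_mult[OF summable_bcoef[OF assms(1)]])
  finally show ?thesis .
qed

lemma bessel_A_eq:
  assumes "\<alpha> > -1" "0 < x"
  shows "bessel_A \<alpha> \<gamma> x = sqrt (\<gamma> * pi) * (pw \<alpha> x * bphi \<alpha> x)"
  by (simp add: bessel_A_def bessel_J_sqrt[OF assms])

lemma bessel_B_eq:
  assumes "\<alpha> > -1" "0 < x"
  shows "bessel_B \<alpha> \<gamma> x = sqrt (\<gamma> * pi) * (pw \<alpha> x * (\<alpha> / 2 * bphi \<alpha> x + x * bphi' \<alpha> x))"
proof -
  have "((\<lambda>x. sqrt (\<gamma> * pi) * (pw \<alpha> x * bphi \<alpha> x)) has_real_derivative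
      sqrt (\<gamma> * pi) * (pw \<alpha> x * bphi' \<alpha> x + \<alpha> / 2 * x powr (\<alpha> / 2 - 1) * bphi \<alpha> x)) (at x)"
    using assms by (auto intro!: derivative_eq_intros bphi_deriv[OF assms(1)])
  then have "(bessel_A \<alpha> \<gamma> has_real_derivative
      sqrt (\<gamma> * pi) * (pw \<alpha> x * bphi' \<alpha> x + \<alpha> / 2 * x powr (\<alpha> / 2 - 1) * bphi \<alpha> x)) (at x)"
    by (rule has_field_derivative_transform_within_open[of _ _ _ "{0<..}"])
      (use assms bessel_A_eq in auto)
  then have "bessel_B \<alpha> \<gamma> x = x * (sqrt (\<gamma> * pi) * (pw \<alpha> x * bphi' \<alpha> x + \<alpha> / 2 * x powr (\<alpha> / 2 - 1) * bphi \<alpha> x))"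
    unfolding bessel_B_def by (simp add: DERIV_imp_deriv)
  moreover have "x * x powr (\<alpha> / 2 - 1) = pw \<alpha> x"
    using assms powr_mult_base[of x "\<alpha> / 2 - 1"] by simp
  ultimately show ?thesis by (simp add: algebra_simps)
qed

text \<open>The functions $s^{\alpha+1} x \varphi'(sx)$ have derivative $-\frac14 s^\alpha x \varphi(sx)$
  by Bessel's equation, so that the bracket below is the integral of its derivative in $s$.\<close>

lemma bphi_Wronskian:
  assumes \<alpha>: "\<alpha> > -1" and x: "0 < x" and t: "0 < t"
  shows "bphi \<alpha> x * (t * bphi' \<alpha> t) - bphi \<alpha> t * (x * bphi' \<alpha> x)
    = (x - t) / 4 * (LINT s|interval_lborel 1. s powr \<alpha> * (bphi \<alpha> (s * x) * bphi \<alpha> (s * t)))"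
proof -
  define D where "D s = s powr (\<alpha> + 1) * (bphi \<alpha> (s * x) * (t * bphi' \<alpha> (s * t)) - bphi \<alpha> (s * t) * (x * bphi' \<alpha> (s * x)))" for s
  define f where "f s = (x - t) / 4 * (s powr \<alpha> * (bphi \<alpha> (s * x) * bphi \<alpha> (s * t)))" for s
  have d0: "(bphi \<alpha> has_real_derivative bphi' \<alpha> y) (at y within S)" for y S
    by (rule DERIV_subset[OF bphi_deriv[OF \<alpha>]]) simp
  have cont': "continuous_on S (bphi' \<alpha>)" for S
  proof -
    have "summable (\<lambda>m. diffs (bcoef \<alpha>) m * y ^ m)" for y :: real
      by (rule termdiff_converges_all[OF summable_bcoef[OF \<alpha>]])
    from termdiffs_strong_converges_everywhere[OF this] show ?thesis
      unfolding bphi'_def[abs_def] by (meson DERIV_isCont continuous_at_imp_continuous_on)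
  qed
  \<comment> \<open>Continuity at 0 rests on alpha + 1 > 0; as \<open>D 0 = 0\<close>, the integral
    has no boundary term there.\<close>
  have contD: "continuous_on {0..1} D"
    unfolding D_def using \<alpha>
    by (intro continuous_intros continuous_on_powr_real
        continuous_on_compose2[OF continuous_on_bphi[OF \<alpha>, of UNIV]] continuous_on_compose2[OF cont'[of UNIV]]) auto
  have der: "(D has_real_derivative f s) (at s)" if s: "s \<in> {0<..<1}" for s
  proof -
    have sx: "s * x \<noteq> 0" "s * t \<noteq> 0" using s x t by auto
    have 1: "((\<lambda>s. bphi \<alpha> (s * y)) has_real_derivative bphi' \<alpha> (s * y) * y) (at s)" for y
      by (rule DERIV_chain2[OF bphi_deriv[OF \<alpha>]]) (auto intro!: derivative_eq_intros)
    have 2: "((\<lambda>s. bphi' \<alpha> (s * y)) has_real_derivative (- ((\<alpha> + 1) * bphi' \<alpha> (s * y) + bphi \<alpha> (s * y) / 4) / s)) (at s)"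
      if "s * y \<noteq> 0" for y
    proof -
      have "((\<lambda>s. bphi' \<alpha> (s * y)) has_real_derivative (- ((\<alpha> + 1) * bphi' \<alpha> (s * y) + bphi \<alpha> (s * y) / 4) / (s * y)) * y) (at s)"
        by (rule DERIV_chain2[where f = "bphi' \<alpha>" and g = "\<lambda>s. s * y", OF bphi'_deriv[OF \<alpha> that]])
          (auto intro!: derivative_eq_intros)
      then show ?thesis using that by simp
    qed
    have p: "s powr (\<alpha> + 1) = s * s powr \<alpha>" using s by (simp add: powr_add)
    have 0: "((\<lambda>s. s powr (\<alpha> + 1)) has_real_derivative (\<alpha> + 1) * s powr \<alpha>) (at s)"
      using s by (auto intro!: derivative_eq_intros)
    note der = DERIV_mult[OF 0 DERIV_diff[OF DERIV_mult[OF 1[of x] DERIV_cmult[OF 2[OF sx(2)], of t]]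
        DERIV_mult[OF 1[of t] DERIV_cmult[OF 2[OF sx(1)], of x]]]]
    \<comment> \<open>With both second derivatives eliminated, the products of first derivatives
      cancel, the terms with alpha + 1 cancel against the derivative of the power, and the two
      quarters leave (x - t) / 4.\<close>
    have cancel: "(\<alpha> + 1) * q * (a * (t * b') - b * (x * a')) +
        (a' * x * (t * b') + t * (- ((\<alpha> + 1) * b' + b / 4) / s) * a
          - (b' * t * (x * a') + x * (- ((\<alpha> + 1) * a' + a / 4) / s) * b)) * (s * q)
        = (x - t) / 4 * (q * (a * b))" for q a b a' b'
      using s by (simp add: field_simps)
    show ?thesis
      by (rule DERIV_cong[OF der[folded D_def]])
        (simp only: p f_def cancel)
  qed
  have "(f has_integral (D 1 - D 0)) {0..1}"
    by (rule fundamental_theorem_of_calculus_interior[OF _ contD])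
      (use der in \<open>auto simp: has_real_derivative_iff_has_vector_derivative[symmetric]\<close>)
  then have I: "(f has_integral (D 1 - D 0)) {0<..<1}"
    using has_integral_Icc_iff_Ioo by blast
  obtain C where C: "\<And>s. s \<in> {0..1} \<Longrightarrow> norm (bphi \<alpha> (s * x) * bphi \<alpha> (s * t)) \<le> C"
  proof -
    have "continuous_on {0..1} (\<lambda>s. bphi \<alpha> (s * x) * bphi \<alpha> (s * t))"
      by (intro continuous_intros continuous_on_compose2[OF continuous_on_bphi[OF \<alpha>, of UNIV]]) auto
    then have "compact ((\<lambda>s. bphi \<alpha> (s * x) * bphi \<alpha> (s * t)) ` {0..1})"
      by (rule compact_continuous_image) simp
    then show ?thesis using that compact_imp_bounded by (fastforce simp: bounded_iff)
  qed
  have int: "integrable (interval_lborel 1) (\<lambda>s. s powr \<alpha> * (bphi \<alpha> (s * x) * bphi \<alpha> (s * t)))"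
  proof (rule Bochner_Integration.integrable_bound)
    show "integrable (interval_lborel 1) (\<lambda>s. C * s powr \<alpha>)"
      using powr_antiderivative(1)[OF \<alpha>, of 1] by (simp add: integrable_interval)
    show "(\<lambda>s. s powr \<alpha> * (bphi \<alpha> (s * x) * bphi \<alpha> (s * t))) \<in> borel_measurable (interval_lborel 1)"
      using borel_bphi_scale[OF \<alpha>] by (intro borel_interval borel_measurable_times) auto
    show "AE s in interval_lborel 1. norm (s powr \<alpha> * (bphi \<alpha> (s * x) * bphi \<alpha> (s * t))) \<le> norm (C * s powr \<alpha>)"
    proof (rule AE_I2)
      fix s assume "s \<in> space (interval_lborel 1)"
      then have "norm (bphi \<alpha> (s * x) * bphi \<alpha> (s * t)) \<le> C" by (intro C) auto
      from mult_left_mono[OF this, of "s powr \<alpha>"]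
      have "norm (s powr \<alpha> * (bphi \<alpha> (s * x) * bphi \<alpha> (s * t))) \<le> s powr \<alpha> * C"
        by (simp add: abs_mult)
      then show "norm (s powr \<alpha> * (bphi \<alpha> (s * x) * bphi \<alpha> (s * t))) \<le> norm (C * s powr \<alpha>)"
        unfolding mult.commute[of C] by (rule order_trans) simp
    qed
  qed
  then have "integrable (interval_lborel 1) f"
    unfolding f_def by simp
  then have "set_integrable lborel {0<..<1} f" by (simp add: integrable_interval)
  from set_borel_integral_eq_integral(2)[OF this]
  have "(LINT s|interval_lborel 1. f s) = D 1 - D 0"
    using I by (simp add: integral_interval integral_unique)
  moreover have "D 0 = 0" using \<alpha> by (simp add: D_def)
  ultimately show ?thesis by (simp add: D_def f_def)
qed

section \<open>The Hankel kernel\<close>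

definition hankel :: "real \<Rightarrow> real \<Rightarrow> real \<Rightarrow> real" where
  "hankel \<alpha> s x = pw \<alpha> s * pw \<alpha> x * bphi \<alpha> (s * x) / 2"

text \<open>The kernel of the adjoint of T composed with T, with s running over (0,1). It does not
  involve zeta, which enters only through the range of x and t.\<close>

definition hankel_sq :: "real \<Rightarrow> real \<Rightarrow> real \<Rightarrow> real" where
  "hankel_sq \<alpha> = kcomp (interval_lborel 1) (\<lambda>x s. hankel \<alpha> s x) (hankel \<alpha>)"

text \<open>The terms with alpha / 2 in \<open>bessel_B\<close> cancel in the antisymmetric bracket
  and leave the Wronskian expression, whose factor x - t cancels the denominator. The square of
  sqrt(gamma pi) cancels pi and leaves gamma.\<close>

lemma bessel_kernel_eq:
  assumes "\<alpha> > -1" "0 < x" "0 < t" "0 < \<gamma>"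
  shows "bessel_kernel \<alpha> \<gamma> x t = (if x = t then 0 else - (\<gamma> * hankel_sq \<alpha> x t))"
proof (cases "x = t")
  case True
  then show ?thesis by (simp add: bessel_kernel_def)
next
  case False
  let ?W = "bphi \<alpha> x * (t * bphi' \<alpha> t) - bphi \<alpha> t * (x * bphi' \<alpha> x)"
  have expand: "c * (p * a) * (c * (p' * (\<alpha> / 2 * b + t * b'))) - c * (p' * b) * (c * (p * (\<alpha> / 2 * a + x * a')))
      = (c * c) * (p * p' * (a * (t * b') - b * (x * a')))" for c p a p' b b' a' :: real
    by (simp add: algebra_simps)
  have g: "sqrt (\<gamma> * pi) * sqrt (\<gamma> * pi) = \<gamma> * pi" using assms by simp
  have "bessel_A \<alpha> \<gamma> x * bessel_B \<alpha> \<gamma> t - bessel_A \<alpha> \<gamma> t * bessel_B \<alpha> \<gamma> x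
      = (sqrt (\<gamma> * pi) * sqrt (\<gamma> * pi)) * (pw \<alpha> x * pw \<alpha> t * ?W)"
    unfolding bessel_A_eq[OF assms(1,2)] bessel_A_eq[OF assms(1,3)] bessel_B_eq[OF assms(1,2)] bessel_B_eq[OF assms(1,3)]
    by (rule expand)
  also have "\<dots> = (\<gamma> * pi) * (pw \<alpha> x * pw \<alpha> t * ?W)" by (simp only: g)
  finally have "bessel_kernel \<alpha> \<gamma> x t = - ((\<gamma> * pi) * (pw \<alpha> x * pw \<alpha> t * ?W)) / (pi * (x - t))"
    by (simp add: bessel_kernel_def)
  also have "\<dots> = - (\<gamma> * (pw \<alpha> x * pw \<alpha> t * (?W / (x - t))))"
  proof -
    have "- ((\<gamma> * pi) * (p * W)) / (pi * (x - t)) = - (\<gamma> * (p * (W / (x - t))))" for p W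
      by simp
    then show ?thesis .
  qed
  finally have 1: "bessel_kernel \<alpha> \<gamma> x t = - (\<gamma> * (pw \<alpha> x * pw \<alpha> t * (?W / (x - t))))" .
  have 2: "?W / (x - t) = (LINT s|interval_lborel 1. s powr \<alpha> * (bphi \<alpha> (s * x) * bphi \<alpha> (s * t))) / 4"
  proof -
    have d0: "x - t \<noteq> 0" using False by simp
    have "(d / 4 * I) / d = I / 4" if "d \<noteq> 0" for d I :: real using that by simp

    from this[OF d0, of "LINT s|interval_lborel 1. s powr \<alpha> * (bphi \<alpha> (s * x) * bphi \<alpha> (s * t))"]
    show ?thesis unfolding bphi_Wronskian[OF assms(1-3)] .

  qed
  have "pw \<alpha> x * pw \<alpha> t * ((LINT s|interval_lborel 1. s powr \<alpha> * (bphi \<alpha> (s * x) * bphi \<alpha> (s * t))) / 4)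
      = (LINT s|interval_lborel 1. pw \<alpha> x * pw \<alpha> t / 4 * (s powr \<alpha> * (bphi \<alpha> (s * x) * bphi \<alpha> (s * t))))"
    by simp
  also have "\<dots> = hankel_sq \<alpha> x t"
    unfolding hankel_sq_def kcomp_def hankel_def
  proof (intro Bochner_Integration.integral_cong refl)
    fix s
    have e: "p / 4 * ((q * q) * (a * b)) = (q * x * a / 2) * (q * y * b / 2)" if "p = x * y" for p q a b x y :: real
      using that by (simp add: algebra_simps)
    have "s powr \<alpha> = pw \<alpha> s * pw \<alpha> s"
      using pw_square[of s \<alpha>] by (simp add: power2_eq_square)
    then show "pw \<alpha> x * pw \<alpha> t / 4 * (s powr \<alpha> * (bphi \<alpha> (s * x) * bphi \<alpha> (s * t))) =
        pw \<alpha> s * pw \<alpha> x * bphi \<alpha> (s * x) / 2 * (pw \<alpha> s * pw \<alpha> t * bphi \<alpha> (s * t) / 2)"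
      using e[OF refl] by metis
  qed

  finally have 3: "pw \<alpha> x * pw \<alpha> t * ((LINT s|interval_lborel 1. s powr \<alpha> * (bphi \<alpha> (s * x) * bphi \<alpha> (s * t))) / 4) = hankel_sq \<alpha> x t" .
  have "bessel_kernel \<alpha> \<gamma> x t = - (\<gamma> * hankel_sq \<alpha> x t)" unfolding 1 2 3 ..
  then show ?thesis using False by simp

qed

section \<open>Weber's second exponential integral\<close>

abbreviation halfline :: "real measure" where
  "halfline \<equiv> restrict_space lborel {0<..}"

lemma space_halfline [simp]: "space halfline = {0<..}"
  by (simp add: space_restrict_space)

lemma borel_halfline: "f \<in> borel_measurable borel \<Longrightarrow> f \<in> borel_measurable halfline"
  by (intro measurable_restrict_space1) simp

lemma nn_integral_Gamma_halfline:
  assumes "0 < p" "0 < e"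
  shows "(\<integral>\<^sup>+s. ennreal (s powr (p - 1) * exp (- (e * s))) \<partial>halfline) = ennreal (Gamma p / e powr p)"
proof -
  let ?I = "\<integral>\<^sup>+s. ennreal (s powr (p - 1) * exp (- (e * s))) \<partial>halfline"
  have "ennreal (Gamma p) = (\<integral>\<^sup>+t. ennreal (indicator {0..} t * t powr (p - 1) / exp t) \<partial>lborel)"
    by (rule Gamma_conv_nn_integral_real[OF assms(1)])
  also have "\<dots> = ennreal \<bar>e\<bar> * (\<integral>\<^sup>+t. ennreal (indicator {0..} (0 + e * t) * (0 + e * t) powr (p - 1) / exp (0 + e * t)) \<partial>lborel)"
    by (rule nn_integral_real_affine) (use assms in auto)
  also have "\<dots> = (\<integral>\<^sup>+t. ennreal \<bar>e\<bar> * ennreal (indicator {0..} (0 + e * t) * (0 + e * t) powr (p - 1) / exp (0 + e * t)) \<partial>lborel)"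
    by (rule nn_integral_cmult[symmetric]) auto
  also have "\<dots> = (\<integral>\<^sup>+t. ennreal (e powr p) * (ennreal (t powr (p - 1) * exp (- (e * t))) * indicator {0<..} t) \<partial>lborel)"
  proof (intro nn_integral_cong)
    fix t :: real
    show "ennreal \<bar>e\<bar> * ennreal (indicator {0..} (0 + e * t) * (0 + e * t) powr (p - 1) / exp (0 + e * t))
        = ennreal (e powr p) * (ennreal (t powr (p - 1) * exp (- (e * t))) * indicator {0<..} t)"
    proof (cases "0 < t")
      case True
      have "e * (e * t) powr (p - 1) = e powr p * t powr (p - 1)"
        using assms True powr_mult_base[of e "p - 1"] by (simp add: powr_mult)
      then show ?thesis
        using assms True by (simp add: ennreal_mult[symmetric] exp_minus divide_inverse mult.assoc[symmetric])
    next
      case False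
      then show ?thesis using assms by (cases "t = 0") (auto simp: indicator_def zero_le_mult_iff)
    qed
  qed
  also have "\<dots> = ennreal (e powr p) * (\<integral>\<^sup>+t. ennreal (t powr (p - 1) * exp (- (e * t))) * indicator {0<..} t \<partial>lborel)"
    by (rule nn_integral_cmult) auto
  also have "(\<integral>\<^sup>+t. ennreal (t powr (p - 1) * exp (- (e * t))) * indicator {0<..} t \<partial>lborel) = ?I"
    by (rule nn_integral_restrict_space[symmetric]) simp
  finally have 1: "ennreal (Gamma p) = ennreal (e powr p) * ?I" .
  have "ennreal (Gamma p / e powr p) = ennreal (1 / e powr p) * ennreal (Gamma p)"
    using assms by (subst ennreal_mult[symmetric]) auto
  also have "\<dots> = ennreal (1 / e powr p) * ennreal (e powr p) * ?I"
    unfolding 1 by (simp add: mult.assoc)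
  also have "ennreal (1 / e powr p) * ennreal (e powr p) = 1"
    using assms by (subst ennreal_mult[symmetric]) auto
  finally show ?thesis by simp
qed

lemma has_integral_Gamma_halfline:
  assumes "0 < p" "0 < e"
  shows "has_bochner_integral halfline (\<lambda>s. s powr (p - 1) * exp (- (e * s))) (Gamma p / e powr p)"
proof (rule has_bochner_integral_nn_integral)
  show "(\<lambda>s. s powr (p - 1) * exp (- (e * s))) \<in> borel_measurable halfline"
    by (intro borel_halfline) measurable
qed (use assms nn_integral_Gamma_halfline[OF assms] in auto)

lemma sigma_finite_halfline: "sigma_finite_measure halfline"
  by (intro sigma_finite_measure_restrict_space lborel.sigma_finite_measure_axioms) simp

section \<open>Vandermonde's convolution in terms of Gamma functions\<close>

lemma gbinomial_Gamma:
  assumes "c > (-1::real)"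
  shows "(c + real n) gchoose n = Gamma (c + real n + 1) * rGamma (c + 1) / fact n"
proof -
  have "c + 1 \<notin> \<int>\<^sub>\<le>\<^sub>0" using assms nonpos_Ints_nonpos[of "c + 1"] by auto
  then have "pochhammer (c + 1) n = Gamma (c + 1 + real n) / Gamma (c + 1)"
    using pochhammer_Gamma[of "c + 1" n] by simp
  then show ?thesis
    by (simp add: gbinomial_pochhammer' rGamma_inverse_Gamma divide_inverse add_ac)
qed

lemma Gamma_rGamma_shift: "\<alpha> > -1 \<Longrightarrow> Gamma (real m + \<alpha> + 1) * rGamma (real m + \<alpha> + 1) = 1"
  using Gamma_real_pos[of "real m + \<alpha> + 1"] by (simp add: rGamma_inverse_Gamma order_less_imp_not_eq2)

text \<open>Integrating the product of two Bessel series against s^alpha exp(-e s) produces Gamma(i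
  + j + alpha + 1), which couples i to j. Vandermonde's convolution for the binomial coefficient of
  i + (j + alpha) over j resolves it into terms that depend on i - k and j - k separately.\<close>

lemma Gamma_Vandermonde:
  assumes \<alpha>: "\<alpha> > -1"
  shows "Gamma (real (i + j) + \<alpha> + 1) * rGamma (real i + \<alpha> + 1) * rGamma (real j + \<alpha> + 1) / (fact i * fact j)
    = (\<Sum>k\<le>j. if k \<le> i then rGamma (real k + \<alpha> + 1) / (fact k * fact (i - k) * fact (j - k)) else 0)"
proof -
  have 1: "(real i + (real j + \<alpha>)) gchoose j = Gamma (real (i + j) + \<alpha> + 1) * rGamma (real i + \<alpha> + 1) / fact j"
    using gbinomial_Gamma[of "real i + \<alpha>" j] \<alpha> by (simp add: add_ac)
  have 2: "(real j + \<alpha>) gchoose (j - k) = Gamma (real j + \<alpha> + 1) * rGamma (real k + \<alpha> + 1) / fact (j - k)" if "k \<le> j" for k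
    using gbinomial_Gamma[of "real k + \<alpha>" "j - k"] \<alpha> that by (simp add: add_ac of_nat_diff)
  have "Gamma (real (i + j) + \<alpha> + 1) * rGamma (real i + \<alpha> + 1) * rGamma (real j + \<alpha> + 1) / (fact i * fact j)
      = rGamma (real j + \<alpha> + 1) / fact i * ((real i + (real j + \<alpha>)) gchoose j)"
    unfolding 1 by simp
  also have "\<dots> = (\<Sum>k\<le>j. rGamma (real j + \<alpha> + 1) / fact i * ((real i gchoose k) * ((real j + \<alpha>) gchoose (j - k))))"
    unfolding gbinomial_Vandermonde[symmetric] by (simp add: sum_distrib_left atMost_atLeast0)
  also have "\<dots> = (\<Sum>k\<le>j. if k \<le> i then rGamma (real k + \<alpha> + 1) / (fact k * fact (i - k) * fact (j - k)) else 0)"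
  proof (intro sum.cong refl)
    fix k assume "k \<in> {..j}"
    then have k: "k \<le> j" by simp
    have g: "rGamma (real j + \<alpha> + 1) * Gamma (real j + \<alpha> + 1) = 1"
      using Gamma_rGamma_shift[OF \<alpha>, of j] by (simp add: mult.commute)
    have b: "real i gchoose k = real (i choose k)" by (simp add: binomial_gbinomial)
    have "rGamma (real j + \<alpha> + 1) / fact i * ((real i gchoose k) * ((real j + \<alpha>) gchoose (j - k)))
       = (rGamma (real j + \<alpha> + 1) * Gamma (real j + \<alpha> + 1)) * (real (i choose k) / fact i) * (rGamma (real k + \<alpha> + 1) / fact (j - k))"
      unfolding 2[OF k] b by simp
    also have "\<dots> = (real (i choose k) / fact i) * (rGamma (real k + \<alpha> + 1) / fact (j - k))"
      unfolding g by simp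
    also have "\<dots> = (if k \<le> i then rGamma (real k + \<alpha> + 1) / (fact k * fact (i - k) * fact (j - k)) else 0)"
    proof (cases "k \<le> i")
      case True
      have "real (i choose k) / fact i = 1 / (fact k * fact (i - k))"
        by (simp add: binomial_fact[OF True])
      then show ?thesis using True by simp
    qed (simp add: binomial_eq_0)
    finally show "rGamma (real j + \<alpha> + 1) / fact i * ((real i gchoose k) * ((real j + \<alpha>) gchoose (j - k)))
       = (if k \<le> i then rGamma (real k + \<alpha> + 1) / (fact k * fact (i - k) * fact (j - k)) else 0)" .
  qed
  finally show ?thesis .
qed

text \<open>The part of total degree n of the double series that arises when the product of the two
  Bessel series is integrated.\<close>

definition weber_u :: "real \<Rightarrow> real \<Rightarrow> real \<Rightarrow> nat \<Rightarrow> real" where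
  "weber_u \<alpha> X Y n = (\<Sum>i\<le>n. Gamma (real n + \<alpha> + 1) * rGamma (real i + \<alpha> + 1) * rGamma (real (n - i) + \<alpha> + 1)
     / (fact i * fact (n - i)) * (X ^ i * Y ^ (n - i)))"

text \<open>(X Y)^k has degree 2 k, so the modified Bessel series is spread over the even indices;
  then its Cauchy product with the series of exp(X + Y) collects terms of equal degree.\<close>

definition weber_v :: "real \<Rightarrow> real \<Rightarrow> nat \<Rightarrow> real" where
  "weber_v \<alpha> Z j = (if even j then rGamma (real (j div 2) + \<alpha> + 1) / fact (j div 2) * Z ^ (j div 2) else 0)"

text \<open>After the Vandermonde expansion, for fixed k the sum over i is the binomial expansion of
  (X + Y)^(n - 2 k) / (n - 2 k)!, times the k-th term in X Y.\<close>

lemma weber_u_Cauchy: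
  assumes \<alpha>: "\<alpha> > -1"
  shows "weber_u \<alpha> X Y n = (\<Sum>j\<le>n. weber_v \<alpha> (X * Y) j * ((X + Y) ^ (n - j) /\<^sub>R fact (n - j)))"
proof -
  let ?r = "\<lambda>k. rGamma (real k + \<alpha> + 1) / fact k"
  let ?T = "\<lambda>i k. ?r k * (X ^ i * Y ^ (n - i) / (fact (i - k) * fact (n - i - k)))"
  have "weber_u \<alpha> X Y n = (\<Sum>i\<le>n. \<Sum>k\<le>n. if k \<le> i \<and> i + k \<le> n then ?T i k else 0)"
    unfolding weber_u_def
  proof (intro sum.cong refl)
    fix i assume "i \<in> {..n}"
    then have i: "i \<le> n" by simp
    have "Gamma (real n + \<alpha> + 1) * rGamma (real i + \<alpha> + 1) * rGamma (real (n - i) + \<alpha> + 1) / (fact i * fact (n - i))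
        = (\<Sum>k\<le>n - i. if k \<le> i then rGamma (real k + \<alpha> + 1) / (fact k * fact (i - k) * fact (n - i - k)) else 0)"
      using Gamma_Vandermonde[OF \<alpha>, of i "n - i"] i by simp
    then have "Gamma (real n + \<alpha> + 1) * rGamma (real i + \<alpha> + 1) * rGamma (real (n - i) + \<alpha> + 1) / (fact i * fact (n - i)) * (X ^ i * Y ^ (n - i))
        = (\<Sum>k\<le>n - i. if k \<le> i then ?T i k else 0)"
      by (simp only: sum_distrib_right) (auto intro!: sum.cong)
    also have "\<dots> = (\<Sum>k\<le>n. if k \<le> i \<and> i + k \<le> n then ?T i k else 0)"
      using i by (intro sum.mono_neutral_cong_left) auto
    finally show "Gamma (real n + \<alpha> + 1) * rGamma (real i + \<alpha> + 1) * rGamma (real (n - i) + \<alpha> + 1) / (fact i * fact (n - i)) * (X ^ i * Y ^ (n - i))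
        = (\<Sum>k\<le>n. if k \<le> i \<and> i + k \<le> n then ?T i k else 0)" .
  qed
  also have "\<dots> = (\<Sum>k\<le>n. \<Sum>i\<le>n. if k \<le> i \<and> i + k \<le> n then ?T i k else 0)"
    by (rule sum.swap)
  also have "\<dots> = (\<Sum>k\<le>n. if 2 * k \<le> n then ?r k * (X * Y) ^ k * ((X + Y) ^ (n - 2 * k) /\<^sub>R fact (n - 2 * k)) else 0)"
  proof (intro sum.cong refl)
    fix k assume "k \<in> {..n}"
    show "(\<Sum>i\<le>n. if k \<le> i \<and> i + k \<le> n then ?T i k else 0)
        = (if 2 * k \<le> n then ?r k * (X * Y) ^ k * ((X + Y) ^ (n - 2 * k) /\<^sub>R fact (n - 2 * k)) else 0)"
    proof (cases "2 * k \<le> n")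
      case True
      define m where "m = n - 2 * k"
      have n: "n = m + 2 * k" using True by (simp add: m_def)
      have "(\<Sum>i\<le>n. if k \<le> i \<and> i + k \<le> n then ?T i k else 0) = (\<Sum>i\<in>{k..n - k}. ?T i k)"
        using True by (intro sum.mono_neutral_cong_right) auto
      also have "\<dots> = (\<Sum>i\<le>m. ?T (i + k) k)"
        by (rule sum.reindex_bij_witness[of _ "\<lambda>i. i + k" "\<lambda>i. i - k"]) (auto simp: n)
      also have "\<dots> = (\<Sum>i\<le>m. ?r k * (X * Y) ^ k * (real (m choose i) * X ^ i * Y ^ (m - i) / fact m))"
      proof (intro sum.cong refl)
        fix i assume "i \<in> {..m}"
        then have i: "i \<le> m" by simp
        have "real (m choose i) / fact m = 1 / (fact i * fact (m - i))"
          by (simp add: binomial_fact[OF i])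
        then have "?r k * (X * Y) ^ k * (real (m choose i) * X ^ i * Y ^ (m - i) / fact m)
            = ?r k * (X * Y) ^ k * (X ^ i * Y ^ (m - i) * (1 / (fact i * fact (m - i))))"
        proof -
          assume b: "real (m choose i) / fact m = 1 / (fact i * fact (m - i))"
          have "a * (B * p * q / f) = a * (p * q * (B / f))" for a B p q f :: real by simp
          then show ?thesis unfolding b[symmetric] .
        qed

        moreover have "n - (i + k) = (m - i) + k" "n - (i + k) - k = m - i" using i n by auto
        ultimately show "?T (i + k) k = ?r k * (X * Y) ^ k * (real (m choose i) * X ^ i * Y ^ (m - i) / fact m)"
          by (simp add: power_add power_mult_distrib mult_ac)
      qed
      also have "\<dots> = ?r k * (X * Y) ^ k * ((X + Y) ^ m / fact m)"
        unfolding binomial_ring by (simp add: sum_distrib_left sum_divide_distrib mult_ac)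
      finally show ?thesis using True by (simp add: m_def divide_inverse mult_ac)
    qed (auto intro!: sum.neutral)
  qed
  also have "\<dots> = (\<Sum>k | 2 * k \<le> n. ?r k * (X * Y) ^ k * ((X + Y) ^ (n - 2 * k) /\<^sub>R fact (n - 2 * k)))"
    by (intro sum.mono_neutral_cong_right) auto
  also have "\<dots> = (\<Sum>j | j \<le> n \<and> even j. weber_v \<alpha> (X * Y) j * ((X + Y) ^ (n - j) /\<^sub>R fact (n - j)))"
    by (rule sum.reindex_bij_witness[of _ "\<lambda>j. j div 2" "\<lambda>k. 2 * k"]) (auto simp: weber_v_def)
  also have "\<dots> = (\<Sum>j\<le>n. weber_v \<alpha> (X * Y) j * ((X + Y) ^ (n - j) /\<^sub>R fact (n - j)))"
    by (intro sum.mono_neutral_cong_left) (auto simp: weber_v_def)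
  finally show ?thesis .
qed

lemma summable_weber:
  assumes \<alpha>: "\<alpha> > -1" and Z: "0 \<le> Z"
  shows "summable (\<lambda>k. rGamma (real k + \<alpha> + 1) / fact k * Z ^ k)"
proof (rule summable_comparison_test'[OF summable_rGamma_power[OF \<alpha>, of Z]])
  fix k
  have "rGamma (real k + \<alpha> + 1) / fact k \<le> rGamma (real k + \<alpha> + 1) / 1"
    using rGamma_shift_pos[OF \<alpha>, of k] by (intro divide_left_mono) auto
  from mult_right_mono[OF this, of "Z ^ k"]
  show "norm (rGamma (real k + \<alpha> + 1) / fact k * Z ^ k) \<le> rGamma (real k + \<alpha> + 1) * Z ^ k"
    using rGamma_shift_pos[OF \<alpha>, of k] Z by (simp add: abs_mult)
qed

lemma weber_u_sums:
  assumes \<alpha>: "\<alpha> > -1" and Z: "0 \<le> X * Y"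
  shows "weber_u \<alpha> X Y sums ((\<Sum>k. rGamma (real k + \<alpha> + 1) / fact k * (X * Y) ^ k) * exp (X + Y))"
proof -
  let ?S = "\<Sum>k. rGamma (real k + \<alpha> + 1) / fact k * (X * Y) ^ k"
  have "(\<lambda>k. weber_v \<alpha> (X * Y) (2 * k)) sums ?S"
    using summable_sums[OF summable_weber[OF \<alpha> Z]] by (simp add: weber_v_def)
  moreover have "weber_v \<alpha> (X * Y) n = 0" if "n \<notin> range (\<lambda>k. 2 * k)" for n
    using that by (auto simp: weber_v_def elim!: evenE)
  ultimately have v: "weber_v \<alpha> (X * Y) sums ?S"
    using sums_mono_reindex[of "\<lambda>k. 2 * k" "weber_v \<alpha> (X * Y)" ?S] by (simp add: strict_mono_def)
  have "norm (weber_v \<alpha> (X * Y) j) = weber_v \<alpha> (X * Y) j" for j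
    using rGamma_shift_pos[OF \<alpha>, of "j div 2"] Z by (simp add: weber_v_def)
  then have "summable (\<lambda>j. norm (weber_v \<alpha> (X * Y) j))"
    using sums_summable[OF v] by simp
  from Cauchy_product_sums[OF this summable_norm_exp[of "X + Y"]]
  show ?thesis
    unfolding weber_u_Cauchy[OF \<alpha>, symmetric] sums_unique[OF v, symmetric] by (simp add: exp_def)

qed

text \<open>Half of the rate \<open>e\<close> goes to each factor, so that a product of two values
  carries exp(-e s).\<close>

definition hankel_exp :: "real \<Rightarrow> real \<Rightarrow> real \<Rightarrow> real \<Rightarrow> real" where
  "hankel_exp \<alpha> e s x = exp (- (e / 2 * s)) * hankel \<alpha> s x"

text \<open>For Z > 0 this is Z^(-alpha/2) I_alpha(2 sqrt Z) with the modified Bessel function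
  I_alpha; for alpha > -1 all coefficients are positive.\<close>

definition weber_I :: "real \<Rightarrow> real \<Rightarrow> real" where
  "weber_I \<alpha> Z = (\<Sum>k. rGamma (real k + \<alpha> + 1) / fact k * Z ^ k)"

text \<open>The alternating signs of the two Bessel series turn X, Y into -X, -Y. The product X Y
  keeps its sign, so the result is a series of nonnegative terms times exp(-X - Y): the kernel is
  nonnegative although the integrand oscillates.\<close>

lemma weber_integral:
  assumes \<alpha>: "\<alpha> > -1" and x: "0 < x" and t: "0 < t" and e: "0 < e"
  defines "X \<equiv> x / (4 * e)" and "Y \<equiv> t / (4 * e)"
  shows "(LINT s|halfline. hankel_exp \<alpha> e s x * hankel_exp \<alpha> e s t)
    = pw \<alpha> x * pw \<alpha> t / 4 * (4 powr (-\<alpha>) * e powr (- (\<alpha> + 1))) * (weber_I \<alpha> (X * Y) * exp (- X - Y))"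
proof -
  define g where "g n = (\<Sum>i\<le>n. (bcoef \<alpha> i * x ^ i) * (bcoef \<alpha> (n - i) * t ^ (n - i)))" for n
  define f where "f n s = g n * (s powr (\<alpha> + real n) * exp (- (e * s)))" for n and s :: real
  \<comment> \<open>4^(-alpha) collects the factor 2^(-alpha) of each series. The power of
    \<open>e\<close> is what the Gamma integral leaves besides e^(-n), which goes into X and
    Y.\<close>
  define c where "c = 4 powr (-\<alpha>) * e powr (- (\<alpha> + 1))"
  have c: "0 \<le> c" by (simp add: c_def)
  have XY: "0 \<le> X" "0 \<le> Y" "0 \<le> X * Y" using x t e by (auto simp: X_def Y_def)
  have hb: "has_bochner_integral halfline (\<lambda>s. s powr (\<alpha> + real n) * exp (- (e * s)))
      (Gamma (real n + \<alpha> + 1) / e powr (real n + \<alpha> + 1))" for n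
    using has_integral_Gamma_halfline[of "real n + \<alpha> + 1" e] \<alpha> e by (simp add: add_ac)
  have c4: "2 powr (-\<alpha>) * 2 powr (-\<alpha>) = 4 powr (-\<alpha>)"
    by (simp add: powr_mult[symmetric])
  have g_eq: "g n * (Gamma (real n + \<alpha> + 1) / e powr (real n + \<alpha> + 1)) = c * weber_u \<alpha> (-X) (-Y) n" for n
  proof -
    have ep: "e powr (real n + \<alpha> + 1) = e ^ n * e powr (\<alpha> + 1)"
      using e by (simp add: powr_add powr_realpow)
    have "g n * (Gamma (real n + \<alpha> + 1) / e powr (real n + \<alpha> + 1))
        = (\<Sum>i\<le>n. (bcoef \<alpha> i * x ^ i) * (bcoef \<alpha> (n - i) * t ^ (n - i)) * (Gamma (real n + \<alpha> + 1) / e powr (real n + \<alpha> + 1)))"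
      by (simp only: g_def sum_distrib_right)
    also have "\<dots> = (\<Sum>i\<le>n. c * (Gamma (real n + \<alpha> + 1) * rGamma (real i + \<alpha> + 1) * rGamma (real (n - i) + \<alpha> + 1)
     / (fact i * fact (n - i)) * ((-X) ^ i * (-Y) ^ (n - i))))"
    proof (intro sum.cong refl)
      fix i assume "i \<in> {..n}"
      then have i: "e ^ n = e ^ i * e ^ (n - i)" by (simp add: power_add[symmetric])
      have p: "(-X) ^ i = (-1) ^ i * x ^ i / (4 ^ i * e ^ i)" "(-Y) ^ (n - i) = (-1) ^ (n - i) * t ^ (n - i) / (4 ^ (n - i) * e ^ (n - i))"
        unfolding X_def Y_def by (simp_all add: power_minus[of "_ / _"] power_divide power_mult_distrib)
      have m: "e powr (- (\<alpha> + 1)) = 1 / e powr (\<alpha> + 1)" by (simp only: powr_minus inverse_eq_divide)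
      show "(bcoef \<alpha> i * x ^ i) * (bcoef \<alpha> (n - i) * t ^ (n - i)) * (Gamma (real n + \<alpha> + 1) / e powr (real n + \<alpha> + 1))
         = c * (Gamma (real n + \<alpha> + 1) * rGamma (real i + \<alpha> + 1) * rGamma (real (n - i) + \<alpha> + 1)
     / (fact i * fact (n - i)) * ((-X) ^ i * (-Y) ^ (n - i)))"
        unfolding p ep i c_def c4[symmetric] bcoef_def m by (simp add: mult_ac)

    qed
    finally show ?thesis by (simp add: weber_u_def sum_distrib_left)
  qed
  \<comment> \<open>Exchanging sum and integral requires absolute convergence; passing from -X, -Y
    to X, Y removes all signs and gives a convergent majorant.\<close>
  have u_abs: "\<bar>weber_u \<alpha> (-X) (-Y) n\<bar> \<le> weber_u \<alpha> X Y n" for n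
    unfolding weber_u_def
  proof (rule order_trans[OF sum_abs], rule sum_mono)
    fix i assume "i \<in> {..n}"
    have "0 < Gamma (real n + \<alpha> + 1)" using \<alpha> by (intro Gamma_real_pos) linarith
    then show "\<bar>Gamma (real n + \<alpha> + 1) * rGamma (real i + \<alpha> + 1) * rGamma (real (n - i) + \<alpha> + 1)
     / (fact i * fact (n - i)) * ((-X) ^ i * (-Y) ^ (n - i))\<bar> \<le> Gamma (real n + \<alpha> + 1) * rGamma (real i + \<alpha> + 1) * rGamma (real (n - i) + \<alpha> + 1)
     / (fact i * fact (n - i)) * (X ^ i * Y ^ (n - i))"
      using rGamma_shift_pos[OF \<alpha>, of i] rGamma_shift_pos[OF \<alpha>, of "n - i"] XY by (simp add: abs_mult power_abs)
  qed
  have int: "integrable halfline (f n)" for n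
    unfolding f_def using hb by (intro integrable_mult_right) (simp add: has_bochner_integral_iff)

  have I: "(LINT s|halfline. f n s) = c * weber_u \<alpha> (-X) (-Y) n" for n
    unfolding f_def g_eq[symmetric] using has_bochner_integral_integral_eq[OF hb] by simp
  have In: "(LINT s|halfline. norm (f n s)) = \<bar>c * weber_u \<alpha> (-X) (-Y) n\<bar>" for n
  proof -
    have "(LINT s|halfline. norm (f n s)) = \<bar>g n\<bar> * (Gamma (real n + \<alpha> + 1) / e powr (real n + \<alpha> + 1))"
      unfolding f_def using has_bochner_integral_integral_eq[OF hb] by (simp add: abs_mult)
    also have "\<dots> = \<bar>g n * (Gamma (real n + \<alpha> + 1) / e powr (real n + \<alpha> + 1))\<bar>"
    proof -
      have "0 < Gamma (real n + \<alpha> + 1)" using \<alpha> by (intro Gamma_real_pos) linarith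
      then show ?thesis by (simp add: abs_mult)
    qed
    finally show ?thesis unfolding g_eq .
  qed
  have prod_sums: "(\<lambda>n. g n * s ^ n) sums (bphi \<alpha> (s * x) * bphi \<alpha> (s * t))" for s
  proof -
    have "(\<lambda>n. \<Sum>i\<le>n. (bcoef \<alpha> i * (s * x) ^ i) * (bcoef \<alpha> (n - i) * (s * t) ^ (n - i))) sums (bphi \<alpha> (s * x) * bphi \<alpha> (s * t))"
      unfolding bphi_def by (intro Cauchy_product_sums summable_bcoef_norm \<alpha>)
    moreover have "(\<Sum>i\<le>n. (bcoef \<alpha> i * (s * x) ^ i) * (bcoef \<alpha> (n - i) * (s * t) ^ (n - i))) = g n * s ^ n" for n
      unfolding g_def sum_distrib_right
    proof (intro sum.cong refl)
      fix i assume "i \<in> {..n}"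
      then have i: "s ^ n = s ^ i * s ^ (n - i)" by (simp add: power_add[symmetric])
      show "(bcoef \<alpha> i * (s * x) ^ i) * (bcoef \<alpha> (n - i) * (s * t) ^ (n - i)) = (bcoef \<alpha> i * x ^ i) * (bcoef \<alpha> (n - i) * t ^ (n - i)) * s ^ n"
        unfolding i by (simp add: power_mult_distrib)
    qed
    ultimately show ?thesis by simp
  qed
  have prod_abs: "summable (\<lambda>n. norm (g n * s ^ n))" for s
  proof (rule summable_comparison_test')
    show "summable (\<lambda>n. \<Sum>i\<le>n. norm (bcoef \<alpha> i * (s * x) ^ i) * norm (bcoef \<alpha> (n - i) * (s * t) ^ (n - i)))"
    proof (rule summable_Cauchy_product)
      show "summable (\<lambda>n. norm (norm (bcoef \<alpha> n * y ^ n)))" for y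
        using summable_bcoef_norm[OF \<alpha>, of y] by simp
      then show "summable (\<lambda>n. norm (norm (bcoef \<alpha> n * (s * t) ^ n)))" .
    qed
    fix n
    have "norm (norm (g n * s ^ n)) = \<bar>\<Sum>i\<le>n. (bcoef \<alpha> i * (s * x) ^ i) * (bcoef \<alpha> (n - i) * (s * t) ^ (n - i))\<bar>"
      unfolding g_def sum_distrib_right real_norm_def abs_idempotent

    proof (intro arg_cong[where f = abs] sum.cong refl)
      fix i assume "i \<in> {..n}"
      then have i: "s ^ n = s ^ i * s ^ (n - i)" by (simp add: power_add[symmetric])
      show "(bcoef \<alpha> i * x ^ i) * (bcoef \<alpha> (n - i) * t ^ (n - i)) * s ^ n = (bcoef \<alpha> i * (s * x) ^ i) * (bcoef \<alpha> (n - i) * (s * t) ^ (n - i))"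
        unfolding i by (simp add: power_mult_distrib)
    qed
    also have "\<dots> \<le> (\<Sum>i\<le>n. norm (bcoef \<alpha> i * (s * x) ^ i) * norm (bcoef \<alpha> (n - i) * (s * t) ^ (n - i)))"
      by (rule order_trans[OF sum_abs]) (simp add: abs_mult)
    finally show "norm (norm (g n * s ^ n)) \<le> (\<Sum>i\<le>n. norm (bcoef \<alpha> i * (s * x) ^ i) * norm (bcoef \<alpha> (n - i) * (s * t) ^ (n - i)))" .
  qed
  have f_eq: "f n s = (s powr \<alpha> * exp (- (e * s))) * (g n * s ^ n)" if "0 < s" for n s
    unfolding f_def using that by (simp add: powr_add powr_realpow)
  have hh: "hankel_exp \<alpha> e s x * hankel_exp \<alpha> e s t = pw \<alpha> x * pw \<alpha> t / 4 * (\<Sum>n. f n s)" if s: "0 < s" for s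
  proof -
    have "(\<Sum>n. f n s) = (s powr \<alpha> * exp (- (e * s))) * (bphi \<alpha> (s * x) * bphi \<alpha> (s * t))"
      unfolding f_eq[OF s] using sums_unique[OF sums_mult[OF prod_sums]] by simp
    moreover have "s powr \<alpha> = pw \<alpha> s * pw \<alpha> s"
      using pw_square[of s \<alpha>] by (simp add: power2_eq_square)
    moreover have "exp (- (e * s)) = exp (- (e / 2 * s)) * exp (- (e / 2 * s))"
      by (simp add: exp_add[symmetric])
    ultimately show ?thesis by (simp add: hankel_exp_def hankel_def)
  qed
  have "(LINT s|halfline. hankel_exp \<alpha> e s x * hankel_exp \<alpha> e s t) = (LINT s|halfline. pw \<alpha> x * pw \<alpha> t / 4 * (\<Sum>n. f n s))"
    using hh by (intro Bochner_Integration.integral_cong) auto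
  also have "\<dots> = pw \<alpha> x * pw \<alpha> t / 4 * (LINT s|halfline. (\<Sum>n. f n s))"
    by (rule integral_mult_right_zero)
  also have "(LINT s|halfline. (\<Sum>n. f n s)) = (\<Sum>n. LINT s|halfline. f n s)"
  proof (rule integral_suminf[OF int])
    show "AE s in halfline. summable (\<lambda>n. norm (f n s))"
    proof (rule AE_I2)
      fix s assume "s \<in> space halfline"
      then have s: "0 < s" by simp
      have "summable (\<lambda>n. \<bar>s powr \<alpha> * exp (- (e * s))\<bar> * norm (g n * s ^ n))"
        by (intro summable_mult prod_abs)
      then show "summable (\<lambda>n. norm (f n s))"
        unfolding f_eq[OF s] by (simp add: abs_mult)
    qed
    show "summable (\<lambda>n. LINT s|halfline. norm (f n s))"
      unfolding In
    proof (rule summable_comparison_test')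
      show "summable (\<lambda>n. c * weber_u \<alpha> X Y n)"
        by (intro summable_mult sums_summable[OF weber_u_sums[OF \<alpha> XY(3)]])
      show "norm \<bar>c * weber_u \<alpha> (-X) (-Y) n\<bar> \<le> c * weber_u \<alpha> X Y n" for n
        using mult_left_mono[OF u_abs c] c by (simp add: abs_mult)
    qed
  qed
  also have "\<dots> = (\<Sum>n. c * weber_u \<alpha> (-X) (-Y) n)" unfolding I ..
  also have "\<dots> = c * (weber_I \<alpha> (X * Y) * exp (- X - Y))"
    using sums_unique[OF sums_mult[OF weber_u_sums[OF \<alpha>, of "-X" "-Y"], of c]] XY by (simp add: weber_I_def)
  finally show ?thesis unfolding c_def by (simp only: mult.assoc)
qed

lemma weber_I_nonneg:
  assumes "\<alpha> > -1" "0 \<le> Z"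
  shows "0 \<le> weber_I \<alpha> Z"
  unfolding weber_I_def using assms rGamma_shift_pos[OF assms(1)]
  by (intro suminf_nonneg summable_weber) (auto simp: less_imp_le)

text \<open>Each term of the series for the kernel is a Gamma integral in t whose value cancels
  1/Gamma(k + alpha + 1). What is left are the Poisson weights exp(-X) X^k / k!, of total mass 1.
  All terms are nonnegative, so sum and integral may be exchanged freely.\<close>

lemma weber_mass:
  assumes \<alpha>: "\<alpha> > -1" and x: "0 < x" and e: "0 < e"
  shows "(\<integral>\<^sup>+t. ennreal ((LINT s|halfline. hankel_exp \<alpha> e s x * hankel_exp \<alpha> e s t) * pw \<alpha> t) \<partial>halfline) = ennreal (pw \<alpha> x)"
proof -
  define X where "X = x / (4 * e)"
  define K where "K = pw \<alpha> x / 4 * (4 powr (-\<alpha>) * e powr (- (\<alpha> + 1))) * exp (- X)"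
  have K: "0 \<le> K" by (simp add: K_def)
  have X: "0 \<le> X" using x e by (simp add: X_def)
  define A where "A k = rGamma (real k + \<alpha> + 1) / fact k * (X / (4 * e)) ^ k" for k
  have A: "0 \<le> A k" for k using rGamma_shift_pos[OF \<alpha>, of k] X e by (simp add: A_def)
  have eq: "(LINT s|halfline. hankel_exp \<alpha> e s x * hankel_exp \<alpha> e s t) * pw \<alpha> t
      = (\<Sum>k. K * A k * (t powr (real k + \<alpha>) * exp (- (1 / (4 * e) * t))))"
    and summ: "summable (\<lambda>k. K * A k * (t powr (real k + \<alpha>) * exp (- (1 / (4 * e) * t))))" if t: "0 < t" for t
  proof -
    let ?Y = "t / (4 * e)"
    have ta: "t powr \<alpha> = pw \<alpha> t * pw \<alpha> t"
      using pw_square[of t \<alpha>] by (simp add: power2_eq_square)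
    have trm: "K * A k * (t powr (real k + \<alpha>) * exp (- (1 / (4 * e) * t)))
        = K * t powr \<alpha> * exp (- ?Y) * (rGamma (real k + \<alpha> + 1) / fact k * (X * ?Y) ^ k)" for k
      unfolding A_def using t e by (simp add: powr_add powr_realpow power_mult_distrib power_divide)
    have S: "summable (\<lambda>k. rGamma (real k + \<alpha> + 1) / fact k * (X * ?Y) ^ k)"
      by (rule summable_weber[OF \<alpha>]) (use X t e in simp)
    show "summable (\<lambda>k. K * A k * (t powr (real k + \<alpha>) * exp (- (1 / (4 * e) * t))))"
      unfolding trm by (rule summable_mult[OF S])
    have "(\<Sum>k. K * A k * (t powr (real k + \<alpha>) * exp (- (1 / (4 * e) * t)))) = K * t powr \<alpha> * exp (- ?Y) * weber_I \<alpha> (X * ?Y)"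
      unfolding trm weber_I_def by (rule suminf_mult[OF S])
    also have "\<dots> = pw \<alpha> x * pw \<alpha> t / 4 * (4 powr (-\<alpha>) * e powr (- (\<alpha> + 1))) * (weber_I \<alpha> (X * ?Y) * exp (- X - ?Y)) * pw \<alpha> t"
    proof -
      have "(q / 4 * cc * E) * (p * p) * F * W = q * p / 4 * cc * (W * (E * F)) * p" for q cc E p F W :: real
        by (simp add: mult_ac)
      moreover have "exp (- X - ?Y) = exp (- X) * exp (- ?Y)" by (simp add: exp_add[symmetric])
      ultimately show ?thesis unfolding K_def ta by metis
    qed

    also have "\<dots> = (LINT s|halfline. hankel_exp \<alpha> e s x * hankel_exp \<alpha> e s t) * pw \<alpha> t"
      unfolding weber_integral[OF \<alpha> x t e] X_def ..
    finally show "(LINT s|halfline. hankel_exp \<alpha> e s x * hankel_exp \<alpha> e s t) * pw \<alpha> t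
      = (\<Sum>k. K * A k * (t powr (real k + \<alpha>) * exp (- (1 / (4 * e) * t))))" ..
  qed
  have "(\<integral>\<^sup>+t. ennreal ((LINT s|halfline. hankel_exp \<alpha> e s x * hankel_exp \<alpha> e s t) * pw \<alpha> t) \<partial>halfline)
      = (\<integral>\<^sup>+t. (\<Sum>k. ennreal (K * A k) * ennreal (t powr (real k + \<alpha> + 1 - 1) * exp (- (1 / (4 * e) * t)))) \<partial>halfline)"
  proof (intro nn_integral_cong)
    fix t assume "t \<in> space halfline"
    then have t: "0 < t" by simp
    show "ennreal ((LINT s|halfline. hankel_exp \<alpha> e s x * hankel_exp \<alpha> e s t) * pw \<alpha> t)
      = (\<Sum>k. ennreal (K * A k) * ennreal (t powr (real k + \<alpha> + 1 - 1) * exp (- (1 / (4 * e) * t))))"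
      unfolding eq[OF t] using summ[OF t] K A
      by (subst suminf_ennreal2[symmetric]) (auto simp: ennreal_mult[symmetric])
  qed
  also have "\<dots> = (\<Sum>k. \<integral>\<^sup>+t. ennreal (K * A k) * ennreal (t powr (real k + \<alpha> + 1 - 1) * exp (- (1 / (4 * e) * t))) \<partial>halfline)"
    by (intro nn_integral_suminf borel_halfline) measurable
  also have "\<dots> = (\<Sum>k. ennreal (pw \<alpha> x * exp (- X) * (X ^ k /\<^sub>R fact k)))"
  proof (intro suminf_cong)
    fix k
    have p: "0 < real k + \<alpha> + 1" using \<alpha> by linarith
    have G: "0 < Gamma (real k + \<alpha> + 1)" by (rule Gamma_real_pos[OF p])
    have "(\<integral>\<^sup>+t. ennreal (K * A k) * ennreal (t powr (real k + \<alpha> + 1 - 1) * exp (- (1 / (4 * e) * t))) \<partial>halfline)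
        = ennreal (K * A k) * ennreal (Gamma (real k + \<alpha> + 1) / (1 / (4 * e)) powr (real k + \<alpha> + 1))"
    proof (subst nn_integral_cmult)
      show "(\<lambda>t. ennreal (t powr (real k + \<alpha> + 1 - 1) * exp (- (1 / (4 * e) * t)))) \<in> borel_measurable halfline"
        by (intro borel_halfline) measurable
      show "ennreal (K * A k) * (\<integral>\<^sup>+t. ennreal (t powr (real k + \<alpha> + 1 - 1) * exp (- (1 / (4 * e) * t))) \<partial>halfline)
        = ennreal (K * A k) * ennreal (Gamma (real k + \<alpha> + 1) / (1 / (4 * e)) powr (real k + \<alpha> + 1))"
        using nn_integral_Gamma_halfline[OF p, of "1 / (4 * e)"] e by simp
    qed
    also have "\<dots> = ennreal (K * A k * (Gamma (real k + \<alpha> + 1) / (1 / (4 * e)) powr (real k + \<alpha> + 1)))"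
      using K A G by (intro ennreal_mult[symmetric]) auto
    also have "K * A k * (Gamma (real k + \<alpha> + 1) / (1 / (4 * e)) powr (real k + \<alpha> + 1)) = pw \<alpha> x * exp (- X) * (X ^ k /\<^sub>R fact k)"
    proof -
      have 1: "(1 / (4 * e)) powr (real k + \<alpha> + 1) = 1 / ((4 * e) ^ k * (4 * (4 powr \<alpha> * e powr (\<alpha> + 1))))"
      proof -
        have "(1 / (4 * e)) powr (real k + \<alpha> + 1) = 1 / (4 * e) powr (real k + (\<alpha> + 1))"
          using e by (simp add: powr_divide add_ac)
        also have "(4 * e) powr (real k + (\<alpha> + 1)) = (4 * e) ^ k * (4 * e) powr (\<alpha> + 1)"
        proof -
          have "(4 * e) powr real k = (4 * e) ^ k" using e by (intro powr_realpow) simp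
          then show ?thesis by (simp only: powr_add[of "4 * e" "real k" "\<alpha> + 1"])
        qed
        also have "(4 * e) powr (\<alpha> + 1) = 4 * (4 powr \<alpha> * e powr (\<alpha> + 1))"
          using e by (simp add: powr_mult powr_add[of 4])
        finally show ?thesis .
      qed
      have 2: "4 powr (-\<alpha>) = 1 / 4 powr \<alpha>" "e powr (- (\<alpha> + 1)) = 1 / e powr (\<alpha> + 1)"
        by (simp_all only: powr_minus inverse_eq_divide)
      have 3: "Gamma (real k + \<alpha> + 1) * rGamma (real k + \<alpha> + 1) = 1" by (rule Gamma_rGamma_shift[OF \<alpha>])
      have "K * A k * (Gamma (real k + \<alpha> + 1) / (1 / (4 * e)) powr (real k + \<alpha> + 1))
          = pw \<alpha> x * exp (- X) * ((Gamma (real k + \<alpha> + 1) * rGamma (real k + \<alpha> + 1)) * X ^ k / fact k)"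
      proof -
        have alg: "P / 4 * (1 / b * (1 / c)) * E * (r / F * (Z / D)) * (G / (1 / (D * (4 * (b * c))))) = P * E * ((G * r) * Z / F)"
          if "b \<noteq> 0" "c \<noteq> 0" "D \<noteq> 0" for P b c E r F Z D G :: real
          using that by (simp add: field_simps)
        show ?thesis
          unfolding K_def A_def 1 2 power_divide[of X] by (rule alg) (use e in auto)
      qed

      also have "\<dots> = pw \<alpha> x * exp (- X) * (X ^ k /\<^sub>R fact k)"
        unfolding 3 real_scaleR_def divide_inverse mult_1_left by (simp only: mult_ac)
      finally show ?thesis .

    qed
    finally show "(\<integral>\<^sup>+t. ennreal (K * A k) * ennreal (t powr (real k + \<alpha> + 1 - 1) * exp (- (1 / (4 * e) * t))) \<partial>halfline)
        = ennreal (pw \<alpha> x * exp (- X) * (X ^ k /\<^sub>R fact k))" .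
  qed
  also have "\<dots> = ennreal (\<Sum>k. pw \<alpha> x * exp (- X) * (X ^ k /\<^sub>R fact k))"
    using X sums_summable[OF sums_mult[OF exp_converges[of X], of "pw \<alpha> x * exp (- X)"]]
    by (intro suminf_ennreal2) auto
  also have "(\<Sum>k. pw \<alpha> x * exp (- X) * (X ^ k /\<^sub>R fact k)) = pw \<alpha> x"
  proof -
    have "pw \<alpha> x * exp (- X) * exp X = pw \<alpha> x" by (simp add: mult.assoc exp_add[symmetric])
    then show ?thesis
      using sums_unique[OF sums_mult[OF exp_converges[of X], of "pw \<alpha> x * exp (- X)"]] by metis
  qed

  finally show ?thesis .
qed

section \<open>The Hankel transform is a contraction\<close>

text \<open>Pointwise, F(x) F(t) is at most half of F(x)^2 a(t) / a(x) + F(t)^2 a(x) / a(t), by the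
  inequality of arithmetic and geometric means. \<open>mass\<close> integrates the first part;
  symmetry and Tonelli reduce the second to it.\<close>

lemma Schur_test:
  fixes M :: "'a measure" and G :: "'a \<Rightarrow> 'a \<Rightarrow> real"
  assumes M: "sigma_finite_measure M"
    and am: "a \<in> borel_measurable M" and a: "\<And>x. x \<in> space M \<Longrightarrow> 0 < a x"
    and Gm: "case_prod G \<in> borel_measurable (M \<Otimes>\<^sub>M M)"
    and G: "\<And>x t. x \<in> space M \<Longrightarrow> t \<in> space M \<Longrightarrow> 0 \<le> G x t"
    and sym: "\<And>x t. x \<in> space M \<Longrightarrow> t \<in> space M \<Longrightarrow> G x t = G t x"
    and mass: "\<And>x. x \<in> space M \<Longrightarrow> (\<integral>\<^sup>+t. ennreal (G x t * a t) \<partial>M) \<le> ennreal (a x)"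
    and Fm: "F \<in> borel_measurable M" and F: "\<And>x. 0 \<le> F x"
  shows "(\<integral>\<^sup>+x. \<integral>\<^sup>+t. ennreal (G x t * (F x * F t)) \<partial>M \<partial>M) \<le> (\<integral>\<^sup>+x. ennreal ((F x)^2) \<partial>M)"
proof -
  interpret sigma_finite_measure M by fact
  interpret pair_sigma_finite M M ..
  define P where "P x t = ennreal (1/2 * (F x)^2 / a x) * ennreal (G x t * a t)" for x t
  have [measurable]: "a \<in> borel_measurable M" "F \<in> borel_measurable M" "(\<lambda>z. G (fst z) (snd z)) \<in> borel_measurable (M \<Otimes>\<^sub>M M)"
    using am Fm Gm by (auto simp: case_prod_unfold)
  have Pm: "case_prod P \<in> borel_measurable (M \<Otimes>\<^sub>M M)"
    unfolding P_def case_prod_unfold by measurable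
  have Pm': "case_prod (\<lambda>x t. P t x) \<in> borel_measurable (M \<Otimes>\<^sub>M M)"
    using measurable_pair_swap[OF Pm] by (simp add: case_prod_unfold)

  have pt: "ennreal (G x t * (F x * F t)) \<le> P x t + P t x" if x: "x \<in> space M" and t: "t \<in> space M" for x t
  proof -
    have pos: "0 < a x" "0 < a t" "0 \<le> G x t" using a G x t by auto
    have "F x * F t \<le> 1/2 * (F x)^2 / a x * a t + 1/2 * (F t)^2 / a t * a x"
    proof -
      have "0 \<le> (F x * a t - F t * a x)^2" by simp
      then have "2 * (F x * F t) * (a x * a t) \<le> (F x)^2 * (a t)^2 + (F t)^2 * (a x)^2"
        by (simp add: power2_eq_square algebra_simps)
      then show ?thesis using pos by (simp add: field_simps power2_eq_square)
    qed
    then have "G x t * (F x * F t) \<le> G x t * (1/2 * (F x)^2 / a x * a t + 1/2 * (F t)^2 / a t * a x)"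
      using pos by (intro mult_left_mono)
    also have "\<dots> = (1/2 * (F x)^2 / a x) * (G x t * a t) + (1/2 * (F t)^2 / a t) * (G t x * a x)"
      unfolding sym[OF t x] by (simp only: distrib_left mult_ac)
    finally have "ennreal (G x t * (F x * F t)) \<le> ennreal ((1/2 * (F x)^2 / a x) * (G x t * a t) + (1/2 * (F t)^2 / a t) * (G t x * a x))"
      by (rule ennreal_leI)
    also have "\<dots> = P x t + P t x"
    proof -
      have "0 \<le> G t x" using pos sym[OF t x] by simp
      then have "P x t = ennreal ((1/2 * (F x)^2 / a x) * (G x t * a t))"
        "P t x = ennreal ((1/2 * (F t)^2 / a t) * (G t x * a x))"
        unfolding P_def using pos by (intro ennreal_mult[symmetric]; simp)+
      then show ?thesis
        using pos \<open>0 \<le> G t x\<close> by (simp only:) (intro ennreal_plus; simp)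
    qed

    finally show ?thesis .
  qed
  have PP: "(\<integral>\<^sup>+x. \<integral>\<^sup>+t. P x t \<partial>M \<partial>M) \<le> (\<integral>\<^sup>+x. ennreal (1/2 * (F x)^2) \<partial>M)"
  proof (rule nn_integral_mono)
    fix x assume x: "x \<in> space M"
    have gm: "(\<lambda>t. G x t) \<in> borel_measurable M"
      by (rule measurable_section1[OF Gm x])
    have "(\<integral>\<^sup>+t. P x t \<partial>M) = ennreal (1/2 * (F x)^2 / a x) * (\<integral>\<^sup>+t. ennreal (G x t * a t) \<partial>M)"
      unfolding P_def using gm by (intro nn_integral_cmult) auto
    also have "\<dots> \<le> ennreal (1/2 * (F x)^2 / a x) * ennreal (a x)"
      by (intro mult_left_mono mass x) auto
    also have "\<dots> = ennreal (1/2 * (F x)^2 / a x * a x)"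
      using a[OF x] by (intro ennreal_mult[symmetric]) auto
    also have "1/2 * (F x)^2 / a x * a x = 1/2 * (F x)^2" using a[OF x] by simp
    finally show "(\<integral>\<^sup>+t. P x t \<partial>M) \<le> ennreal (1/2 * (F x)^2)" .
  qed
  have sect: "(\<lambda>t. P x t) \<in> borel_measurable M" "(\<lambda>t. P t x) \<in> borel_measurable M" if "x \<in> space M" for x
    using measurable_section1[OF Gm that] measurable_section2[OF Gm that] unfolding P_def by auto
  have "(\<integral>\<^sup>+x. \<integral>\<^sup>+t. ennreal (G x t * (F x * F t)) \<partial>M \<partial>M) \<le> (\<integral>\<^sup>+x. \<integral>\<^sup>+t. (P x t + P t x) \<partial>M \<partial>M)"
    by (intro nn_integral_mono pt)
  also have "\<dots> = (\<integral>\<^sup>+x. (\<integral>\<^sup>+t. P x t \<partial>M) + (\<integral>\<^sup>+t. P t x \<partial>M) \<partial>M)"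
    by (intro nn_integral_cong nn_integral_add sect)
  also have "\<dots> = (\<integral>\<^sup>+x. \<integral>\<^sup>+t. P x t \<partial>M \<partial>M) + (\<integral>\<^sup>+x. \<integral>\<^sup>+t. P t x \<partial>M \<partial>M)"
    by (rule nn_integral_add[OF sigma_finite_measure.borel_measurable_nn_integral[OF M Pm]
          sigma_finite_measure.borel_measurable_nn_integral[OF M Pm']])
  also have "(\<integral>\<^sup>+x. \<integral>\<^sup>+t. P t x \<partial>M \<partial>M) = (\<integral>\<^sup>+x. \<integral>\<^sup>+t. P x t \<partial>M \<partial>M)"
    by (rule Fubini'[OF Pm])
  also have "(\<integral>\<^sup>+x. \<integral>\<^sup>+t. P x t \<partial>M \<partial>M) + (\<integral>\<^sup>+x. \<integral>\<^sup>+t. P x t \<partial>M \<partial>M)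
      \<le> (\<integral>\<^sup>+x. ennreal (1/2 * (F x)^2) \<partial>M) + (\<integral>\<^sup>+x. ennreal (1/2 * (F x)^2) \<partial>M)"
    by (intro add_mono PP)
  also have "\<dots> = (\<integral>\<^sup>+x. ennreal (1/2 * (F x)^2) + ennreal (1/2 * (F x)^2) \<partial>M)"
    by (intro nn_integral_add[symmetric]) auto
  also have "\<dots> = (\<integral>\<^sup>+x. ennreal ((F x)^2) \<partial>M)"
    by (intro nn_integral_cong) (subst ennreal_plus[symmetric], auto)
  finally show ?thesis .
qed

section \<open>Domination of the Hankel kernel, plain and damped\<close>

lemma hankel_measurable:
  assumes \<alpha>: "\<alpha> > -1" and p: "p \<in> borel_measurable borel"
  shows "case_prod (\<lambda>s x. p s * hankel \<alpha> s x) \<in> borel_measurable (restrict_space lborel A \<Otimes>\<^sub>M restrict_space lborel B)"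
proof -
  have [measurable]: "(\<lambda>x. x) \<in> borel_measurable (restrict_space lborel S)" for S :: "real set"
    by (intro measurable_restrict_space1) simp
  have 1: "(\<lambda>z. fst z) \<in> borel_measurable (restrict_space lborel A \<Otimes>\<^sub>M restrict_space lborel B)"
    "(\<lambda>z. snd z) \<in> borel_measurable (restrict_space lborel A \<Otimes>\<^sub>M restrict_space lborel B)" by measurable
  have 2: "(\<lambda>z. bphi \<alpha> (fst z * snd z)) \<in> borel_measurable (restrict_space lborel A \<Otimes>\<^sub>M restrict_space lborel B)"
    by (rule measurable_compose[OF borel_measurable_times[OF 1] borel_bphi[OF \<alpha>]])
  have 3: "(\<lambda>z. p (fst z)) \<in> borel_measurable (restrict_space lborel A \<Otimes>\<^sub>M restrict_space lborel B)"
    by (rule measurable_compose[OF 1(1) p])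
  show ?thesis
    unfolding hankel_def case_prod_unfold using 1 2 3 by measurable
qed

lemma kern_hankel:
  assumes \<alpha>: "\<alpha> > -1"
  shows "kern (interval_lborel R) (pw \<alpha>) (interval_lborel \<zeta>) (pw \<alpha>) (hankel \<alpha>)"
proof -
  obtain C where C: "0 \<le> C" "\<And>y. 0 \<le> y \<Longrightarrow> \<bar>bphi \<alpha> y\<bar> \<le> C * exp (1 * y)"
    using bphi_exp_bound[OF \<alpha>, of 1] by auto
  have "\<bar>hankel \<alpha> s x\<bar> \<le> (C * exp (R * \<zeta>)) * pw \<alpha> s * pw \<alpha> x" if s: "s \<in> {0<..<R}" and x: "x \<in> {0<..<\<zeta>}" for s x
  proof -
    have "\<bar>bphi \<alpha> (s * x)\<bar> \<le> C * exp (1 * (s * x))" using s x by (intro C) auto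
    also have "\<dots> \<le> C * exp (R * \<zeta>)"
      using s x C(1) by (intro mult_left_mono) (auto intro!: mult_mono)
    finally have "\<bar>bphi \<alpha> (s * x)\<bar> / 2 \<le> C * exp (R * \<zeta>)" by linarith
    from mult_left_mono[OF this, of "pw \<alpha> s * pw \<alpha> x"] show ?thesis
      by (simp add: hankel_def abs_mult mult_ac)
  qed
  then show ?thesis
    unfolding kern_def using hankel_measurable[OF \<alpha>, of "\<lambda>_. 1" "{0<..<R}" "{0<..<\<zeta>}"] C(1)
    by (auto intro!: exI[of _ "C * exp (R * \<zeta>)"])
qed

text \<open>Of the rate e / 2, one half pays for the growth of phi(s x), taken with rate e / (4
  zeta) and x < zeta; the other half remains as the square-integrable weight on the
  half-line.\<close>

lemma kern_hankel_exp:
  assumes \<alpha>: "\<alpha> > -1" and e: "0 < e" and \<zeta>: "0 < \<zeta>"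
  shows "kern halfline (\<lambda>s. exp (- (e / 4 * s)) * pw \<alpha> s) (interval_lborel \<zeta>) (pw \<alpha>) (hankel_exp \<alpha> e)"
proof -
  obtain C where C: "0 \<le> C" "\<And>y. 0 \<le> y \<Longrightarrow> \<bar>bphi \<alpha> y\<bar> \<le> C * exp (e / (4 * \<zeta>) * y)"
    using bphi_exp_bound[OF \<alpha>, of "e / (4 * \<zeta>)"] e \<zeta> by auto
  have "\<bar>hankel_exp \<alpha> e s x\<bar> \<le> C * (exp (- (e / 4 * s)) * pw \<alpha> s) * pw \<alpha> x" if s: "s \<in> {0<..}" and x: "x \<in> {0<..<\<zeta>}" for s x
  proof -
    have "\<bar>bphi \<alpha> (s * x)\<bar> \<le> C * exp (e / (4 * \<zeta>) * (s * x))" using s x by (intro C) auto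
    also have "e / (4 * \<zeta>) * (s * x) \<le> e / (4 * \<zeta>) * (s * \<zeta>)"
      using s x e \<zeta> by (intro mult_left_mono) auto
    also have "e / (4 * \<zeta>) * (s * \<zeta>) = e / 4 * s" using \<zeta> by simp
    finally have "\<bar>bphi \<alpha> (s * x)\<bar> \<le> C * exp (e / 4 * s)" using C(1) by (simp add: mult_left_mono)
    moreover have "0 \<le> C * exp (e / 4 * s)" using C(1) by simp
    ultimately have "\<bar>bphi \<alpha> (s * x)\<bar> / 2 \<le> C * exp (e / 4 * s)" by linarith
    from mult_left_mono[OF this, of "exp (- (e / 2 * s)) * (pw \<alpha> s * pw \<alpha> x)"]
    have "\<bar>hankel_exp \<alpha> e s x\<bar> \<le> C * ((exp (- (e / 2 * s)) * exp (e / 4 * s)) * pw \<alpha> s) * pw \<alpha> x"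
      by (simp add: hankel_exp_def hankel_def abs_mult mult_ac)
    also have "exp (- (e / 2 * s)) * exp (e / 4 * s) = exp (- (e / 4 * s))"
      by (simp add: exp_add[symmetric])
    finally show ?thesis .
  qed
  then show ?thesis
    unfolding kern_def hankel_exp_def[abs_def] using hankel_measurable[OF \<alpha>, of "\<lambda>s. exp (- (e / 2 * s))" "{0<..}" "{0<..<\<zeta>}"] C(1)
    by (auto intro!: exI[of _ C])
qed

lemma weight_halfline:
  assumes \<alpha>: "\<alpha> > -1" and e: "0 < e"
  shows "weight halfline (\<lambda>s. exp (- (e / 4 * s)) * pw \<alpha> s)"
proof -
  have "(norm (exp (- (e / 4 * s)) * pw \<alpha> s))^2 = s powr (\<alpha> + 1 - 1) * exp (- (e / 2 * s))" for s
  proof -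
    have "(norm (exp (- (e / 4 * s)) * pw \<alpha> s))^2 = (exp (- (e / 4 * s)))^2 * (pw \<alpha> s)^2"
      by (simp add: power_mult_distrib)
    also have "(exp (- (e / 4 * s)))^2 = exp (- (e / 2 * s))"
      by (simp add: power2_eq_square exp_add[symmetric])
    finally show ?thesis by (simp add: pw_square)
  qed
  then show ?thesis
    unfolding weight_def sq_def
    using has_integral_Gamma_halfline[of "\<alpha> + 1" "e / 2"] \<alpha> e
    by (auto simp: sigma_finite_halfline has_bochner_integral_iff intro!: borel_halfline)
qed

text \<open>The squared norm of the transform is the quadratic form of the Weber kernel. As that
  kernel is nonnegative, f may be replaced by its pointwise norm, to which Schur's test with
  x^(alpha/2) applies.\<close>

lemma hankel_exp_contraction:
  fixes f :: "real \<Rightarrow> 'b::euclidean_space"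
  assumes \<alpha>: "\<alpha> > -1" and e: "0 < e" and \<zeta>: "0 < \<zeta>" and f: "sq (interval_lborel \<zeta>) f"
  shows "(nrm halfline (kint (interval_lborel \<zeta>) (hankel_exp \<alpha> e) f))^2 \<le> (nrm (interval_lborel \<zeta>) f)^2"
proof -
  let ?M = "interval_lborel \<zeta>" and ?b = "\<lambda>s. exp (- (e / 4 * s)) * pw \<alpha> s"
  define G where "G = kcomp halfline (\<lambda>x s. hankel_exp \<alpha> e s x) (hankel_exp \<alpha> e)"
  have h: "kern halfline ?b ?M (pw \<alpha>) (hankel_exp \<alpha> e)" by (rule kern_hankel_exp[OF \<alpha> e \<zeta>])
  have wN: "weight halfline ?b" by (rule weight_halfline[OF \<alpha> e])
  have wM: "weight ?M (pw \<alpha>)" by (rule weight_pw[OF \<alpha> \<zeta>])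
  have hT: "kern ?M (pw \<alpha>) halfline ?b (\<lambda>x s. hankel_exp \<alpha> e s x)" by (rule kern_transpose[OF h])
  have Gk: "kern ?M (pw \<alpha>) ?M (pw \<alpha>) G" unfolding G_def by (rule kern_kcomp[OF hT h wM wN wM])
  have G_eq: "G x t = (LINT s|halfline. hankel_exp \<alpha> e s x * hankel_exp \<alpha> e s t)" for x t
    by (simp add: G_def kcomp_def)
  have G0: "0 \<le> G x t" if "x \<in> space ?M" "t \<in> space ?M" for x t
  proof -
    have "0 < x" "0 < t" using that by auto
    then show ?thesis
      unfolding G_eq weber_integral[OF \<alpha> \<open>0 < x\<close> \<open>0 < t\<close> e] using e
      by (intro mult_nonneg_nonneg weber_I_nonneg[OF \<alpha>]) auto
  qed
  have Gs: "G x t = G t x" for x t by (simp add: G_eq mult.commute)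
  \<comment> \<open>\<open>weber_mass\<close> is an identity on the whole half-line; restricting its
    nonnegative integrand to (0, zeta) leaves an inequality.\<close>
  have mass: "(\<integral>\<^sup>+t. ennreal (G x t * pw \<alpha> t) \<partial>?M) \<le> ennreal (pw \<alpha> x)" if "x \<in> space ?M" for x
  proof -
    have "(\<integral>\<^sup>+t. ennreal (G x t * pw \<alpha> t) \<partial>?M) = (\<integral>\<^sup>+t. ennreal (G x t * pw \<alpha> t) * indicator {0<..<\<zeta>} t \<partial>lborel)"
      by (rule nn_integral_restrict_space) simp
    also have "\<dots> \<le> (\<integral>\<^sup>+t. ennreal (G x t * pw \<alpha> t) * indicator {0<..} t \<partial>lborel)"
      by (intro nn_integral_mono) (auto simp: indicator_def)
    also have "\<dots> = (\<integral>\<^sup>+t. ennreal (G x t * pw \<alpha> t) \<partial>halfline)"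
      by (rule nn_integral_restrict_space[symmetric]) simp
    also have "\<dots> = ennreal (pw \<alpha> x)"
      unfolding G_eq by (rule weber_mass[OF \<alpha> _ e]) (use that in auto)
    finally show ?thesis .
  qed
  let ?F = "\<lambda>x. norm (f x)"
  have F: "sq ?M ?F" by (rule sq_norm[OF f])
  have Tf: "sq halfline (kint ?M (hankel_exp \<alpha> e) f)" by (rule kint_sq[OF h wN wM f])
  have GF: "sq ?M (kint ?M G ?F)" by (rule kint_sq[OF Gk wM wM F])
  have "(nrm halfline (kint ?M (hankel_exp \<alpha> e) f))^2 = inn halfline (kint ?M (hankel_exp \<alpha> e) f) (kint ?M (hankel_exp \<alpha> e) f)"
    by (simp add: inn_self)
  also have "\<dots> = inn ?M f (kint halfline (\<lambda>x s. hankel_exp \<alpha> e s x) (kint ?M (hankel_exp \<alpha> e) f))"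
    by (rule kint_adjoint[OF h wN wM Tf f])
  also have "\<dots> = inn ?M f (kint ?M G f)"
    unfolding inn_def G_def using kint_kint[OF hT h wN wM _ f]
    by (intro Bochner_Integration.integral_cong) auto
  also have "\<dots> \<le> (LINT x|?M. ?F x * kint ?M G ?F x)"
    unfolding inn_def
  proof (rule integral_mono[OF sq_integrable_inner[OF f kint_sq[OF Gk wM wM f]]])
    show "integrable ?M (\<lambda>x. ?F x * kint ?M G ?F x)"
      using sq_integrable_inner[OF F GF] by simp
    fix x assume x: "x \<in> space ?M"
    have "norm (kint ?M G f x) \<le> (LINT t|?M. norm (G x t *\<^sub>R f t))"
      unfolding kint_def by (rule integral_norm_bound)
    also have "\<dots> = kint ?M G ?F x"
      unfolding kint_def using G0[OF x] by (intro Bochner_Integration.integral_cong) auto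
    finally have "norm (f x) * norm (kint ?M G f x) \<le> ?F x * kint ?M G ?F x"
      by (intro mult_left_mono) auto
    then show "f x \<bullet> kint ?M G f x \<le> ?F x * kint ?M G ?F x"
      using norm_cauchy_schwarz[of "f x" "kint ?M G f x"] by linarith
  qed
  also have "\<dots> \<le> (nrm ?M f)^2"
  proof -
    have kn: "0 \<le> kint ?M G ?F x" if "x \<in> space ?M" for x
      unfolding kint_def using G0[OF that] by (intro integral_nonneg_AE AE_I2) auto
    have "ennreal (LINT x|?M. ?F x * kint ?M G ?F x) = (\<integral>\<^sup>+x. ennreal (?F x * kint ?M G ?F x) \<partial>?M)"
      using sq_integrable_inner[OF F GF] kn by (intro nn_integral_eq_integral[symmetric] AE_I2) auto
    also have "\<dots> = (\<integral>\<^sup>+x. \<integral>\<^sup>+t. ennreal (G x t * (?F x * ?F t)) \<partial>?M \<partial>?M)"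
    proof (intro nn_integral_cong)
      fix x assume x: "x \<in> space ?M"
      have i: "integrable ?M (\<lambda>t. G x t *\<^sub>R ?F t)" by (rule kint_integrable[OF Gk wM x F])
      have "?F x * kint ?M G ?F x = (LINT t|?M. ?F x * (G x t *\<^sub>R ?F t))"
        unfolding kint_def by (rule integral_mult_right_zero[symmetric])
      also have "ennreal \<dots> = (\<integral>\<^sup>+t. ennreal (?F x * (G x t *\<^sub>R ?F t)) \<partial>?M)"
        using G0[OF x] by (intro nn_integral_eq_integral[symmetric] integrable_mult_right i AE_I2) auto
      finally show "ennreal (?F x * kint ?M G ?F x) = (\<integral>\<^sup>+t. ennreal (G x t * (?F x * ?F t)) \<partial>?M)"
        by (simp add: mult.left_commute)
    qed
    also have "\<dots> \<le> (\<integral>\<^sup>+x. ennreal ((?F x)^2) \<partial>?M)"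
    proof (rule Schur_test[of ?M "pw \<alpha>"])
      show "pw \<alpha> \<in> borel_measurable ?M" using wM by (simp add: weight_def sq_def)
      show "?F \<in> borel_measurable ?M" using F by (simp add: sq_def)
    qed (use sigma_finite_interval kern_measurable[OF Gk] G0 Gs mass in auto)
    also have "\<dots> = ennreal ((nrm ?M f)^2)"
      unfolding nrm_sq using sq_integrable[OF f] by (intro nn_integral_eq_integral) auto
    finally show ?thesis by (simp add: ennreal_le_iff)
  qed
  finally show ?thesis .
qed

text \<open>On (0,R) the damping of the squared transform is at least exp(-e R), which tends to 1 as
  \<open>e\<close> tends to 0. The length \<open>R\<close> is free because strictness compares R = 1
  with R = 2.\<close>

lemma hankel_contraction:
  fixes f :: "real \<Rightarrow> 'b::euclidean_space"
  assumes \<alpha>: "\<alpha> > -1" and R: "0 < R" and \<zeta>: "0 < \<zeta>" and f: "sq (interval_lborel \<zeta>) f"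
  shows "nrm (interval_lborel R) (kint (interval_lborel \<zeta>) (hankel \<alpha>) f) \<le> nrm (interval_lborel \<zeta>) f"
proof -
  let ?M = "interval_lborel \<zeta>"
  define A where "A = (nrm (interval_lborel R) (kint ?M (hankel \<alpha>) f))^2"
  define B where "B = (nrm ?M f)^2"
  have wM: "weight ?M (pw \<alpha>)" by (rule weight_pw[OF \<alpha> \<zeta>])
  have step: "exp (- (e * R)) * A \<le> B" if e: "0 < e" for e
  proof -
    have ke: "kint ?M (hankel_exp \<alpha> e) f s = exp (- (e / 2 * s)) *\<^sub>R kint ?M (hankel \<alpha>) f s" for s
      unfolding kint_def hankel_exp_def by (simp flip: scaleR_scaleR)
    have n2: "(norm (kint ?M (hankel_exp \<alpha> e) f s))^2 = exp (- (e * s)) * (norm (kint ?M (hankel \<alpha>) f s))^2" for s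
      unfolding ke by (simp add: power_mult_distrib) (simp add: power2_eq_square exp_add[symmetric])
    have i1: "integrable lborel (\<lambda>s. indicator {0<..<R} s *\<^sub>R (norm (kint ?M (hankel \<alpha>) f s))^2)"
      using sq_integrable[OF kint_sq[OF kern_hankel[OF \<alpha>] weight_pw[OF \<alpha> R] wM f]]
      unfolding integrable_interval set_integrable_def .
    have i2: "integrable lborel (\<lambda>s. indicator {0<..} s *\<^sub>R (norm (kint ?M (hankel_exp \<alpha> e) f s))^2)"
      using sq_integrable[OF kint_sq[OF kern_hankel_exp[OF \<alpha> e \<zeta>] weight_halfline[OF \<alpha> e] wM f]]
      by (simp add: integrable_restrict_space)
    have "exp (- (e * R)) * A = (LINT s|lborel. exp (- (e * R)) * (indicator {0<..<R} s *\<^sub>R (norm (kint ?M (hankel \<alpha>) f s))^2))"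
      unfolding A_def nrm_sq integral_interval set_lebesgue_integral_def by (rule integral_mult_right_zero[symmetric])
    also have "\<dots> \<le> (LINT s|lborel. indicator {0<..} s *\<^sub>R (norm (kint ?M (hankel_exp \<alpha> e) f s))^2)"
    proof (rule integral_mono[OF integrable_mult_right[OF i1] i2])
      fix s
      show "exp (- (e * R)) * (indicator {0<..<R} s *\<^sub>R (norm (kint ?M (hankel \<alpha>) f s))^2) \<le> indicator {0<..} s *\<^sub>R (norm (kint ?M (hankel_exp \<alpha> e) f s))^2"
        unfolding n2 using e by (auto simp: indicator_def intro!: mult_right_mono)
    qed
    also have "\<dots> = (nrm halfline (kint ?M (hankel_exp \<alpha> e) f))^2"
      unfolding nrm_sq by (simp add: integral_restrict_space)
    also have "\<dots> \<le> B" unfolding B_def by (rule hankel_exp_contraction[OF \<alpha> e \<zeta> f])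
    finally show ?thesis .
  qed
  have "((\<lambda>e. exp (- (e * R)) * A) \<longlongrightarrow> exp (- (0 * R)) * A) (at_right 0)"
    by (intro tendsto_intros)
  then have "exp (- (0 * R)) * A \<le> B"
    by (rule tendsto_upperbound) (auto simp: eventually_at_right_field intro!: exI[of _ 1] step)
  then have "A \<le> B" by simp
  then show ?thesis
    unfolding A_def B_def by (rule power2_le_imp_le) (rule nrm_nonneg)
qed

text \<open>If $f$ lives on $(0,\zeta)$ and its Hankel transform has full norm on $(0,1)$, then the
  transform vanishes on $(1,2)$.  Being a power times an entire function, it vanishes identically.\<close>

lemma hankel_strict:
  fixes f :: "real \<Rightarrow> real"
  assumes \<alpha>: "\<alpha> > -1" and \<zeta>: "0 < \<zeta>" and f: "sq (interval_lborel \<zeta>) f"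
    and le: "nrm (interval_lborel \<zeta>) f \<le> nrm (interval_lborel 1) (kint (interval_lborel \<zeta>) (hankel \<alpha>) f)"
  shows "nrm (interval_lborel \<zeta>) f = 0"
proof -
  let ?M = "interval_lborel \<zeta>"
  define T where "T = kint ?M (hankel \<alpha>) f"
  have wM: "weight ?M (pw \<alpha>)" by (rule weight_pw[OF \<alpha> \<zeta>])
  have Wsq: "sq ?M (pw \<alpha>)" using wM by (simp add: weight_def)
  have fm: "f \<in> borel_measurable ?M" using f by (rule sq_measurable)
  define pf where "pf x = pw \<alpha> x * f x" for x
  have pfm: "pf \<in> borel_measurable ?M"
    unfolding pf_def using fm Wsq by (auto simp: sq_def)
  have pfi: "integrable ?M pf"
    by (rule sq_integrable_bound[OF Wsq f pfm, where C = 1]) (simp add: pf_def abs_mult)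
  \<comment> \<open>Expanding phi(s x) in powers of x makes these moments, multiplied by
    \<open>bcoef\<close>, the coefficients of the entire factor of the transform. They grow at most
    like zeta^m.\<close>
  define \<mu> where "\<mu> m = (LINT x|?M. pf x * x ^ m)" for m :: nat
  define B where "B = (LINT x|?M. \<bar>pf x\<bar>)"
  have mi: "integrable ?M (\<lambda>x. pf x * x ^ m)" and mb: "(LINT x|?M. \<bar>pf x * x ^ m\<bar>) \<le> B * \<zeta> ^ m" for m
  proof -
    have bd: "\<bar>pf x * x ^ m\<bar> \<le> \<bar>pf x\<bar> * \<zeta> ^ m" if "x \<in> space ?M" for x
      using that by (auto simp: abs_mult power_abs intro!: mult_left_mono power_mono)
    have xm: "(\<lambda>x. x ^ m) \<in> borel_measurable ?M" by (intro borel_interval) measurable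
    show i: "integrable ?M (\<lambda>x. pf x * x ^ m)"
    proof (rule Bochner_Integration.integrable_bound)
      show "integrable ?M (\<lambda>x. \<bar>pf x\<bar> * \<zeta> ^ m)" using pfi by auto
      show "(\<lambda>x. pf x * x ^ m) \<in> borel_measurable ?M" using pfm xm by auto
      show "AE x in ?M. norm (pf x * x ^ m) \<le> norm (\<bar>pf x\<bar> * \<zeta> ^ m)"
        using bd \<zeta> by (intro AE_I2) (auto simp: abs_mult)
    qed
    have "(LINT x|?M. \<bar>pf x * x ^ m\<bar>) \<le> (LINT x|?M. \<bar>pf x\<bar> * \<zeta> ^ m)"
      using pfi i bd by (intro integral_mono) auto
    then show "(LINT x|?M. \<bar>pf x * x ^ m\<bar>) \<le> B * \<zeta> ^ m" by (simp add: B_def)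
  qed
  have B0: "0 \<le> B" unfolding B_def by simp
  have \<mu>b: "\<bar>\<mu> m\<bar> \<le> B * \<zeta> ^ m" for m
    unfolding \<mu>_def by (rule order_trans[OF integral_abs_bound mb])
  have summA: "summable (\<lambda>m. \<bar>bcoef \<alpha> m * \<mu> m\<bar> * r ^ m)" if r: "0 \<le> r" for r :: real
  proof (rule summable_comparison_test')
    show "summable (\<lambda>m. B * (\<bar>bcoef \<alpha> m\<bar> * norm (\<zeta> * r) ^ m))"
      by (intro summable_mult summable_bcoef_abs \<alpha>)
    fix m
    have "norm (\<bar>bcoef \<alpha> m * \<mu> m\<bar> * r ^ m) = \<bar>bcoef \<alpha> m\<bar> * \<bar>\<mu> m\<bar> * r ^ m"
      using r by (simp add: abs_mult)
    also have "\<dots> \<le> \<bar>bcoef \<alpha> m\<bar> * (B * \<zeta> ^ m) * r ^ m"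
      using r by (intro mult_left_mono mult_right_mono \<mu>b) auto
    also have "\<dots> = B * (\<bar>bcoef \<alpha> m\<bar> * norm (\<zeta> * r) ^ m)"
      using \<zeta> r by (simp add: power_mult_distrib)
    finally show "norm (\<bar>bcoef \<alpha> m * \<mu> m\<bar> * r ^ m) \<le> B * (\<bar>bcoef \<alpha> m\<bar> * norm (\<zeta> * r) ^ m)" .
  qed
  have summR: "summable (\<lambda>m. (bcoef \<alpha> m * \<mu> m) * s ^ m)" for s :: real
    by (rule summable_norm_cancel) (use summA[of "\<bar>s\<bar>"] in \<open>simp add: abs_mult power_abs\<close>)
  have summC: "summable (\<lambda>m. complex_of_real (bcoef \<alpha> m * \<mu> m) * z ^ m)" for z
    by (rule summable_norm_cancel) (use summA[of "norm z"] in \<open>simp add: norm_mult norm_power abs_mult\<close>)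
  define P where "P s = (\<Sum>m. (bcoef \<alpha> m * \<mu> m) * s ^ m)" for s :: real
  define PC where "PC z = (\<Sum>m. of_real (bcoef \<alpha> m * \<mu> m) * z ^ m)" for z :: complex
  have T_eq: "T s = pw \<alpha> s / 2 * P s" for s
  proof -
    let ?f = "\<lambda>m x. bcoef \<alpha> m * s ^ m * (pf x * x ^ m)"
    have "T s = (LINT x|?M. pw \<alpha> s / 2 * (\<Sum>m. ?f m x))"
      unfolding T_def kint_def
    proof (intro Bochner_Integration.integral_cong refl)
      fix x
      have "(\<Sum>m. ?f m x) = (\<Sum>m. pf x * (bcoef \<alpha> m * (s * x) ^ m))"
        by (simp add: power_mult_distrib mult_ac)
      also have "\<dots> = pf x * bphi \<alpha> (s * x)"
        unfolding bphi_def by (rule suminf_mult[OF summable_bcoef[OF \<alpha>]])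
      finally show "hankel \<alpha> s x *\<^sub>R f x = pw \<alpha> s / 2 * (\<Sum>m. ?f m x)"
        by (simp add: hankel_def pf_def)
    qed
    also have "\<dots> = pw \<alpha> s / 2 * (LINT x|?M. (\<Sum>m. ?f m x))" by (rule integral_mult_right_zero)
    also have "(LINT x|?M. (\<Sum>m. ?f m x)) = (\<Sum>m. LINT x|?M. ?f m x)"
    proof (rule integral_suminf)
      show "integrable ?M (?f m)" for m using mi by (intro integrable_mult_right)
      show "AE x in ?M. summable (\<lambda>m. norm (?f m x))"
      proof (rule AE_I2)
        fix x
        have "summable (\<lambda>m. \<bar>pf x\<bar> * (\<bar>bcoef \<alpha> m\<bar> * norm (s * x) ^ m))"
          by (intro summable_mult summable_bcoef_abs \<alpha>)
        then show "summable (\<lambda>m. norm (?f m x))"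
          by (simp add: abs_mult power_abs power_mult_distrib mult_ac)
      qed
      show "summable (\<lambda>m. LINT x|?M. norm (?f m x))"
      proof (rule summable_comparison_test')
        show "summable (\<lambda>m. B * (\<bar>bcoef \<alpha> m\<bar> * norm (\<zeta> * norm s) ^ m))"
          by (intro summable_mult summable_bcoef_abs \<alpha>)
        fix m
        have "(LINT x|?M. norm (?f m x)) = \<bar>bcoef \<alpha> m * s ^ m\<bar> * (LINT x|?M. \<bar>pf x * x ^ m\<bar>)"
          unfolding real_norm_def abs_mult[of "bcoef \<alpha> m * s ^ m"] by (rule integral_mult_right_zero)
        also have "\<dots> \<le> \<bar>bcoef \<alpha> m * s ^ m\<bar> * (B * \<zeta> ^ m)"
          by (intro mult_left_mono mb) auto
        also have "\<dots> = B * (\<bar>bcoef \<alpha> m\<bar> * norm (\<zeta> * norm s) ^ m)"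
          using \<zeta> by (simp add: abs_mult power_abs power_mult_distrib)
        finally show "norm (LINT x|?M. norm (?f m x)) \<le> B * (\<bar>bcoef \<alpha> m\<bar> * norm (\<zeta> * norm s) ^ m)" by simp
      qed
    qed
    also have "(\<Sum>m. LINT x|?M. ?f m x) = P s"
      unfolding P_def \<mu>_def integral_mult_right_zero by (simp only: mult_ac)

    finally show ?thesis .
  qed
  have T0: "AE s in lborel. s \<in> {1<..<2} \<longrightarrow> T s = 0"
  proof -
    have sqT: "sq (interval_lborel R) T" if "0 < R" for R
      unfolding T_def by (rule kint_sq[OF kern_hankel[OF \<alpha>] weight_pw[OF \<alpha> that] wM f])
    have i: "integrable lborel (\<lambda>s. indicator {0<..<R} s *\<^sub>R (norm (T s))^2)" if "0 < R" for R
      using sq_integrable[OF sqT[OF that]] unfolding integrable_interval set_integrable_def .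
    have n: "(nrm (interval_lborel R) T)^2 = (LINT s|lborel. indicator {0<..<R} s *\<^sub>R (norm (T s))^2)" for R
      unfolding nrm_sq integral_interval set_lebesgue_integral_def ..
    \<comment> \<open>The norm over (0,2) is at most that of \<open>f\<close>, hence at most the
      norm over (0,1); nothing is left for the rest of the interval.\<close>
    have "(nrm (interval_lborel 2) T)^2 \<le> (nrm (interval_lborel 1) T)^2"
      using hankel_contraction[OF \<alpha> _ \<zeta> f, of 2] le unfolding T_def[symmetric]
      by (intro power_mono nrm_nonneg) auto
    then have "(LINT s|lborel. indicator {0<..<2} s *\<^sub>R (norm (T s))^2 - indicator {0<..<1} s *\<^sub>R (norm (T s))^2) \<le> 0"
      unfolding n using i[of 2] i[of 1] by simp
    moreover have nn: "0 \<le> indicator {0<..<2} s *\<^sub>R (norm (T s))^2 - indicator {0<..<1} s *\<^sub>R (norm (T s))^2" for s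
      by (auto simp: indicator_def)
    ultimately have "(LINT s|lborel. indicator {0<..<2} s *\<^sub>R (norm (T s))^2 - indicator {0<..<1} s *\<^sub>R (norm (T s))^2) = 0"
      by (intro antisym integral_nonneg_AE AE_I2 nn)

    then have "AE s in lborel. indicator {0<..<2} s *\<^sub>R (norm (T s))^2 - indicator {0<..<1} s *\<^sub>R (norm (T s))^2 = 0"
      using integral_nonneg_eq_0_iff_AE[OF Bochner_Integration.integrable_diff[OF i[of 2] i[of 1]]] nn by auto
    then show ?thesis
      by eventually_elim (auto simp: indicator_def)
  qed
  have derP: "(P has_real_derivative (\<Sum>m. diffs (\<lambda>m. bcoef \<alpha> m * \<mu> m) m * s ^ m)) (at s)" for s
    unfolding P_def[abs_def] by (rule termdiffs_strong_converges_everywhere[OF summR])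
  have contP: "continuous_on UNIV P"
    by (meson DERIV_isCont derP continuous_at_imp_continuous_on)
  \<comment> \<open>\<open>T\<close> is known to vanish only almost everywhere on (1,2), but the set
    where the continuous \<open>P\<close> is nonzero is open, and an open null set is empty.\<close>
  define U where "U = {s \<in> {1<..<2}. P s \<noteq> 0}"
  have "open U"
  proof -
    have "U = {1<..<2} \<inter> P -` (- {0})" by (auto simp: U_def)
    moreover have "open (P -` (- {0}))" using contP by (intro open_vimage) auto
    ultimately show ?thesis by auto
  qed
  moreover have "negligible U"
  proof -
    have "AE s in lebesgue. s \<notin> U"
      using T0 by (intro AE_completion, eventually_elim) (auto simp: U_def T_eq)
    moreover have "U \<in> sets lebesgue"
      using \<open>open U\<close> by (intro sets_completionI_sets) (simp add: borel_open)
    ultimately have "U \<in> null_sets lebesgue" by (simp add: AE_iff_null_sets)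

    then show ?thesis by (simp add: negligible_iff_null_sets)
  qed
  ultimately have "U = {}" using open_not_negligible by blast
  then have P0: "P s = 0" if "s \<in> {1<..<2}" for s using that by (auto simp: U_def)
  have PCP: "PC (of_real s) = of_real (P s)" for s
    unfolding PC_def P_def using suminf_of_real[OF summR[of s], where 'a = complex] by simp
  have hol: "PC holomorphic_on UNIV"
    unfolding PC_def[abs_def] holomorphic_on_def field_differentiable_def
    using termdiffs_strong_converges_everywhere[OF summC] by blast
  have "PC z = 0" for z
  proof (rule analytic_continuation[OF hol, of "of_real ` {1<..<2}" "of_real (3/2)"])
    show "complex_of_real (3/2) islimpt of_real ` {1<..<2}"
    proof (rule islimpt_isCont_image[where f = of_real])
      show "(3/2::real) islimpt {1<..<2}" by (rule interior_limit_point) simp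
      show "\<forall>\<^sub>F y in at (3/2). complex_of_real y \<noteq> of_real (3/2)"
        unfolding of_real_eq_iff eventually_at_filter by simp
    qed auto
  qed (use PCP P0 in auto)
  then have "P s = 0" for s using PCP[of s] by simp
  then have "T s = 0" for s by (simp add: T_eq)
  \<comment> \<open>With T = 0 the hypothesis \<open>le\<close> bounds the norm of \<open>f\<close>
    by 0.\<close>
  then have "nrm (interval_lborel 1) T = 0" by (simp add: nrm_def)
  then show ?thesis using le nrm_nonneg[of ?M f] by (simp add: T_def)
qed

section \<open>The Bessel kernel operator\<close>

text \<open>Let K have the kernel \<open>hankel_sq\<close>. The square of the norm of K f is the
  inner product of T f with T (K f), so contractivity of T makes K f no longer than T f. A function
  not shortened by K is then not shortened by T either, which is the situation of
  \<open>hankel_strict\<close>.\<close>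

lemma hankel_sq_strict_contraction:
  assumes \<alpha>: "\<alpha> > -1" and \<zeta>: "0 < \<zeta>"
  obtains q where "0 < q" "q < 1"
    "\<And>f::real \<Rightarrow> real. sq (interval_lborel \<zeta>) f \<Longrightarrow>
       nrm (interval_lborel \<zeta>) (kint (interval_lborel \<zeta>) (hankel_sq \<alpha>) f) \<le> q * nrm (interval_lborel \<zeta>) f"
proof -
  let ?M = "interval_lborel \<zeta>" and ?N = "interval_lborel 1"
  have wM: "weight ?M (pw \<alpha>)" and wN: "weight ?N (pw \<alpha>)" by (rule weight_pw[OF \<alpha>]; use \<zeta> in simp)+
  have h: "kern ?N (pw \<alpha>) ?M (pw \<alpha>) (hankel \<alpha>)" by (rule kern_hankel[OF \<alpha>])
  have hT: "kern ?M (pw \<alpha>) ?N (pw \<alpha>) (\<lambda>x s. hankel \<alpha> s x)" by (rule kern_transpose[OF h])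
  have K: "kern ?M (pw \<alpha>) ?M (pw \<alpha>) (hankel_sq \<alpha>)" unfolding hankel_sq_def by (rule kern_kcomp[OF hT h wM wN wM])
  have sym: "hankel_sq \<alpha> x y = hankel_sq \<alpha> y x" for x y by (simp add: hankel_sq_def kcomp_def mult.commute)
  have sqT: "sq ?N (kint ?M (hankel \<alpha>) f)" and sqK: "sq ?M (kint ?M (hankel_sq \<alpha>) f)"
    if "sq ?M f" for f :: "real \<Rightarrow> real"
    by (rule kint_sq[OF h wN wM that], rule kint_sq[OF K wM wM that])
  have contr: "nrm ?N (kint ?M (hankel \<alpha>) f) \<le> nrm ?M f" if "sq ?M f" for f :: "real \<Rightarrow> real"
    by (rule hankel_contraction[OF \<alpha> _ \<zeta> that]) simp
  have KT: "nrm ?M (kint ?M (hankel_sq \<alpha>) f) \<le> nrm ?N (kint ?M (hankel \<alpha>) f)" if f: "sq ?M f" for f :: "real \<Rightarrow> real"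
  proof -
    let ?K = "kint ?M (hankel_sq \<alpha>) f" and ?T = "kint ?M (hankel \<alpha>) f"
    have "(nrm ?M ?K)^2 = inn ?M (kint ?N (\<lambda>x s. hankel \<alpha> s x) ?T) ?K"
      unfolding inn_self[symmetric] hankel_sq_def using kint_kint[OF hT h wN wM _ f]
      by (intro Bochner_Integration.integral_cong[of ?M ?M] arg_cong2[where f = inner] refl
          | simp add: inn_def cong: Bochner_Integration.integral_cong)+
    also have "\<dots> = inn ?N ?T (kint ?M (hankel \<alpha>) ?K)"
      by (rule kint_adjoint[OF hT wM wN sqK[OF f] sqT[OF f]])
    also have "\<dots> \<le> nrm ?N ?T * nrm ?N (kint ?M (hankel \<alpha>) ?K)"
      using inn_le[OF sqT[OF f] sqT[OF sqK[OF f]]] by linarith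
    also have "\<dots> \<le> nrm ?N ?T * nrm ?M ?K"
      by (intro mult_left_mono contr sqK f nrm_nonneg)
    finally have "nrm ?M ?K * nrm ?M ?K \<le> nrm ?N ?T * nrm ?M ?K" by (simp add: power2_eq_square)
    then show ?thesis
      using nrm_nonneg[of ?M ?K] nrm_nonneg[of ?N ?T] by (cases "nrm ?M ?K = 0") (auto simp: mult_le_cancel_right)
  qed
  have "\<exists>q. 0 < q \<and> q < 1 \<and> (\<forall>f::real \<Rightarrow> real. sq ?M f \<longrightarrow> nrm ?M (kint ?M (hankel_sq \<alpha>) f) \<le> q * nrm ?M f)"
  proof (rule strict_contraction[OF wM K])
    show "hankel_sq \<alpha> x y = hankel_sq \<alpha> y x" for x y by (rule sym)
    show "nrm ?M (kint ?M (hankel_sq \<alpha>) f) \<le> nrm ?M f" if "sq ?M f" for f :: "real \<Rightarrow> real"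
      using KT[OF that] contr[OF that] by linarith
    show "nrm ?M f = 0" if "sq ?M f" "nrm ?M f \<le> nrm ?M (kint ?M (hankel_sq \<alpha>) f)" for f :: "real \<Rightarrow> real"
      by (rule hankel_strict[OF \<alpha> \<zeta> that(1)]) (use KT[OF that(1)] that(2) in linarith)
  qed
  then show ?thesis using that by blast
qed

lemma bessel_kernel_commute: "bessel_kernel \<alpha> \<gamma> x t = bessel_kernel \<alpha> \<gamma> t x"
proof -
  have "- (p - r) / c = - (r - p) / d" if "d = - c" for p r c d :: real
    using that by (simp add: diff_divide_distrib)
  moreover have "pi * (t - x) = - (pi * (x - t))" by (simp add: algebra_simps)
  ultimately show ?thesis unfolding bessel_kernel_def by blast

qed

lemma bessel_S_eq: "bessel_S \<alpha> \<gamma> \<zeta> = iop (interval_lborel \<zeta>) (bessel_kernel \<alpha> \<gamma>)"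
  by (auto simp: bessel_S_def iop_def kint_def fun_eq_iff scaleR_conv_of_real)

lemma bessel_K_eq: "bessel_K \<alpha> \<gamma> \<zeta> = kint (interval_lborel \<zeta>) (\<lambda>x t. - bessel_kernel \<alpha> \<gamma> x t)"
  by (auto simp: bessel_K_def bessel_S_def kint_def fun_eq_iff scaleR_conv_of_real)

theorem proposition6p16:
  fixes \<alpha> \<gamma> \<zeta> :: real
  assumes "\<alpha> > - 1 / 2" and "0 < \<gamma>" and "\<gamma> \<le> 1" and "0 < \<zeta>"
  shows "positive_op (interval_lborel \<zeta>) (bessel_S \<alpha> \<gamma> \<zeta>) \<and>
         invertible_op (interval_lborel \<zeta>) (bessel_S \<alpha> \<gamma> \<zeta>) \<and>
         factorable \<zeta> (bessel_S \<alpha> \<gamma> \<zeta>) \<and>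
         trace_class_op (interval_lborel \<zeta>) (bessel_K \<alpha> \<gamma> \<zeta>)"
proof -
  let ?M = "interval_lborel \<zeta>" and ?N = "interval_lborel 1"
  define k where "k x t = - bessel_kernel \<alpha> \<gamma> x t" for x t
  have \<alpha>: "\<alpha> > -1" using assms(1) by simp
  note \<gamma> = assms(2,3) and \<zeta> = assms(4)
  have wM: "weight ?M (pw \<alpha>)" and wN: "weight ?N (pw \<alpha>)" by (rule weight_pw[OF \<alpha>]; use \<zeta> in simp)+
  have h: "kern ?N (pw \<alpha>) ?M (pw \<alpha>) (hankel \<alpha>)" by (rule kern_hankel[OF \<alpha>])
  have hT: "kern ?M (pw \<alpha>) ?N (pw \<alpha>) (\<lambda>x s. hankel \<alpha> s x)" by (rule kern_transpose[OF h])
  have K: "kern ?M (pw \<alpha>) ?M (pw \<alpha>) (hankel_sq \<alpha>)" unfolding hankel_sq_def by (rule kern_kcomp[OF hT h wM wN wM])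
  have k_eq: "k x t = (if x = t then 0 else \<gamma> * hankel_sq \<alpha> x t)" if "x \<in> space ?M" "t \<in> space ?M" for x t
    using bessel_kernel_eq[OF \<alpha>, of x t \<gamma>] that \<gamma>(1) by (auto simp: k_def)
  have k_sym: "k x y = k y x" for x y by (simp add: k_def bessel_kernel_commute[of \<alpha> \<gamma> x y])
  have kk: "kern ?M (pw \<alpha>) ?M (pw \<alpha>) k"
  proof (rule kern_bound[OF kern_cmult[OF K, of \<gamma>]])
    have [measurable]: "(\<lambda>x. x) \<in> borel_measurable ?M" by (rule borel_interval) simp
    have [measurable]: "(\<lambda>z. hankel_sq \<alpha> (fst z) (snd z)) \<in> borel_measurable (?M \<Otimes>\<^sub>M ?M)"
      using kern_measurable[OF K] by (simp add: case_prod_unfold)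
    have "(\<lambda>z. if fst z = snd z then 0 else \<gamma> * hankel_sq \<alpha> (fst z) (snd z)) \<in> borel_measurable (?M \<Otimes>\<^sub>M ?M)"
      by measurable
    then show "case_prod k \<in> borel_measurable (?M \<Otimes>\<^sub>M ?M)"
      by (rule measurable_cong[THEN iffD1, rotated]) (auto simp: k_eq space_pair_measure)
    show "\<bar>k x y\<bar> \<le> \<bar>\<gamma> * hankel_sq \<alpha> x y\<bar>" if "x \<in> space ?M" "y \<in> space ?M" for x y
      by (simp add: k_eq[OF that])
  qed
  \<comment> \<open>\<open>k\<close> and gamma times \<open>hankel_sq\<close> can differ only for t
    = x, a single point of each row.\<close>
  have kint_k: "kint ?M k f x = \<gamma> *\<^sub>R kint ?M (hankel_sq \<alpha>) f x" if x: "x \<in> space ?M" and f: "f \<in> borel_measurable ?M"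
    for x and f :: "real \<Rightarrow> 'b::euclidean_space"
  proof -
    have "kint ?M k f x = (LINT t|?M. \<gamma> *\<^sub>R (hankel_sq \<alpha> x t *\<^sub>R f t))"
      unfolding kint_def
    proof (rule integral_cong_AE)
      show "AE t in ?M. k x t *\<^sub>R f t = \<gamma> *\<^sub>R (hankel_sq \<alpha> x t *\<^sub>R f t)"
        using AE_interval_neq[of x \<zeta>] AE_space[of ?M]
        by eventually_elim (use x in \<open>auto simp: k_eq\<close>)
    qed (use f measurable_section1[OF kern_measurable[OF kk] x] measurable_section1[OF kern_measurable[OF K] x] in auto)
    then show ?thesis unfolding kint_def by (simp del: scaleR_scaleR)
  qed
  obtain q where q: "0 < q" "q < 1" "\<And>f::real \<Rightarrow> real. sq ?M f \<Longrightarrow> nrm ?M (kint ?M (hankel_sq \<alpha>) f) \<le> q * nrm ?M f"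
    using hankel_sq_strict_contraction[OF \<alpha> \<zeta>] by blast
  \<comment> \<open>Here gamma \<le> 1 lets the bound \<open>q\<close> for \<open>hankel_sq\<close>
    carry over to \<open>k\<close>.\<close>
  have contr: "nrm ?M (kint ?M k f) \<le> q * nrm ?M f" if f: "sq ?M f" for f :: "real \<Rightarrow> real"
  proof -
    have "nrm ?M (kint ?M k f) = nrm ?M (\<lambda>x. \<gamma> *\<^sub>R kint ?M (hankel_sq \<alpha>) f x)"
      using kint_k[OF _ sq_measurable[OF f]] by (intro nrm_cong)
    also have "\<dots> = \<gamma> * nrm ?M (kint ?M (hankel_sq \<alpha>) f)" unfolding nrm_scaleR using \<gamma> by simp
    also have "\<dots> \<le> 1 * nrm ?M (kint ?M (hankel_sq \<alpha>) f)" using \<gamma> by (intro mult_right_mono nrm_nonneg) auto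
    also have "\<dots> \<le> q * nrm ?M f" using q(3)[OF f] by simp
    finally show ?thesis .
  qed
  have S: "bessel_S \<alpha> \<gamma> \<zeta> = iop ?M (\<lambda>x t. - k x t)" by (simp add: bessel_S_eq k_def)
  have fac: "invertible_op ?M (bessel_S \<alpha> \<gamma> \<zeta>)" "factorable \<zeta> (bessel_S \<alpha> \<gamma> \<zeta>)"
    unfolding S using triangular_factorization[OF \<alpha> \<zeta> kk k_sym q(1,2) contr] by auto
  have gram: "kint ?M k f x = \<gamma> *\<^sub>R kint ?M (kcomp ?N (\<lambda>x s. hankel \<alpha> s x) (hankel \<alpha>)) f x"
    if "sq ?M (f :: real \<Rightarrow> complex)" "x \<in> space ?M" for f x
    using kint_k[OF that(2) sq_measurable[OF that(1)]] by (simp add: hankel_sq_def)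
  have trace: "trace_class_op ?M (bessel_K \<alpha> \<gamma> \<zeta>)"
    unfolding bessel_K_eq k_def[symmetric]
    by (rule trace_class_Gram(2)[OF h wN wM less_imp_le[OF \<gamma>(1)] kk k_sym gram])
  have nk: "kern ?M (pw \<alpha>) ?M (pw \<alpha>) (\<lambda>x t. - k x t)" by (rule kern_uminus[OF kk])
  \<comment> \<open>The quadratic form of S is the squared norm of f minus gamma times that of T f,
    so positivity is the contraction property for complex f.\<close>
  have S_inner: "L2_inner ?M (bessel_S \<alpha> \<gamma> \<zeta> f) f = of_real ((nrm ?M f)^2 - \<gamma> * (nrm ?N (kint ?M (hankel \<alpha>) f))^2)"
    if f: "sq ?M f" for f
  proof -
    have "L2_inner ?M (kint ?M (\<lambda>x t. - k x t) f) f
        = (LINT x|?M. (- \<gamma>) *\<^sub>R (kint ?M (kcomp ?N (\<lambda>x s. hankel \<alpha> s x) (hankel \<alpha>)) f x * cnj (f x)))"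
      unfolding L2_inner_def using gram[OF f]
      by (intro Bochner_Integration.integral_cong) (auto simp: kint_uminus_kern)
    also have "\<dots> = (- \<gamma>) *\<^sub>R L2_inner ?M (kint ?M (kcomp ?N (\<lambda>x s. hankel \<alpha> s x) (hankel \<alpha>)) f) f"
      unfolding L2_inner_def by (simp only: integral_scaleR_right)
    finally show ?thesis
      unfolding S L2_inner_iop[OF nk wM f f] L2_inner_self
      by (simp add: L2_inner_Gram[OF h wN wM f] scaleR_conv_of_real)
  qed
  have "positive_op ?M (bessel_S \<alpha> \<gamma> \<zeta>)"
    unfolding positive_op_def
  proof (intro conjI ballI)
    show "bounded_op ?M (bessel_S \<alpha> \<gamma> \<zeta>)" unfolding S by (rule bounded_op_iop[OF nk wM])
    fix f :: "real \<Rightarrow> complex" assume "f \<in> L2 ?M"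
    then have f: "sq ?M f" by (simp add: L2_iff_sq)
    show "L2_inner ?M (bessel_S \<alpha> \<gamma> \<zeta> f) f \<in> \<real>" unfolding S_inner[OF f] by simp
    have "\<gamma> * (nrm ?N (kint ?M (hankel \<alpha>) f))^2 \<le> 1 * (nrm ?M f)^2"
      using \<gamma> hankel_contraction[OF \<alpha> _ \<zeta> f, of 1] by (intro mult_mono power_mono nrm_nonneg) auto
    then show "0 \<le> Re (L2_inner ?M (bessel_S \<alpha> \<gamma> \<zeta> f) f)" unfolding S_inner[OF f] by simp
  qed
  with fac trace show ?thesis by blast
qed

end
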